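(* Let $m,n,p,q$ be integers with $0\le m\le q$, $0\le n\le p$, let $a_i,b_j\in\mathbb{C}$ and $\alpha_i,\beta_j>0$ ($1\le i\le p$, $1\le j\le q$), and let $\mathcal H(s)$, $\Delta$, $\delta$, $H^{m,n}_{p,q}(z)$, $b_{jl}$, $N^*_{jl}$, $h^*_{jl}$, $H^*_{jli}$ be as defined in the context. Assume $$\beta_j(a_i-1-k)\ne\alpha_i(b_j+l)\qquad(i=1,\dots,n;\ j=1,\dots,m;\ k,l\in\mathbb N_0),$$ and let either $\Delta>0$, $z\ne0$, or $\Delta=0$, $0<|z|<\delta$. Then the $H$-function has the power-logarithmic series expansion $$H^{m,n}_{p,q}(z)={\sum_{j,l}}'\,h^*_{jl}\,z^{(b_j+l)/\beta_j}+{\sum_{j,l}}''\,\sum_{i=0}^{N^*_{jl}-1}H^*_{jli}\,z^{(b_j+l)/\beta_j}[\log z]^i .$$ Here $\sum'$ is taken over the pairs $(j,l)$ ($j=1,\dots,m$; $l\in\mathbb N_0$) with $N^*_{jl}=1$ (simple poles), and $\sum''$ is taken over the pairs with $N^*_{jl}\ge2$, where for each point $b$ that equals $b_{jl}$ for several pairs $(j,l)$ exactly one such pair is included in the sum.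
   Context: $\mathbb N_0=\{0,1,2,\dots\}$. Definitions (empty products equal $1$, and $1/\Gamma$ is entire, so $1/\Gamma=0$ at the poles of $\Gamma$): $$\mathcal H(s)=\frac{\prod_{j=1}^m\Gamma(b_j+\beta_js)\ \prod_{i=1}^n\Gamma(1-a_i-\alpha_is)}{\prod_{i=n+1}^p\Gamma(a_i+\alpha_is)\ \prod_{j=m+1}^q\Gamma(1-b_j-\beta_js)},\qquad \Delta=\sum_{j=1}^q\beta_j-\sum_{i=1}^p\alpha_i,\qquad \delta=\prod_{i=1}^p\alpha_i^{-\alpha_i}\prod_{j=1}^q\beta_j^{\beta_j},$$ $$H^{m,n}_{p,q}(z)=\frac1{2\pi i}\int_{\mathfrak L_{-\infty}}\mathcal H(s)z^{-s}\,ds .$$ $\mathfrak L_{-\infty}$ is a loop running from $-\infty+i\varphi_1$ to $-\infty+i\varphi_2$, $\varphi_1<\varphi_2$ (consisting of the half-lines $\operatorname{Im}s=\varphi_1,\varphi_2$ for $\operatorname{Re}s$ sufficiently negative), with all poles of $\Gamma(b_j+\beta_js)$ ($1\le j\le m$) to its left (inside the loop) and all poles of $\Gamma(1-a_i-\alpha_is)$ ($1\le i\le n$) to its right (outside the loop). Powers are $z^{c}=\exp(c\log z)$ with one and the same choice of $\log z$ throughout. For $j=1,\dots,m$, $l\in\mathbb N_0$ put $b_{jl}=-(b_j+l)/\beta_j$, let $J=J_{jl}\subseteq\{1,\dots,m\}$ be the set of indices $r$ such that $\Gamma(b_r+\beta_rs)$ has a pole at $s=b_{jl}$ (i.e. $b_{jl}=-(b_r+l_r)/\beta_r$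 for some $l_r\in\mathbb N_0$), and let $N^*_{jl}=|J_{jl}|$ (the order of the pole of $\prod_{r=1}^m\Gamma(b_r+\beta_rs)$ at $b_{jl}$). If $N^*_{jl}=1$, $$h^*_{jl}=\frac{(-1)^l}{l!\,\beta_j}\ \frac{\prod_{i=1,\,i\ne j}^m\Gamma\!\left(b_i-[b_j+l]\frac{\beta_i}{\beta_j}\right)\prod_{i=1}^n\Gamma\!\left(1-a_i+[b_j+l]\frac{\alpha_i}{\beta_j}\right)}{\prod_{i=n+1}^p\Gamma\!\left(a_i-[b_j+l]\frac{\alpha_i}{\beta_j}\right)\prod_{i=m+1}^q\Gamma\!\left(1-b_i+[b_j+l]\frac{\beta_i}{\beta_j}\right)} .$$ If $N^*_{jl}\ge2$, write $N^*=N^*_{jl}$, $b=b_{jl}$, and set $$\mathcal H_1^*(s)=(s-b)^{N^*}\prod_{r\in J}\Gamma(b_r+\beta_rs),\qquad \mathcal H_2^*(s)=\frac{\mathcal H(s)}{\prod_{r\in J}\Gamma(b_r+\beta_rs)}$$ (both extended analytically to $s=b$). For $0\le i\le N^*-1$, $$H^*_{jli}=\frac1{(N^*-1)!}\sum_{\nu=i}^{N^*-1}(-1)^i\binom{N^*-1}{\nu}\binom{\nu}{i}\left[\mathcal H_1^*\right]^{(N^*-1-\nu)}(b)\,\left[\mathcal H_2^*\right]^{(\nu-i)}(b),$$ where $[\cdot]^{(r)}$ denotes the $r$-th derivative.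
   Formalization: The series can diverge when distinct poles nearly coincide, so the expansion is the limit of sums over poles with Re b_jl > -R, R→∞ avoiding poles; both sums converge absolutely, with literal equality, if distinct poles do not approach one another exponentially fast. *)

theory Defs
  imports "HOL-Complex_Analysis.Complex_Analysis"
begin

text \<open>
  Parameters are families a, b, alpha, beta of which only the indices 1..p (for a, alpha)
  and 1..q (for b, beta) are used.  Reciprocals of Gamma are written with the entire function
  rGamma; Gamma itself has the value 0 at its poles in the library.
\<close>

definition H_kernel :: "nat \<Rightarrow> nat \<Rightarrow> nat \<Rightarrow> nat \<Rightarrow> (nat \<Rightarrow> complex) \<Rightarrow> (nat \<Rightarrow> real) \<Rightarrow>
    (nat \<Rightarrow> complex) \<Rightarrow> (nat \<Rightarrow> real) \<Rightarrow> complex \<Rightarrow> complex" where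
  "H_kernel m n p q a \<alpha> b \<beta> s =
     (\<Prod>j=1..m. Gamma (b j + of_real (\<beta> j) * s)) *
     (\<Prod>i=1..n. Gamma (1 - a i - of_real (\<alpha> i) * s)) *
     (\<Prod>i=n+1..p. rGamma (a i + of_real (\<alpha> i) * s)) *
     (\<Prod>j=m+1..q. rGamma (1 - b j - of_real (\<beta> j) * s))"

definition H_Delta :: "nat \<Rightarrow> nat \<Rightarrow> (nat \<Rightarrow> real) \<Rightarrow> (nat \<Rightarrow> real) \<Rightarrow> real" where
  "H_Delta p q \<alpha> \<beta> = (\<Sum>j=1..q. \<beta> j) - (\<Sum>i=1..p. \<alpha> i)"

definition H_delta :: "nat \<Rightarrow> nat \<Rightarrow> (nat \<Rightarrow> real) \<Rightarrow> (nat \<Rightarrow> real) \<Rightarrow> real" where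
  "H_delta p q \<alpha> \<beta> = (\<Prod>i=1..p. \<alpha> i powr (- \<alpha> i)) * (\<Prod>j=1..q. \<beta> j powr \<beta> j)"

definition b_pole :: "(nat \<Rightarrow> complex) \<Rightarrow> (nat \<Rightarrow> real) \<Rightarrow> nat \<Rightarrow> nat \<Rightarrow> complex" where
  "b_pole b \<beta> j l = - (b j + of_nat l) / of_real (\<beta> j)"

definition a_pole :: "(nat \<Rightarrow> complex) \<Rightarrow> (nat \<Rightarrow> real) \<Rightarrow> nat \<Rightarrow> nat \<Rightarrow> complex" where
  "a_pole a \<alpha> i k = (1 - a i + of_nat k) / of_real (\<alpha> i)"

text \<open>
  A loop is given by the ordinates phi1 < phi2, an abscissa X and an arc g from X + i phi1
  to X + i phi2: it runs along the half-line from -infinity + i phi1 to X + i phi1, then along g,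
  then along the half-line from X + i phi2 to -infinity + i phi2.  The closed curve
  loop_closed_at Y is obtained by cutting the loop at Re s = Y and joining the two ends by a
  vertical segment.  A point lies inside (outside) the loop if it lies inside (outside) these
  closed curves for all sufficiently negative Y.
\<close>

definition loop_closed_at :: "real \<Rightarrow> real \<Rightarrow> real \<Rightarrow> (real \<Rightarrow> complex) \<Rightarrow> real \<Rightarrow> complex set" where
  "loop_closed_at \<phi>1 \<phi>2 X g Y =
     path_image g \<union> closed_segment (Complex Y \<phi>1) (Complex X \<phi>1)
       \<union> closed_segment (Complex X \<phi>2) (Complex Y \<phi>2)
       \<union> closed_segment (Complex Y \<phi>2) (Complex Y \<phi>1)"

definition is_H_loop :: "nat \<Rightarrow> nat \<Rightarrow> (nat \<Rightarrow> complex) \<Rightarrow> (nat \<Rightarrow> real) \<Rightarrow> (nat \<Rightarrow> complex) \<Rightarrow>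
    (nat \<Rightarrow> real) \<Rightarrow> real \<Rightarrow> real \<Rightarrow> real \<Rightarrow> (real \<Rightarrow> complex) \<Rightarrow> bool" where
  "is_H_loop m n a \<alpha> b \<beta> \<phi>1 \<phi>2 X g \<longleftrightarrow>
     \<phi>1 < \<phi>2 \<and> valid_path g \<and> arc g \<and>
     pathstart g = Complex X \<phi>1 \<and> pathfinish g = Complex X \<phi>2 \<and>
     (\<forall>x<X. Complex x \<phi>1 \<notin> path_image g \<and> Complex x \<phi>2 \<notin> path_image g) \<and>
     (\<forall>j\<in>{1..m}. \<forall>l. \<forall>\<^sub>F Y in at_bot. b_pole b \<beta> j l \<in> inside (loop_closed_at \<phi>1 \<phi>2 X g Y)) \<and>
     (\<forall>i\<in>{1..n}. \<forall>k. \<forall>\<^sub>F Y in at_bot. a_pole a \<alpha> i k \<in> outside (loop_closed_at \<phi>1 \<phi>2 X g Y))"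

definition loop_integral ::
    "real \<Rightarrow> real \<Rightarrow> real \<Rightarrow> (real \<Rightarrow> complex) \<Rightarrow> (complex \<Rightarrow> complex) \<Rightarrow> complex" where
  "loop_integral \<phi>1 \<phi>2 X g f =
     integral {..X} (\<lambda>x. f (Complex x \<phi>1)) + contour_integral g f
       - integral {..X} (\<lambda>x. f (Complex x \<phi>2))"

text \<open>The argument w is the chosen value of log z, so that the power of z with exponent c is exp (c * w).\<close>

definition H_fun :: "nat \<Rightarrow> nat \<Rightarrow> nat \<Rightarrow> nat \<Rightarrow> (nat \<Rightarrow> complex) \<Rightarrow> (nat \<Rightarrow> real) \<Rightarrow>
    (nat \<Rightarrow> complex) \<Rightarrow> (nat \<Rightarrow> real) \<Rightarrow> real \<Rightarrow> real \<Rightarrow> real \<Rightarrow> (real \<Rightarrow> complex) \<Rightarrow>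
    complex \<Rightarrow> complex" where
  "H_fun m n p q a \<alpha> b \<beta> \<phi>1 \<phi>2 X g w =
     1 / (2 * of_real pi * \<i>) *
     loop_integral \<phi>1 \<phi>2 X g (\<lambda>s. H_kernel m n p q a \<alpha> b \<beta> s * exp (- s * w))"

definition pole_J :: "nat \<Rightarrow> (nat \<Rightarrow> complex) \<Rightarrow> (nat \<Rightarrow> real) \<Rightarrow> nat \<Rightarrow> nat \<Rightarrow> nat set" where
  "pole_J m b \<beta> j l = {r \<in> {1..m}. \<exists>k. b_pole b \<beta> j l = b_pole b \<beta> r k}"

definition pole_N :: "nat \<Rightarrow> (nat \<Rightarrow> complex) \<Rightarrow> (nat \<Rightarrow> real) \<Rightarrow> nat \<Rightarrow> nat \<Rightarrow> nat" where
  "pole_N m b \<beta> j l = card (pole_J m b \<beta> j l)"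

definition h_star :: "nat \<Rightarrow> nat \<Rightarrow> nat \<Rightarrow> nat \<Rightarrow> (nat \<Rightarrow> complex) \<Rightarrow> (nat \<Rightarrow> real) \<Rightarrow>
    (nat \<Rightarrow> complex) \<Rightarrow> (nat \<Rightarrow> real) \<Rightarrow> nat \<Rightarrow> nat \<Rightarrow> complex" where
  "h_star m n p q a \<alpha> b \<beta> j l =
     (-1) ^ l / (fact l * of_real (\<beta> j)) *
     ((\<Prod>i\<in>{1..m} - {j}. Gamma (b i - (b j + of_nat l) * of_real (\<beta> i / \<beta> j))) *
      (\<Prod>i=1..n. Gamma (1 - a i + (b j + of_nat l) * of_real (\<alpha> i / \<beta> j))) *
      (\<Prod>i=n+1..p. rGamma (a i - (b j + of_nat l) * of_real (\<alpha> i / \<beta> j))) *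
      (\<Prod>i=m+1..q. rGamma (1 - b i + (b j + of_nat l) * of_real (\<beta> i / \<beta> j))))"

text \<open>Both functions below have removable singularities at the pole; remove_sings extends them
  analytically.\<close>

definition H1_star ::
    "nat \<Rightarrow> (nat \<Rightarrow> complex) \<Rightarrow> (nat \<Rightarrow> real) \<Rightarrow> nat \<Rightarrow> nat \<Rightarrow> complex \<Rightarrow> complex" where
  "H1_star m b \<beta> j l =
     remove_sings (\<lambda>s. (s - b_pole b \<beta> j l) ^ pole_N m b \<beta> j l *
       (\<Prod>r\<in>pole_J m b \<beta> j l. Gamma (b r + of_real (\<beta> r) * s)))"

definition H2_star :: "nat \<Rightarrow> nat \<Rightarrow> nat \<Rightarrow> nat \<Rightarrow> (nat \<Rightarrow> complex) \<Rightarrow> (nat \<Rightarrow> real) \<Rightarrow>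
    (nat \<Rightarrow> complex) \<Rightarrow> (nat \<Rightarrow> real) \<Rightarrow> nat \<Rightarrow> nat \<Rightarrow> complex \<Rightarrow> complex" where
  "H2_star m n p q a \<alpha> b \<beta> j l =
     remove_sings (\<lambda>s. H_kernel m n p q a \<alpha> b \<beta> s /
       (\<Prod>r\<in>pole_J m b \<beta> j l. Gamma (b r + of_real (\<beta> r) * s)))"

definition H_star :: "nat \<Rightarrow> nat \<Rightarrow> nat \<Rightarrow> nat \<Rightarrow> (nat \<Rightarrow> complex) \<Rightarrow> (nat \<Rightarrow> real) \<Rightarrow>
    (nat \<Rightarrow> complex) \<Rightarrow> (nat \<Rightarrow> real) \<Rightarrow> nat \<Rightarrow> nat \<Rightarrow> nat \<Rightarrow> complex" where
  "H_star m n p q a \<alpha> b \<beta> j l i =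
     (let N = pole_N m b \<beta> j l; c = b_pole b \<beta> j l in
      1 / fact (N - 1) *
      (\<Sum>\<nu>=i..N-1. (-1) ^ i * of_nat ((N - 1) choose \<nu>) * of_nat (\<nu> choose i) *
         (deriv ^^ (N - 1 - \<nu>)) (H1_star m b \<beta> j l) c *
         (deriv ^^ (\<nu> - i)) (H2_star m n p q a \<alpha> b \<beta> j l) c))"

definition simple_pairs :: "nat \<Rightarrow> (nat \<Rightarrow> complex) \<Rightarrow> (nat \<Rightarrow> real) \<Rightarrow> (nat \<times> nat) set" where
  "simple_pairs m b \<beta> = {(j, l). j \<in> {1..m} \<and> pole_N m b \<beta> j l = 1}"

definition multiple_pairs :: "nat \<Rightarrow> (nat \<Rightarrow> complex) \<Rightarrow> (nat \<Rightarrow> real) \<Rightarrow> (nat \<times> nat) set" where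
  "multiple_pairs m b \<beta> = {(j, l). j \<in> {1..m} \<and> pole_N m b \<beta> j l \<ge> 2}"

definition is_pole_choice ::
    "nat \<Rightarrow> (nat \<Rightarrow> complex) \<Rightarrow> (nat \<Rightarrow> real) \<Rightarrow> (nat \<times> nat) set \<Rightarrow> bool" where
  "is_pole_choice m b \<beta> S \<longleftrightarrow>
     S \<subseteq> multiple_pairs m b \<beta> \<and>
     (\<forall>(j, l)\<in>multiple_pairs m b \<beta>. \<exists>!x. x \<in> S \<and> b_pole b \<beta> (fst x) (snd x) = b_pole b \<beta> j l)"

definition simple_term :: "nat \<Rightarrow> nat \<Rightarrow> nat \<Rightarrow> nat \<Rightarrow> (nat \<Rightarrow> complex) \<Rightarrow> (nat \<Rightarrow> real) \<Rightarrow>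
    (nat \<Rightarrow> complex) \<Rightarrow> (nat \<Rightarrow> real) \<Rightarrow> complex \<Rightarrow> nat \<times> nat \<Rightarrow> complex" where
  "simple_term m n p q a \<alpha> b \<beta> w =
     (\<lambda>(j, l). h_star m n p q a \<alpha> b \<beta> j l * exp ((b j + of_nat l) / of_real (\<beta> j) * w))"

definition multiple_term :: "nat \<Rightarrow> nat \<Rightarrow> nat \<Rightarrow> nat \<Rightarrow> (nat \<Rightarrow> complex) \<Rightarrow> (nat \<Rightarrow> real) \<Rightarrow>
    (nat \<Rightarrow> complex) \<Rightarrow> (nat \<Rightarrow> real) \<Rightarrow> complex \<Rightarrow> nat \<times> nat \<Rightarrow> complex" where
  "multiple_term m n p q a \<alpha> b \<beta> w =
     (\<lambda>(j, l). \<Sum>i=0..pole_N m b \<beta> j l - 1.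
        H_star m n p q a \<alpha> b \<beta> j l i * exp ((b j + of_nat l) / of_real (\<beta> j) * w) * w ^ i)"

text \<open>
  Mode of convergence.  The expansion is a residue series, and distinct poles may come arbitrarily
  close to each other.  The residues at two nearby poles are then individually huge and nearly
  cancel.  For example, take m = q = 2, n = p = 0, b = (0, 0), beta = (1, t): the residue term at
  s = -l (l > 0) is (-1)^l / l! * Gamma (- l t) * z^l, and for Liouville numbers t that are very
  well approximable by rationals these terms are unbounded, so that the two sums diverge as
  ordinary series in any arrangement of single terms.  In general the sums therefore have to be
  taken over all poles with Re s > -R, for R tending to infinity such that the line Re s = -R
  stays away from the poles (pole_gaps).  If distinct poles do not approach each other
  exponentially fast (poles_apart; for example if all quotients of the beta are rational), both
  sums converge absolutely.
\<close>

definition pole_gaps :: "nat \<Rightarrow> (nat \<Rightarrow> complex) \<Rightarrow> (nat \<Rightarrow> real) \<Rightarrow> (nat \<Rightarrow> real) \<Rightarrow> bool" where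
  "pole_gaps m b \<beta> R \<longleftrightarrow>
     filterlim R at_top sequentially \<and>
     (\<exists>\<epsilon>>0. \<forall>k. \<forall>j\<in>{1..m}. \<forall>l. \<epsilon> \<le> \<bar>Re (b_pole b \<beta> j l) + R k\<bar>)"

definition right_of :: "(nat \<Rightarrow> complex) \<Rightarrow> (nat \<Rightarrow> real) \<Rightarrow> real \<Rightarrow> (nat \<times> nat) set" where
  "right_of b \<beta> r = {(j, l). - r < Re (b_pole b \<beta> j l)}"

definition poles_apart :: "nat \<Rightarrow> (nat \<Rightarrow> complex) \<Rightarrow> (nat \<Rightarrow> real) \<Rightarrow> bool" where
  "poles_apart m b \<beta> \<longleftrightarrow>
     (\<forall>\<eta>>0. \<exists>c>0. \<forall>j\<in>{1..m}. \<forall>r\<in>{1..m}. \<forall>l k. b_pole b \<beta> j l \<noteq> b_pole b \<beta> r k \<longrightarrow>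
        c * exp (- \<eta> * norm (b_pole b \<beta> j l)) \<le> dist (b_pole b \<beta> j l) (b_pole b \<beta> r k))"

end

theory Submission
  imports Defs "HOL-Real_Asymp.Real_Asymp"
begin

text \<open>
  Cut the loop at an abscissa \<open>Re s = - R\<close> that keeps a fixed distance from the poles.  The resulting closed
  curve is simple, winds once around the poles of the first Gamma product with \<open>Re s > - R\<close>, and around no
  pole of the second one, so the residue theorem turns the integral over it into a finite sum of residues.
  Far to the left the reflection formula replaces the Gamma functions of the first product by reciprocals of
  Gamma functions with large positive real part, at the price of a factor \<open>1 / sin\<close>, which is bounded away
  from the poles.  There the integrand has size
  \<open>exp (- \<Delta> t ln t + (\<Delta> - ln \<delta> + ln |z|) t + O(ln t))\<close> with \<open>t = - Re s\<close>, hence it decays exponentially under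
  either hypothesis on \<open>z\<close>: the vertical segment contributes nothing in the limit, and the half-lines converge.
  The residues are evaluated by the Leibniz rule.  If the poles do not approach each other exponentially
  fast, the same estimate on small circles makes the residues themselves decay exponentially.
\<close>

section \<open>Growth of the Gamma function in strips\<close>

text \<open>Reflection is applied to the first Gamma product and also to the reciprocals 1/Gamma(a_i
  + \<alpha>_i s), so that all arguments move to the right as t grows. Every \<alpha>_i then
  contributes \<alpha> t ln t + \<alpha> (ln \<alpha> - 1) t to the exponent and every \<beta>_j the
  negative of this; therefore only \<Delta> and \<delta> appear, whatever m and n are. The loss
  through 1 / sin is kept explicit as a factor (1/d)^m, where d bounds the distance of the Gamma
  arguments from their poles, with a decay rate fixed before d. On the half-lines and on the cuts d
  is constant; on circles around poles that approach each other it shrinks with the circle. The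
  other obstacle is topological: the arc is arbitrary, and the poles are known to be inside or
  outside only for sufficiently negative cuts. Orientation and winding numbers at a given cut are
  found by comparing two cuts, whose closed curves differ by the boundary of a rectangle.\<close>

lemma ln_recurrence_upper:
  fixes x K :: real
  assumes "x \<ge> 1" "K \<ge> 0"
  defines "F \<equiv> \<lambda>x::real. x * ln x - x + 2 * K * ln x"
  shows "ln (x + K) + F x \<le> F (x + 1)"
proof -
  have l1: "ln (x + K) \<le> ln x + K / x"
  proof -
    have "ln (x + K) = ln x + ln (1 + K / x)"
      using assms by (subst ln_mult_pos [symmetric]) (auto intro!: add_pos_nonneg simp: ring_distribs)
    also have "ln (1 + K / x) \<le> K / x"
      using assms by (intro ln_add_one_self_le_self) auto
    finally show ?thesis by simp
  qed
  have l2: "ln (x + 1) - ln x \<ge> 1 / (x + 1)"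
  proof -
    have "ln (x / (x + 1)) \<le> x / (x + 1) - 1"
      using assms by (intro ln_le_minus_one) auto
    moreover have "x / (x + 1) - 1 = - (1 / (x + 1))" using assms by (simp add: field_simps)
    ultimately show ?thesis using assms by (simp add: ln_div)
  qed
  have l3: "(x + 1) * (ln (x + 1) - ln x) \<ge> 1"
    using mult_left_mono[OF l2, of "x + 1"] assms by simp
  \<comment> \<open>The coefficient 2 K pays for the step from ln x to ln (x + K), which costs K /
    x: the increment of ln is at least 1 / (x + 1), and x + 1 \<le> 2 x.\<close>
  have l4: "2 * K * (ln (x + 1) - ln x) \<ge> K / x"
  proof -
    have "K / x \<le> 2 * K * (1 / (x + 1))"
      using assms mult_left_mono[of 1 x K] by (simp add: field_simps)
    also have "\<dots> \<le> 2 * K * (ln (x + 1) - ln x)"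
      using l2 assms by (intro mult_left_mono) auto
    finally show ?thesis .
  qed
  have "F (x + 1) - F x = ln x + ((x + 1) * (ln (x + 1) - ln x) - 1) + 2 * K * (ln (x + 1) - ln x)"
    unfolding F_def by (simp add: algebra_simps)
  then show ?thesis using l1 l3 l4 by linarith
qed

text \<open>As \<open>norm z \<ge> Re z\<close>, a subsolution of F (x + 1) = ln x + F x propagates
  lower bounds for ln |Gamma|. Subtracting 2 ln x changes the factor x + 1 of ln (x + 1) - ln x into
  x - 1, and (x - 1) / x \<le> 1.\<close>

lemma ln_recurrence_lower:
  fixes x :: real
  assumes "x \<ge> 1"
  defines "F \<equiv> \<lambda>x::real. x * ln x - x - 2 * ln x"
  shows "F (x + 1) \<le> ln x + F x"
proof -
  have l1: "ln (x + 1) - ln x \<le> 1 / x"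
  proof -
    have "ln (x + 1) = ln x + ln (1 + 1 / x)"
      using assms by (subst ln_mult_pos [symmetric]) (auto intro!: add_pos_nonneg simp: ring_distribs)
    also have "ln (1 + 1 / x) \<le> 1 / x"
      using assms by (intro ln_add_one_self_le_self) auto
    finally show ?thesis by simp
  qed
  have l2: "(x - 1) * (ln (x + 1) - ln x) \<le> 1"
  proof -
    have "(x - 1) * (ln (x + 1) - ln x) \<le> (x - 1) * (1 / x)"
      using l1 assms by (intro mult_left_mono) auto
    also have "\<dots> \<le> 1" using assms by (simp add: field_simps)
    finally show ?thesis .
  qed
  have "F (x + 1) - F x = ln x + ((x - 1) * (ln (x + 1) - ln x) - 1)"
    unfolding F_def by (simp add: algebra_simps)
  then show ?thesis using l2 by linarith
qed

lemma notin_nonpos_Ints_if_Re_pos: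
  fixes z :: complex
  assumes "Re z > 0"
  shows "z \<notin> \<int>\<^sub>\<le>\<^sub>0"
proof
  assume "z \<in> \<int>\<^sub>\<le>\<^sub>0"
  then obtain k where "z = - of_nat k" by (auto elim: nonpos_Ints_cases')
  then show False using assms by simp
qed

text \<open>The functional equation propagates the bounds from the compact set
  \<open>1 \<le> Re z \<le> 2\<close>; this replaces Stirling's formula.\<close>
lemma Gamma_strip_bounds:
  fixes K :: real
  assumes "K \<ge> 0"
  obtains M where "\<And>z. Re z \<ge> 1 \<Longrightarrow> \<bar>Im z\<bar> \<le> K \<Longrightarrow>
    \<bar>ln (norm (Gamma z)) - (Re z * ln (Re z) - Re z)\<bar> \<le> M + (2 * K + 2) * ln (Re z)"
proof -
  define D where "D = cbox (Complex 1 (-K)) (Complex 2 K)"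
  define U where "U = (\<lambda>x::real. x * ln x - x + 2 * K * ln x)"
  define L where "L = (\<lambda>x::real. x * ln x - x - 2 * ln x)"
  have npos: "z \<notin> \<int>\<^sub>\<le>\<^sub>0" if "Re z \<ge> 1" for z :: complex
    using that by (intro notin_nonpos_Ints_if_Re_pos) simp
  have comp: "compact D" by (auto simp: D_def)
  have reD: "Re z \<ge> 1" "Re z \<le> 2" if "z \<in> D" for z
    using that by (auto simp: D_def in_cbox_complex_iff)
  have cont1: "continuous_on D (\<lambda>z. ln (norm (Gamma z)) - U (Re z))"
    unfolding U_def using reD npos
    by (intro continuous_intros) (force simp: Gamma_eq_zero_iff)+
  have cont2: "continuous_on D (\<lambda>z. ln (norm (Gamma z)) - L (Re z))"
    unfolding L_def using reD npos
    by (intro continuous_intros) (force simp: Gamma_eq_zero_iff)+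
  obtain M1 where M1: "\<And>z. z \<in> D \<Longrightarrow> \<bar>ln (norm (Gamma z)) - U (Re z)\<bar> \<le> M1"
    using compact_imp_bounded[OF compact_continuous_image[OF cont1 comp]]
    by (auto simp: bounded_iff)
  obtain M2 where M2: "\<And>z. z \<in> D \<Longrightarrow> \<bar>ln (norm (Gamma z)) - L (Re z)\<bar> \<le> M2"
    using compact_imp_bounded[OF compact_continuous_image[OF cont2 comp]]
    by (auto simp: bounded_iff)
  \<comment> \<open>Translation by 1 keeps the imaginary part, so the strip is preserved; N counts
    the translations back to D.\<close>
  have main: "ln (norm (Gamma z)) \<le> U (Re z) + M1 \<and> L (Re z) - M2 \<le> ln (norm (Gamma z))"
    if "Re z \<ge> 1" "\<bar>Im z\<bar> \<le> K" "Re z \<le> real N + 2" for z N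
    using that
  proof (induction N arbitrary: z)
    case 0
    then have "z \<in> D" by (auto simp: D_def in_cbox_complex_iff)
    from M1[OF this] M2[OF this] show ?case by linarith
  next
    case (Suc N)
    show ?case
    proof (cases "Re z \<le> 2")
      case True
      with Suc.prems have "z \<in> D" by (auto simp: D_def in_cbox_complex_iff)
      from M1[OF this] M2[OF this] show ?thesis by linarith
    next
      case False
      define y where "y = z - 1"
      have y: "Re y \<ge> 1" "\<bar>Im y\<bar> \<le> K" "Re y \<le> real N + 2" "z = y + 1"
        using Suc.prems False by (auto simp: y_def)
      note IH = Suc.IH[OF y(1-3)]
      have "Gamma z = y * Gamma y" using Gamma_plus1[OF npos[OF y(1)]] y(4) by simp
      moreover have "Gamma y \<noteq> 0" "y \<noteq> 0" using npos[OF y(1)] y(1) by (auto simp: Gamma_eq_zero_iff)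
      ultimately have eq: "ln (norm (Gamma z)) = ln (norm y) + ln (norm (Gamma y))"
        by (simp add: norm_mult ln_mult_pos)
      have n1: "Re y \<le> norm y" using complex_Re_le_cmod by auto
      have n2: "norm y \<le> Re y + K" using cmod_le[of y] y by linarith
      have "ln (norm y) \<le> ln (Re y + K)" "ln (Re y) \<le> ln (norm y)"
        using n1 n2 y(1) by (intro ln_mono; linarith)+
      moreover have "Re z = Re y + 1" using y by simp
      ultimately show ?thesis
        using IH eq ln_recurrence_upper[OF y(1) assms] ln_recurrence_lower[OF y(1)]
        unfolding U_def L_def by simp
    qed
  qed
  show ?thesis
  proof (rule that[of "\<bar>M1\<bar> + \<bar>M2\<bar>"])
    fix z assume z: "Re z \<ge> 1" "\<bar>Im z\<bar> \<le> K"
    have "Re z \<le> real (nat \<lceil>Re z\<rceil>) + 2" by linarith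
    from main[OF z this] have m: "ln (norm (Gamma z)) \<le> U (Re z) + M1" "L (Re z) - M2 \<le> ln (norm (Gamma z))"
      by auto
    have "ln (Re z) \<ge> 0" using z by simp
    then have "0 \<le> 2 * K * ln (Re z)" using assms by simp
    then show "\<bar>ln (norm (Gamma z)) - (Re z * ln (Re z) - Re z)\<bar> \<le> \<bar>M1\<bar> + \<bar>M2\<bar> + (2 * K + 2) * ln (Re z)"
      using m \<open>ln (Re z) \<ge> 0\<close> unfolding U_def L_def ring_distribs by linarith
  qed
qed

text \<open>Expresses the main term at c + \<alpha> t through t. The shift costs only c ln t + O(1),
  and beyond e constants are absorbed by ln t \<ge> 1.\<close>

lemma shift_asymptotics:
  fixes \<alpha> c :: real
  assumes "\<alpha> > 0"
  obtains M T where "T \<ge> exp 1"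
    "\<And>t. t \<ge> T \<Longrightarrow> c + \<alpha> * t \<ge> 1 \<and> ln (c + \<alpha> * t) \<le> M * ln t \<and>
       \<bar>((c + \<alpha> * t) * ln (c + \<alpha> * t) - (c + \<alpha> * t)) - (\<alpha> * (t * ln t) + \<alpha> * (ln \<alpha> - 1) * t)\<bar> \<le> M * ln t"
proof -
  have "(\<lambda>t. ln (c + \<alpha> * t)) \<in> O(\<lambda>t. ln t)" using assms by real_asymp
  then obtain M1 where M1: "\<forall>\<^sub>F t in at_top. norm (ln (c + \<alpha> * t)) \<le> M1 * norm (ln t :: real)"
    by (elim landau_o.bigE)
  have "(\<lambda>t. ((c + \<alpha> * t) * ln (c + \<alpha> * t) - (c + \<alpha> * t)) - (\<alpha> * (t * ln t) + \<alpha> * (ln \<alpha> - 1) * t)) \<in> O(\<lambda>t::real. ln t)"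
  proof -
    \<comment> \<open>The difference in question after the splitting ln (c + \<alpha> t) = ln
      \<alpha> + ln t + ln (1 + c / (\<alpha> t)); its last summand tends to c, so only c ln t can
      grow.\<close>
    have "(\<lambda>t. (c * ln \<alpha> - c) + c * ln t + (c + \<alpha> * t) * ln (1 + c / (\<alpha> * t))) \<in> O(\<lambda>t::real. ln t)"
    proof (rule sum_in_bigo(1)[OF sum_in_bigo(1)])
      show "(\<lambda>t. c * ln \<alpha> - c) \<in> O(\<lambda>t::real. ln t)" by real_asymp
      show "(\<lambda>t. c * ln t) \<in> O(\<lambda>t::real. ln t)" by simp
      show "(\<lambda>t. (c + \<alpha> * t) * ln (1 + c / (\<alpha> * t))) \<in> O(\<lambda>t::real. ln t)"
        using assms by real_asymp
    qed
    moreover have "\<forall>\<^sub>F t in at_top. (c * ln \<alpha> - c) + c * ln t + (c + \<alpha> * t) * ln (1 + c / (\<alpha> * t)) =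
        ((c + \<alpha> * t) * ln (c + \<alpha> * t) - (c + \<alpha> * t)) - (\<alpha> * (t * ln t) + \<alpha> * (ln \<alpha> - 1) * t)"
    proof -
      have "\<forall>\<^sub>F t in at_top. c + \<alpha> * t > 0" using assms by real_asymp
      with eventually_gt_at_top[of 0] show ?thesis
      proof eventually_elim
        case (elim t)
        have "1 + c / (\<alpha> * t) = (c + \<alpha> * t) / (\<alpha> * t)"
          using elim assms by (simp add: field_simps)
        then have *: "ln (c + \<alpha> * t) = ln (1 + c / (\<alpha> * t)) + (ln \<alpha> + ln t)"
          using elim assms by (simp add: ln_div ln_mult_pos)
        show ?case unfolding * by (simp add: algebra_simps)
      qed
    qed
    ultimately show ?thesis by (simp only: landau_o.big.in_cong)
  qed
  then obtain M2 where M2: "\<forall>\<^sub>F t in at_top. norm (((c + \<alpha> * t) * ln (c + \<alpha> * t) - (c + \<alpha> * t)) - (\<alpha> * (t * ln t) + \<alpha> * (ln \<alpha> - 1) * t)) \<le> M2 * norm (ln t :: real)"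
    by (elim landau_o.bigE)
  have "\<forall>\<^sub>F t in at_top. c + \<alpha> * t \<ge> 1" using assms by real_asymp
  with M1 M2 have "\<forall>\<^sub>F t::real in at_top. c + \<alpha> * t \<ge> 1 \<and> norm (ln (c + \<alpha> * t)) \<le> M1 * norm (ln t) \<and>
    norm (((c + \<alpha> * t) * ln (c + \<alpha> * t) - (c + \<alpha> * t)) - (\<alpha> * (t * ln t) + \<alpha> * (ln \<alpha> - 1) * t)) \<le> M2 * norm (ln t)"
    by eventually_elim auto
  then obtain T where T: "\<And>t. t \<ge> T \<Longrightarrow> c + \<alpha> * t \<ge> 1 \<and> norm (ln (c + \<alpha> * t)) \<le> M1 * norm (ln t) \<and>
    norm (((c + \<alpha> * t) * ln (c + \<alpha> * t) - (c + \<alpha> * t)) - (\<alpha> * (t * ln t) + \<alpha> * (ln \<alpha> - 1) * t)) \<le> M2 * norm (ln t)"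
    by (auto simp: eventually_at_top_linorder)
  show ?thesis
  proof (rule that[of "max T (exp 1)" "max M1 M2"])
    fix t assume t: "max T (exp 1) \<le> t"
    then have "ln t \<ge> 1" by (subst ln_ge_iff) (auto intro: less_le_trans[OF exp_gt_zero])
    then have le: "M1 * ln t \<le> max M1 M2 * ln t" "M2 * ln t \<le> max M1 M2 * ln t"
      by (auto intro!: mult_right_mono)
    have "T \<le> t" using t by simp
    from T[OF this] \<open>ln t \<ge> 1\<close> have "c + \<alpha> * t \<ge> 1" "ln (c + \<alpha> * t) \<le> M1 * ln t"
      "\<bar>((c + \<alpha> * t) * ln (c + \<alpha> * t) - (c + \<alpha> * t)) - (\<alpha> * (t * ln t) + \<alpha> * (ln \<alpha> - 1) * t)\<bar> \<le> M2 * ln t"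
      by auto
    then show "c + \<alpha> * t \<ge> 1 \<and> ln (c + \<alpha> * t) \<le> max M1 M2 * ln t \<and>
       \<bar>((c + \<alpha> * t) * ln (c + \<alpha> * t) - (c + \<alpha> * t)) - (\<alpha> * (t * ln t) + \<alpha> * (ln \<alpha> - 1) * t)\<bar> \<le> max M1 M2 * ln t"
      using le by (blast intro: order.trans)
  qed auto
qed

text \<open>Only the coefficients of t ln t and of t decide about convergence. They are exposed as A
  and B, which add up under products, while errors of order ln t disappear in the quantified M. The
  strip is followed to the left, with t = - Re s.\<close>

definition strip_bound :: "real \<Rightarrow> (complex \<Rightarrow> complex) \<Rightarrow> real \<Rightarrow> real \<Rightarrow> bool" where
  "strip_bound K F A B \<longleftrightarrow> (\<exists>M T. \<forall>t\<ge>T. \<forall>y. \<bar>y\<bar> \<le> K \<longrightarrow>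
     norm (F (Complex (- t) y)) \<le> exp (A * (t * ln t) + B * t + M * ln t))"

lemma strip_boundI:
  assumes "\<And>t y. t \<ge> T \<Longrightarrow> \<bar>y\<bar> \<le> K \<Longrightarrow>
    norm (F (Complex (- t) y)) \<le> exp (A * (t * ln t) + B * t + M * ln t)"
  shows "strip_bound K F A B"
  using assms unfolding strip_bound_def by blast

lemma strip_bound_mult:
  assumes "strip_bound K F A B" "strip_bound K G A' B'"
  shows "strip_bound K (\<lambda>s. F s * G s) (A + A') (B + B')"
proof -
  obtain M T where 1: "\<And>t y. t \<ge> T \<Longrightarrow> \<bar>y\<bar> \<le> K \<Longrightarrow>
    norm (F (Complex (- t) y)) \<le> exp (A * (t * ln t) + B * t + M * ln t)"
    using assms(1) unfolding strip_bound_def by blast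
  obtain M' T' where 2: "\<And>t y. t \<ge> T' \<Longrightarrow> \<bar>y\<bar> \<le> K \<Longrightarrow>
    norm (G (Complex (- t) y)) \<le> exp (A' * (t * ln t) + B' * t + M' * ln t)"
    using assms(2) unfolding strip_bound_def by blast
  show ?thesis
  proof (rule strip_boundI[of "max T T'" _ _ _ _ "M + M'"])
    fix t y :: real assume "max T T' \<le> t" "\<bar>y\<bar> \<le> K"
    then have "norm (F (Complex (- t) y) * G (Complex (- t) y))
       \<le> exp (A * (t * ln t) + B * t + M * ln t) * exp (A' * (t * ln t) + B' * t + M' * ln t)"
      unfolding norm_mult by (intro mult_mono 1 2) auto
    also have "\<dots> = exp ((A + A') * (t * ln t) + (B + B') * t + (M + M') * ln t)"
      by (simp add: exp_add [symmetric] algebra_simps)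
    finally show "norm (F (Complex (- t) y) * G (Complex (- t) y)) \<le> \<dots>" .
  qed
qed

lemma strip_bound_const: "strip_bound K (\<lambda>s. c) 0 0"
proof (rule strip_boundI[of "exp 1" _ _ _ _ "norm c"])
  fix t y :: real assume t: "t \<ge> exp 1"
  then have "ln t \<ge> 1" by (subst ln_ge_iff) (auto intro: less_le_trans[OF exp_gt_zero])
  \<comment> \<open>The bound has no constant term, so the constant is moved into the ln t
    term.\<close>
  then have "norm c \<le> norm c * ln t" using mult_left_mono[of 1 "ln t" "norm c"] by simp
  also have "\<dots> \<le> exp (norm c * ln t)" using exp_ge_add_one_self[of "norm c * ln t"] by linarith
  finally show "norm c \<le> exp (0 * (t * ln t) + 0 * t + norm c * ln t)" by simp
qed

lemma strip_bound_prod: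
  assumes "finite I" "\<And>i. i \<in> I \<Longrightarrow> strip_bound K (F i) (A i) (B i)"
  shows "strip_bound K (\<lambda>s. \<Prod>i\<in>I. F i s) (\<Sum>i\<in>I. A i) (\<Sum>i\<in>I. B i)"
  using assms
proof (induction I rule: finite_induct)
  case empty
  then show ?case using strip_bound_const[of K 1] by simp
next
  case (insert i I)
  then show ?case by (simp add: strip_bound_mult)
qed

text \<open>Nonvanishing is recorded separately, since a bound on the logarithm can be exponentiated
  only for a positive norm. The two-sided form serves Gamma and its reciprocal alike.\<close>

lemma Gamma_affine_strip:
  fixes \<alpha> K :: real and c :: complex
  assumes "\<alpha> > 0" "K \<ge> 0"
  obtains M T where "T \<ge> exp 1" "\<And>t y. t \<ge> T \<Longrightarrow> \<bar>y\<bar> \<le> K \<Longrightarrow>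
    Gamma (c - of_real \<alpha> * Complex (- t) y) \<noteq> 0 \<and>
    \<bar>ln (norm (Gamma (c - of_real \<alpha> * Complex (- t) y))) - (\<alpha> * (t * ln t) + \<alpha> * (ln \<alpha> - 1) * t)\<bar> \<le> M * ln t"
proof -
  define K' where "K' = \<bar>Im c\<bar> + \<alpha> * K"
  have K': "K' \<ge> 0" using assms by (auto simp: K'_def)
  obtain M1 where M1: "\<And>z. Re z \<ge> 1 \<Longrightarrow> \<bar>Im z\<bar> \<le> K' \<Longrightarrow>
    \<bar>ln (norm (Gamma z)) - (Re z * ln (Re z) - Re z)\<bar> \<le> M1 + (2 * K' + 2) * ln (Re z)"
    using Gamma_strip_bounds[OF K'] by blast
  obtain M2 T where T: "T \<ge> exp 1" "\<And>t. t \<ge> T \<Longrightarrow> Re c + \<alpha> * t \<ge> 1 \<and> ln (Re c + \<alpha> * t) \<le> M2 * ln t \<and>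
       \<bar>((Re c + \<alpha> * t) * ln (Re c + \<alpha> * t) - (Re c + \<alpha> * t)) - (\<alpha> * (t * ln t) + \<alpha> * (ln \<alpha> - 1) * t)\<bar> \<le> M2 * ln t"
    using shift_asymptotics[OF assms(1)] by blast
  show ?thesis
  proof (rule that[OF T(1), of "\<bar>M1\<bar> + (2 * K' + 2) * M2 + M2"])
    fix t y :: real assume ty: "t \<ge> T" "\<bar>y\<bar> \<le> K"
    define z where "z = c - of_real \<alpha> * Complex (- t) y"
    have Re: "Re z = Re c + \<alpha> * t" by (simp add: z_def)
    have "\<bar>Im z\<bar> \<le> \<bar>Im c\<bar> + \<bar>\<alpha> * y\<bar>" by (simp add: z_def)
    also have "\<dots> \<le> K'" using ty assms by (simp add: K'_def abs_mult)
    finally have Im: "\<bar>Im z\<bar> \<le> K'" .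
    note T' = T(2)[OF ty(1)]
    have "Re z \<ge> 1" using T' Re by simp
    then have nz: "Gamma z \<noteq> 0" by (auto simp: Gamma_eq_zero_iff elim!: nonpos_Ints_cases')
    have "exp 1 \<le> t" using T(1) ty(1) by linarith
    then have lnt: "ln t \<ge> 1"
      by (subst ln_ge_iff) (auto intro: less_le_trans[OF exp_gt_zero])
    have "\<bar>M1\<bar> \<le> \<bar>M1\<bar> * ln t" using mult_left_mono[OF lnt, of "\<bar>M1\<bar>"] by simp
    moreover have "(2 * K' + 2) * ln (Re c + \<alpha> * t) \<le> (2 * K' + 2) * (M2 * ln t)"
      using T' K' by (intro mult_left_mono) auto
    ultimately have "\<bar>ln (norm (Gamma z)) - (\<alpha> * (t * ln t) + \<alpha> * (ln \<alpha> - 1) * t)\<bar> \<le>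
         \<bar>M1\<bar> * ln t + (2 * K' + 2) * (M2 * ln t) + M2 * ln t"
      using M1[OF \<open>Re z \<ge> 1\<close> Im] T' unfolding Re by linarith
    also have "\<dots> = (\<bar>M1\<bar> + (2 * K' + 2) * M2 + M2) * ln t" by (simp add: algebra_simps)
    finally show "Gamma z \<noteq> 0 \<and> \<bar>ln (norm (Gamma z)) - (\<alpha> * (t * ln t) + \<alpha> * (ln \<alpha> - 1) * t)\<bar> \<le> \<dots>"
      using nz by blast
  qed
qed

lemma strip_bound_Gamma:
  assumes "\<alpha> > 0" "K \<ge> 0"
  shows "strip_bound K (\<lambda>s. Gamma (c - of_real \<alpha> * s)) \<alpha> (\<alpha> * (ln \<alpha> - 1))"
    and "strip_bound K (\<lambda>s. rGamma (c - of_real \<alpha> * s)) (- \<alpha>) (- (\<alpha> * (ln \<alpha> - 1)))"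
proof -
  obtain M T where "T \<ge> exp 1" and T: "\<And>t y. t \<ge> T \<Longrightarrow> \<bar>y\<bar> \<le> K \<Longrightarrow>
    Gamma (c - of_real \<alpha> * Complex (- t) y) \<noteq> 0 \<and>
    \<bar>ln (norm (Gamma (c - of_real \<alpha> * Complex (- t) y))) - (\<alpha> * (t * ln t) + \<alpha> * (ln \<alpha> - 1) * t)\<bar> \<le> M * ln t"
    by (rule Gamma_affine_strip[OF assms, of c]) (rule that)
  show "strip_bound K (\<lambda>s. Gamma (c - of_real \<alpha> * s)) \<alpha> (\<alpha> * (ln \<alpha> - 1))"
  proof (rule strip_boundI[of T _ _ _ _ M])
    fix t y :: real assume ty: "T \<le> t" "\<bar>y\<bar> \<le> K"
    let ?G = "norm (Gamma (c - of_real \<alpha> * Complex (- t) y))"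
    have nz: "?G > 0" using T[OF ty, THEN conjunct1] by (simp only: zero_less_norm_iff not_False_eq_True)
    have le: "ln ?G \<le> \<alpha> * (t * ln t) + \<alpha> * (ln \<alpha> - 1) * t + M * ln t"
      using T[OF ty, THEN conjunct2] unfolding abs_le_iff minus_diff_eq mult_minus_left by linarith
    have "exp (ln ?G) \<le> exp (\<alpha> * (t * ln t) + \<alpha> * (ln \<alpha> - 1) * t + M * ln t)"
      using le by (simp only: exp_le_cancel_iff)
    then show "?G \<le> exp (\<alpha> * (t * ln t) + \<alpha> * (ln \<alpha> - 1) * t + M * ln t)"
      by (simp only: exp_ln[OF nz])
  qed
  show "strip_bound K (\<lambda>s. rGamma (c - of_real \<alpha> * s)) (- \<alpha>) (- (\<alpha> * (ln \<alpha> - 1)))"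
  proof (rule strip_boundI[of T _ _ _ _ M])
    fix t y :: real assume ty: "T \<le> t" "\<bar>y\<bar> \<le> K"
    let ?G = "norm (Gamma (c - of_real \<alpha> * Complex (- t) y))"
    have nz: "?G > 0" using T[OF ty, THEN conjunct1] by (simp only: zero_less_norm_iff not_False_eq_True)
    have le: "- ln ?G \<le> (- \<alpha>) * (t * ln t) + (- (\<alpha> * (ln \<alpha> - 1))) * t + M * ln t"
      using T[OF ty, THEN conjunct2] unfolding abs_le_iff minus_diff_eq mult_minus_left by linarith
    have "norm (rGamma (c - of_real \<alpha> * Complex (- t) y)) = exp (- ln ?G)"
      by (simp only: rGamma_inverse_Gamma norm_inverse exp_minus exp_ln[OF nz])
    also have "\<dots> \<le> exp ((- \<alpha>) * (t * ln t) + (- (\<alpha> * (ln \<alpha> - 1))) * t + M * ln t)"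
      using le by (simp only: exp_le_cancel_iff)
    finally show "norm (rGamma (c - of_real \<alpha> * Complex (- t) y)) \<le> \<dots>" .
  qed
qed

section \<open>The sine factor of the reflection formula\<close>

lemma norm_sin_le_exp: "norm (sin z) \<le> exp \<bar>Im z\<bar>"
proof -
  have "norm (exp (\<i> * z) - exp (- (\<i> * z))) \<le> exp (- Im z) + exp (Im z)"
    by (rule order.trans[OF norm_triangle_ineq4]) simp
  also have "\<dots> \<le> 2 * exp \<bar>Im z\<bar>" by (auto simp: abs_if)
  finally show ?thesis unfolding sin_exp_eq by (simp add: norm_divide norm_mult)
qed

text \<open>Up to pi/3 the difference sin x - x / pi increases because cos \<ge> 1/2 \<ge> 1/pi;
  beyond, sin x \<ge> 1/2 \<ge> x / pi. The slope 1/pi is what gives |sin (pi r)| \<ge> |r| for |r|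
  \<le> 1/2.\<close>

lemma sin_ge_div_pi:
  fixes x :: real
  assumes "0 \<le> x" "x \<le> pi / 2"
  shows "x / pi \<le> sin x"
proof (cases "x \<le> pi / 3")
  case True
  have "sin 0 - 0 / pi \<le> sin x - x / pi"
  proof (rule DERIV_nonneg_imp_nondecreasing[OF assms(1)])
    fix u :: real assume u: "0 \<le> u" "u \<le> x"
    have "cos (pi / 3) \<le> cos u" using u True by (intro cos_monotone_0_pi_le) auto
    moreover have "1 / pi \<le> 1 / 2" using pi_ge_two by (simp add: field_simps)
    ultimately have "0 \<le> cos u - 1 / pi" unfolding cos_60 by linarith
    moreover have "((\<lambda>u. sin u - u / pi) has_real_derivative (cos u - 1 / pi)) (at u)"
      by (auto intro!: derivative_eq_intros)
    ultimately show "\<exists>y. ((\<lambda>u. sin u - u / pi) has_real_derivative y) (at u) \<and> 0 \<le> y" by blast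
  qed
  then show ?thesis by simp
next
  case False
  have "sin (pi / 6) \<le> sin x" using False assms by (intro sin_monotone_2pi_le) auto
  moreover have "x / pi \<le> 1 / 2" using assms by (simp add: field_simps)
  ultimately show ?thesis unfolding sin_30 by linarith
qed

lemma sinh_ge_self:
  fixes x :: real
  assumes "0 \<le> x"
  shows "x \<le> sinh x"
proof -
  have "sinh 0 - 0 \<le> sinh x - x"
  proof (rule DERIV_nonneg_imp_nondecreasing[OF assms(1)])
    fix u :: real
    have "((\<lambda>u. sinh u - u) has_real_derivative (cosh u - 1)) (at u)"
      by (auto intro!: derivative_eq_intros)
    then show "\<exists>y. ((\<lambda>u. sinh u - u) has_real_derivative y) (at u) \<and> 0 \<le> y"
      using cosh_real_ge_1[of u] by force
  qed
  then show ?thesis by simp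
qed

text \<open>Subtract the integer nearest to Re u. The identity |sin (x + i y)|^2 = sin^2 x + sinh^2
  y then reduces the claim to one real inequality in each direction.\<close>

lemma norm_sin_pi_ge:
  fixes u :: complex
  assumes "d \<le> 1/2" and "\<And>k::int. norm (u - of_int k) \<ge> d"
  shows "norm (sin (of_real pi * u)) \<ge> d"
proof -
  define k where "k = round (Re u)"
  define v where "v = u - of_int k"
  have re: "\<bar>Re v\<bar> \<le> 1/2"
    using of_int_round_abs_le[of "Re u"] by (simp add: v_def k_def abs_minus_commute)
  have "d \<le> norm v" using assms(2)[of k] by (simp add: v_def)
  have per: "norm (sin (of_real pi * u)) = norm (sin (of_real pi * v))"
  proof -
    have "sin (of_real pi * u) = sin (of_real pi * v + of_real (of_int k * pi))"
      by (simp add: v_def algebra_simps)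
    also have "\<dots> = sin (of_real pi * v) * cos (of_real (of_int k * pi))"
      by (simp only: sin_add sin_of_real) (simp add: sin_zero_iff_int2)
    also have "norm \<dots> = norm (sin (of_real pi * v)) * \<bar>cos (of_int k * pi)\<bar>"
      by (simp only: norm_mult cos_of_real norm_of_real)
    also have "\<bar>cos (of_int k * pi)\<bar> = 1"
      by (subst abs_square_eq_1 [symmetric]) (simp add: cos_squared_eq sin_zero_iff_int2)
    finally show ?thesis by simp
  qed
  define x y where "x = pi * Re v" and "y = pi * Im v"
  have sq: "norm (sin (of_real pi * v)) ^ 2 = (sin x)\<^sup>2 + (sinh y)\<^sup>2"
  proof -
    have "norm (sin (of_real pi * v)) ^ 2 = (exp (2 * y) + inverse (exp (2 * y)) - 2 * cos (2 * x)) / 4"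
      by (subst norm_sin_squared) (simp add: x_def y_def)
    also have "cos (2 * x) = 1 - 2 * (sin x)\<^sup>2" by (rule cos_double_sin)
    also have "exp (2 * y) + inverse (exp (2 * y)) = 4 * (sinh y)\<^sup>2 + 2"
    proof -
      define E where "E = exp y"
      have 1: "exp (2 * y) = E * E" and 2: "sinh y = (E - inverse E) / 2" and 3: "E > 0"
        by (simp_all add: E_def sinh_def exp_minus flip: exp_add)
      show ?thesis unfolding 1 2 using 3 by (simp add: field_simps power2_eq_square)
    qed
    finally show ?thesis by simp
  qed
  have s1: "\<bar>Re v\<bar> \<le> \<bar>sin x\<bar>"
  proof -
    have a: "\<bar>x\<bar> \<le> pi / 2" using re by (simp add: x_def abs_mult)
    have "\<bar>x\<bar> / pi \<le> sin \<bar>x\<bar>" using sin_ge_div_pi[OF _ a] by simp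
    also have "\<dots> \<le> \<bar>sin x\<bar>" by (auto simp: abs_if)
    finally show ?thesis by (simp add: x_def abs_mult)
  qed
  have s2: "\<bar>Im v\<bar> \<le> \<bar>sinh y\<bar>"
  proof -
    have "\<bar>y\<bar> \<le> sinh \<bar>y\<bar>" by (rule sinh_ge_self) simp
    also have "\<dots> \<le> \<bar>sinh y\<bar>" by (auto simp: abs_if)
    finally have "\<bar>y\<bar> \<le> \<bar>sinh y\<bar>" .
    moreover have "\<bar>Im v\<bar> \<le> \<bar>y\<bar>" using pi_ge_two by (simp add: y_def abs_mult mult_le_cancel_right1)
    ultimately show ?thesis by linarith
  qed
  have "norm v ^ 2 = (Re v)\<^sup>2 + (Im v)\<^sup>2" by (rule cmod_power2)
  also have "\<dots> \<le> norm (sin (of_real pi * v)) ^ 2"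
    unfolding sq using s1 s2 by (intro add_mono) (simp_all add: abs_le_square_iff)
  finally have "norm v \<le> norm (sin (of_real pi * v))"
    by (rule power2_le_imp_le) simp
  then show ?thesis using \<open>d \<le> norm v\<close> per by linarith
qed

lemma strip_bound_mono:
  assumes "strip_bound K G A B"
    and "\<And>t y. t \<ge> T \<Longrightarrow> \<bar>y\<bar> \<le> K \<Longrightarrow> norm (F (Complex (- t) y)) \<le> norm (G (Complex (- t) y))"
  shows "strip_bound K F A B"
proof -
  obtain M T' where "\<And>t y. t \<ge> T' \<Longrightarrow> \<bar>y\<bar> \<le> K \<Longrightarrow>
    norm (G (Complex (- t) y)) \<le> exp (A * (t * ln t) + B * t + M * ln t)"
    using assms(1) unfolding strip_bound_def by blast
  then show ?thesis
    using assms(2) by (intro strip_boundI[of "max T T'" _ _ _ _ M]) (force intro: order.trans)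
qed

text \<open>Here the argument runs to the left, where 1/Gamma can be large. Reflection writes it as
  sin (pi v) / pi times Gamma (1 - v), and the sine is bounded because Im v is bounded on the
  strip.\<close>

lemma strip_bound_rGamma_reflected:
  assumes "\<alpha> > 0" "K \<ge> 0"
  shows "strip_bound K (\<lambda>s. rGamma (c + of_real \<alpha> * s)) \<alpha> (\<alpha> * (ln \<alpha> - 1))"
proof -
  define C where "C = exp (pi * (\<bar>Im c\<bar> + \<alpha> * K))"
  have "strip_bound K (\<lambda>s. of_real C * Gamma (1 - c - of_real \<alpha> * s)) \<alpha> (\<alpha> * (ln \<alpha> - 1))"
    using strip_bound_mult[OF strip_bound_const strip_bound_Gamma(1)[OF assms]] by simp
  then show ?thesis
  proof (rule strip_bound_mono[of _ _ _ _ "\<bar>Re c\<bar> / \<alpha>"])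
    fix t y :: real
    assume ty: "t \<ge> \<bar>Re c\<bar> / \<alpha>" "\<bar>y\<bar> \<le> K"
    define v where "v = c + of_real \<alpha> * Complex (- t) y"
    have "\<bar>Re c\<bar> \<le> \<alpha> * t" using ty assms by (simp add: field_simps)
    then have "Re (1 - v) > 0" by (simp add: v_def)
    then have np: "1 - v \<notin> \<int>\<^sub>\<le>\<^sub>0" by (rule notin_nonpos_Ints_if_Re_pos)
    have "rGamma v * (rGamma (1 - v) * Gamma (1 - v)) = sin (of_real pi * v) / of_real pi * Gamma (1 - v)"
      by (subst rGamma_reflection_complex[symmetric]) simp
    moreover have "rGamma (1 - v) * Gamma (1 - v) = 1"
      using np by (simp add: rGamma_inverse_Gamma Gamma_eq_zero_iff)
    ultimately have eq: "rGamma v = sin (of_real pi * v) / of_real pi * Gamma (1 - v)" by simp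
    have "norm (sin (of_real pi * v)) \<le> C"
    proof -
      have "\<bar>Im v\<bar> \<le> \<bar>Im c\<bar> + \<bar>\<alpha> * y\<bar>" by (simp add: v_def)
      also have "\<bar>\<alpha> * y\<bar> \<le> \<alpha> * K" using ty assms by (simp add: abs_mult)
      finally have "pi * \<bar>Im v\<bar> \<le> pi * (\<bar>Im c\<bar> + \<alpha> * K)" by simp
      then have "exp \<bar>Im (of_real pi * v)\<bar> \<le> C" unfolding C_def by (simp add: abs_mult)
      then show ?thesis using norm_sin_le_exp[of "of_real pi * v"] by linarith
    qed
    moreover have "norm (sin (of_real pi * v)) / pi \<le> norm (sin (of_real pi * v)) / 1"
      by (rule divide_left_mono) (use pi_ge_two in auto)
    ultimately have "norm (sin (of_real pi * v)) / pi \<le> C" by simp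
    then have "norm (rGamma v) \<le> C * norm (Gamma (1 - v))"
      unfolding eq norm_mult norm_divide norm_of_real abs_of_pos[OF pi_gt_zero] by (rule mult_right_mono) simp
    moreover have "1 - v = 1 - c - of_real \<alpha> * Complex (- t) y" by (simp add: v_def)
    moreover have "C \<ge> 0" by (simp add: C_def)
    ultimately show "norm (rGamma (c + of_real \<alpha> * Complex (- t) y)) \<le>
        norm (of_real C * Gamma (1 - c - of_real \<alpha> * Complex (- t) y))"
      by (simp add: norm_mult flip: v_def)
  qed
qed

text \<open>The distance d is assumed only from 0, -1, -2, ...; from the positive integers it is
  automatic because Re u \<le> 1/2 and d \<le> 1/2. Hence the sine in the reflection formula is at
  least d. The factor 1/d stays explicit because d later varies with the point.\<close>

lemma norm_Gamma_reflected_le: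
  fixes u :: complex
  assumes "0 < d" "d \<le> 1/2" "Re u \<le> 1/2" "\<And>l::nat. d \<le> norm (u + of_nat l)"
  shows "norm (Gamma u) \<le> 1 / d * norm (of_real pi * rGamma (1 - u))"
proof -
  have "d \<le> norm (u - of_int k)" for k
  proof (cases "k \<le> 0")
    case True
    then show ?thesis using assms(4)[of "nat (- k)"] by simp
  next
    case False
    then have "real_of_int k \<ge> 1" by simp
    then have "1/2 \<le> \<bar>Re (u - of_int k)\<bar>" using assms(3) by simp
    also have "\<dots> \<le> norm (u - of_int k)" by (rule abs_Re_le_cmod)
    finally show ?thesis using assms(2) by linarith
  qed
  then have s: "norm (sin (of_real pi * u)) \<ge> d" by (intro norm_sin_pi_ge assms) auto
  have np: "rGamma (1 - u) * Gamma (1 - u) = 1"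
  proof -
    have "1 - u \<notin> \<int>\<^sub>\<le>\<^sub>0" using assms(3) by (intro notin_nonpos_Ints_if_Re_pos) simp
    then show ?thesis by (simp add: rGamma_inverse_Gamma Gamma_eq_zero_iff)
  qed
  have "Gamma u = Gamma u * Gamma (1 - u) * rGamma (1 - u)" using np by (simp add: mult.commute)
  also have "\<dots> = of_real pi / sin (of_real pi * u) * rGamma (1 - u)"
    by (simp only: Gamma_reflection_complex)
  finally have "norm (Gamma u) = norm (of_real pi * rGamma (1 - u)) / norm (sin (of_real pi * u))"
    by (simp add: norm_mult norm_divide)
  also have "\<dots> \<le> norm (of_real pi * rGamma (1 - u)) / d"
    by (rule divide_left_mono[OF s norm_ge_zero mult_pos_pos[OF order.strict_trans2[OF assms(1) s] assms(1)]])
  finally show ?thesis by simp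
qed

text \<open>In |exp (- s w)| = exp (t Re w + y Im w) the part with y is bounded on the
  strip.\<close>

lemma strip_bound_exp: "strip_bound K (\<lambda>s. exp (- s * w)) 0 (Re w)"
proof -
  have "strip_bound K (\<lambda>s. exp (- of_real (Re s) * w)) 0 (Re w)"
    by (rule strip_boundI[of 0 _ _ _ _ 0]) simp
  from strip_bound_mult[OF strip_bound_const[of K "of_real (exp (K * \<bar>Im w\<bar>))"] this]
  have "strip_bound K (\<lambda>s. of_real (exp (K * \<bar>Im w\<bar>)) * exp (- of_real (Re s) * w)) 0 (Re w)" by simp
  then show ?thesis
  proof (rule strip_bound_mono[of _ _ _ _ 0])
    fix t y :: real assume "\<bar>y\<bar> \<le> K"
    then have "\<bar>y * Im w\<bar> \<le> K * \<bar>Im w\<bar>" unfolding abs_mult by (intro mult_right_mono) auto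
    then show "norm (exp (- Complex (- t) y * w)) \<le>
       norm (of_real (exp (K * \<bar>Im w\<bar>)) * exp (- of_real (Re (Complex (- t) y)) * w))"
      by (simp add: norm_mult flip: exp_add)
  qed
qed

lemma atLeastAtMost_split_sum:
  fixes f :: "nat \<Rightarrow> real"
  assumes "m \<le> q"
  shows "sum f {1..q} = sum f {1..m} + sum f {m+1..q}"
proof -
  have "{1..q} = {1..m} \<union> {m+1..q}" using assms by auto
  then show ?thesis by (simp add: sum.union_disjoint)
qed

section \<open>Exponential decay of the integrand\<close>

locale H_parameters =
  fixes m n p q :: nat and a b :: "nat \<Rightarrow> complex" and \<alpha> \<beta> :: "nat \<Rightarrow> real"
  assumes mq: "m \<le> q" and np: "n \<le> p"
    and alpha_pos: "\<And>i. i \<in> {1..p} \<Longrightarrow> \<alpha> i > 0"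
    and beta_pos: "\<And>j. j \<in> {1..q} \<Longrightarrow> \<beta> j > 0"
    and poles_separated: "\<And>i j k l :: nat. i \<in> {1..n} \<Longrightarrow> j \<in> {1..m} \<Longrightarrow>
           of_real (\<beta> j) * (a i - 1 - of_nat k) \<noteq> of_real (\<alpha> i) * (b j + of_nat l)"

text \<open>Since w is the chosen value of log z, \<open>exp (Re w)\<close> is |z|.\<close>

locale H_convergent = H_parameters +
  fixes w :: complex
  assumes growth: "H_Delta p q \<alpha> \<beta> > 0 \<or>
    H_Delta p q \<alpha> \<beta> = 0 \<and> exp (Re w) < H_delta p q \<alpha> \<beta>"
begin

abbreviation "integrand s \<equiv> H_kernel m n p q a \<alpha> b \<beta> s * exp (- s * w)"

lemma ln_H_delta:
  "ln (H_delta p q \<alpha> \<beta>) = (\<Sum>j=1..q. \<beta> j * ln (\<beta> j)) - (\<Sum>i=1..p. \<alpha> i * ln (\<alpha> i))"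
proof -
  have 1: "(\<Prod>i=1..p. \<alpha> i powr (- \<alpha> i)) > 0" using alpha_pos by (intro prod_pos) force
  have 2: "(\<Prod>j=1..q. \<beta> j powr \<beta> j) > 0" using beta_pos by (intro prod_pos) force
  have "ln (\<Prod>i=1..p. \<alpha> i powr (- \<alpha> i)) = - (\<Sum>i=1..p. \<alpha> i * ln (\<alpha> i))"
    using alpha_pos by (subst ln_prod) (force simp: ln_powr sum_negf)+
  moreover have "ln (\<Prod>j=1..q. \<beta> j powr \<beta> j) = (\<Sum>j=1..q. \<beta> j * ln (\<beta> j))"
    using beta_pos by (subst ln_prod) (force simp: ln_powr)+
  ultimately show ?thesis unfolding H_delta_def using 1 2 by (simp add: ln_mult_pos)
qed

text \<open>The order of the quantifiers matters: the rate \<eta> and the threshold T come before d,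
  so d may shrink with s. Far to the left only the first product has poles, and each of its m
  factors costs one 1/d.\<close>

lemma integrand_decay:
  assumes K: "K \<ge> 0"
  shows "\<exists>\<eta>>0. \<exists>T. \<forall>s d. Re s \<le> - T \<longrightarrow> \<bar>Im s\<bar> \<le> K \<longrightarrow> 0 < d \<longrightarrow> d \<le> 1/2 \<longrightarrow>
       (\<forall>j\<in>{1..m}. \<forall>l. d \<le> norm (b j + of_real (\<beta> j) * s + of_nat l)) \<longrightarrow>
       norm (integrand s) \<le> (1 / d) ^ m * exp (\<eta> * Re s)"
proof -
  have ap: "\<alpha> i > 0" if "i \<in> {1..n} \<union> {n+1..p}" for i using alpha_pos[of i] np that by auto
  have bp: "\<beta> j > 0" if "j \<in> {1..m} \<union> {m+1..q}" for j using beta_pos[of j] mq that by auto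
  \<comment> \<open>The integrand with the first product reflected and its factors 1 / sin left out;
    F has no poles far to the left, so it can be estimated on the whole strip.\<close>
  define F where "F s = (\<Prod>j=1..m. of_real pi * rGamma (1 - b j - of_real (\<beta> j) * s)) *
     (\<Prod>i=1..n. Gamma (1 - a i - of_real (\<alpha> i) * s)) *
     (\<Prod>i=n+1..p. rGamma (a i + of_real (\<alpha> i) * s)) *
     (\<Prod>j=m+1..q. rGamma (1 - b j - of_real (\<beta> j) * s)) * exp (- s * w)" for s
  define \<Delta> where "\<Delta> = H_Delta p q \<alpha> \<beta>"
  define L where "L = ln (H_delta p q \<alpha> \<beta>)"
  have "strip_bound K (\<lambda>s. of_real pi * rGamma (1 - b j - of_real (\<beta> j) * s)) (- \<beta> j) (- (\<beta> j * (ln (\<beta> j) - 1)))"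
    if "j \<in> {1..m}" for j
    using strip_bound_mult[OF strip_bound_const strip_bound_Gamma(2)[OF bp K]] that by simp
  then have "strip_bound K F
     ((\<Sum>j=1..m. - \<beta> j) + (\<Sum>i=1..n. \<alpha> i) + (\<Sum>i=n+1..p. \<alpha> i) + (\<Sum>j=m+1..q. - \<beta> j) + 0)
     ((\<Sum>j=1..m. - (\<beta> j * (ln (\<beta> j) - 1))) + (\<Sum>i=1..n. \<alpha> i * (ln (\<alpha> i) - 1)) +
      (\<Sum>i=n+1..p. \<alpha> i * (ln (\<alpha> i) - 1)) + (\<Sum>j=m+1..q. - (\<beta> j * (ln (\<beta> j) - 1))) + Re w)"
    unfolding F_def
    by (intro strip_bound_mult strip_bound_prod strip_bound_Gamma strip_bound_rGamma_reflected
        strip_bound_exp K ap bp) auto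
  moreover have "(\<Sum>j=1..m. - \<beta> j) + (\<Sum>i=1..n. \<alpha> i) + (\<Sum>i=n+1..p. \<alpha> i) + (\<Sum>j=m+1..q. - \<beta> j) + 0 = - \<Delta>"
    unfolding \<Delta>_def H_Delta_def atLeastAtMost_split_sum[OF mq] atLeastAtMost_split_sum[OF np]
    by (simp add: sum_negf)
  moreover have "(\<Sum>j=1..m. - (\<beta> j * (ln (\<beta> j) - 1))) + (\<Sum>i=1..n. \<alpha> i * (ln (\<alpha> i) - 1)) +
      (\<Sum>i=n+1..p. \<alpha> i * (ln (\<alpha> i) - 1)) + (\<Sum>j=m+1..q. - (\<beta> j * (ln (\<beta> j) - 1))) + Re w
      = \<Delta> - L + Re w"
    unfolding L_def ln_H_delta \<Delta>_def H_Delta_def atLeastAtMost_split_sum[OF mq] atLeastAtMost_split_sum[OF np]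
    by (simp add: sum_negf sum_subtractf right_diff_distrib)
  ultimately have "strip_bound K F (- \<Delta>) (\<Delta> - L + Re w)" by simp
  then obtain M T1 where F: "\<And>t y. t \<ge> T1 \<Longrightarrow> \<bar>y\<bar> \<le> K \<Longrightarrow>
     norm (F (Complex (- t) y)) \<le> exp ((- \<Delta>) * (t * ln t) + (\<Delta> - L + Re w) * t + M * ln t)"
    unfolding strip_bound_def by blast
  \<comment> \<open>For \<Delta> > 0 the term - \<Delta> t ln t dominates. For \<Delta> = 0 the
    linear coefficient is Re w - ln \<delta>, negative because |z| < \<delta>; half of it is given
    up to absorb M ln t.\<close>
  have "\<exists>\<eta>>0. \<forall>\<^sub>F t in at_top. (- \<Delta>) * (t * ln t) + (\<Delta> - L + Re w) * t + M * ln t \<le> - \<eta> * t"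
  proof (cases "\<Delta> > 0")
    case True
    define B where "B = \<Delta> - L + Re w"
    have "\<forall>\<^sub>F t in at_top. (- \<Delta>) * (t * ln t) + B * t + M * ln t \<le> - 1 * t"
      using True by real_asymp
    then show ?thesis unfolding B_def by (intro exI[of _ 1]) simp
  next
    case False
    then have D0: "\<Delta> = 0" and less: "exp (Re w) < H_delta p q \<alpha> \<beta>" using growth by (auto simp: \<Delta>_def)
    define B where "B = \<Delta> - L + Re w"
    have "Re w < L" unfolding L_def using less ln_less_cancel_iff[of "exp (Re w)"]
      by (metis exp_gt_zero ln_exp order.strict_trans)
    then have B: "B < 0" using D0 by (simp add: B_def)
    have "\<forall>\<^sub>F t in at_top. B * t + M * ln t \<le> - (- B / 2) * t"
      using B by real_asymp
    then show ?thesis using B D0 unfolding B_def [symmetric]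
      by (intro exI[of _ "- B / 2"]) simp
  qed
  then obtain \<eta> T2 where eta: "\<eta> > 0" and
    T2: "\<And>t. t \<ge> T2 \<Longrightarrow> (- \<Delta>) * (t * ln t) + (\<Delta> - L + Re w) * t + M * ln t \<le> - \<eta> * t"
    by (auto simp: eventually_at_top_linorder)
  \<comment> \<open>For - Re s \<ge> T3 every argument b_j + \<beta>_j s has nonpositive real part,
    as the reflected bound requires; the sum is a common upper bound for the terms of all j.\<close>
  define T3 where "T3 = (\<Sum>j=1..m. \<bar>Re (b j)\<bar> / \<beta> j)"
  show ?thesis
  proof (rule exI[of _ \<eta>], rule conjI[OF eta], rule exI[of _ "max T1 (max T2 T3)"], intro allI impI)
    fix s :: complex and d :: real
    assume s: "Re s \<le> - max T1 (max T2 T3)" "\<bar>Im s\<bar> \<le> K" and d: "0 < d" "d \<le> 1/2"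
      and "\<forall>j\<in>{1..m}. \<forall>l. d \<le> norm (b j + of_real (\<beta> j) * s + of_nat l)"
    then have dist: "\<And>j l. j \<in> {1..m} \<Longrightarrow> d \<le> norm (b j + of_real (\<beta> j) * s + of_nat l)" by blast
    have t: "- Re s \<ge> T1" "- Re s \<ge> T2" "- Re s \<ge> T3" using s(1) by auto
    have "norm (Gamma (b j + of_real (\<beta> j) * s)) \<le> 1 / d * norm (of_real pi * rGamma (1 - b j - of_real (\<beta> j) * s))"
      if j: "j \<in> {1..m}" for j
    proof -
      have bpos: "\<beta> j > 0" using bp j by auto
      have "\<bar>Re (b j)\<bar> / \<beta> j \<le> T3"
        unfolding T3_def
      proof (rule member_le_sum[OF j])
        fix i assume "i \<in> {1..m} - {j}"
        then show "0 \<le> \<bar>Re (b i)\<bar> / \<beta> i" using bp[of i] by simp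
      qed simp
      then have "\<bar>Re (b j)\<bar> / \<beta> j \<le> - Re s" using t by linarith
      then have "\<bar>Re (b j)\<bar> \<le> - Re s * \<beta> j" using bpos by (simp add: pos_divide_le_eq)
      then have "Re (b j + of_real (\<beta> j) * s) \<le> 1/2" by (simp add: algebra_simps)
      from norm_Gamma_reflected_le[OF d this dist[OF j]] show ?thesis by (simp add: algebra_simps)
    qed
    then have "(\<Prod>j=1..m. norm (Gamma (b j + of_real (\<beta> j) * s))) \<le>
        (\<Prod>j=1..m. 1 / d * norm (of_real pi * rGamma (1 - b j - of_real (\<beta> j) * s)))"
      by (intro prod_mono) auto
    also have "\<dots> = (1 / d) ^ m * (\<Prod>j=1..m. norm (of_real pi * rGamma (1 - b j - of_real (\<beta> j) * s)))"
      by (simp only: prod.distrib prod_constant card_atLeastAtMost) simp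
    finally have "norm (\<Prod>j=1..m. Gamma (b j + of_real (\<beta> j) * s)) \<le>
        (1 / d) ^ m * norm (\<Prod>j=1..m. of_real pi * rGamma (1 - b j - of_real (\<beta> j) * s))"
      by (simp only: prod_norm)
    from mult_right_mono[OF this, of "norm ((\<Prod>i=1..n. Gamma (1 - a i - of_real (\<alpha> i) * s)) *
     (\<Prod>i=n+1..p. rGamma (a i + of_real (\<alpha> i) * s)) *
     (\<Prod>j=m+1..q. rGamma (1 - b j - of_real (\<beta> j) * s)) * exp (- s * w))"]
    have "norm (integrand s) \<le> (1 / d) ^ m * norm (F s)"
      unfolding H_kernel_def F_def by (simp only: norm_mult norm_ge_zero mult_nonneg_nonneg mult.assoc simp_thms)
    also have "norm (F s) \<le> exp (\<eta> * Re s)"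
    proof -
      have "norm (F (Complex (- (- Re s)) (Im s))) \<le>
         exp ((- \<Delta>) * ((- Re s) * ln (- Re s)) + (\<Delta> - L + Re w) * (- Re s) + M * ln (- Re s))"
        by (rule F) (use t s in auto)
      also have "\<dots> \<le> exp (- \<eta> * (- Re s))" using T2[OF t(2)] by (simp only: exp_le_cancel_iff)
      finally show ?thesis by simp
    qed
    finally show "norm (integrand s) \<le> (1 / d) ^ m * exp (\<eta> * Re s)"
      using d by (simp add: mult_left_mono)
  qed
qed

end

section \<open>Residues of the kernel\<close>

text \<open>The agreement includes the point itself; this is what carries analyticity and values
  over from an explicit g to \<open>remove_sings f\<close>.\<close>

lemma eventually_remove_sings_eq:
  assumes "\<forall>\<^sub>F s in at z. f s = g s" "g analytic_on {z}"
  shows "\<forall>\<^sub>F s in nhds z. remove_sings f s = g s"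
proof -
  have "isolated_singularity_at f z"
    using isolated_singularity_at_cong[OF assms(1) refl] isolated_singularity_at_analytic[OF assms(2)]
    by simp
  then have "\<forall>\<^sub>F s in at z. remove_sings f s = f s" by (rule eventually_remove_sings_eq_at)
  with assms(1) have "\<forall>\<^sub>F s in at z. remove_sings f s = g s" by eventually_elim simp
  moreover have "remove_sings f z = g z"
    using remove_sings_cong[OF assms(1) refl] assms(2) by simp
  ultimately show ?thesis by (simp add: eventually_nhds_conv_at)
qed

text \<open>Since c + \<beta> s + l = \<beta> (s - u), the residue (-1)^l / l! of Gamma at - l,
  divided by \<beta>, becomes the value P u. The last conclusion permits division by Gamma near u:
  Gamma has no zeros, but by convention the value 0 at its poles.\<close>

lemma Gamma_affine_simple_pole:
  fixes c u :: complex and \<beta> :: real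
  assumes "\<beta> > 0" "c + of_real \<beta> * u = - of_nat l"
  obtains P where "P analytic_on {u}" "P u = (-1) ^ l / (fact l * of_real \<beta>)"
    "\<forall>\<^sub>F s in at u. (s - u) * Gamma (c + of_real \<beta> * s) = P s"
    "\<forall>\<^sub>F s in at u. c + of_real \<beta> * s \<notin> \<int>\<^sub>\<le>\<^sub>0"
proof -
  define f where "f s = (s - u) * Gamma (c + of_real \<beta> * s)" for s
  \<comment> \<open>The poles of Gamma (c + \<beta> s) have spacing 1 / \<beta>, so this ball
    contains only the one at its centre.\<close>
  have np: "c + of_real \<beta> * s \<notin> \<int>\<^sub>\<le>\<^sub>0" if "s \<in> ball u (1 / \<beta>) - {u}" for s
  proof
    assume "c + of_real \<beta> * s \<in> \<int>\<^sub>\<le>\<^sub>0"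
    then obtain k where k: "c + of_real \<beta> * s = - of_nat k" by (auto elim: nonpos_Ints_cases')
    have "of_real \<beta> * (s - u) = (c + of_real \<beta> * s) - (c + of_real \<beta> * u)" by (simp add: algebra_simps)
    also have "\<dots> = of_int (int l - int k)" unfolding k assms(2) by simp
    finally have eq: "of_real \<beta> * (s - u) = of_int (int l - int k)" .
    have "\<beta> * norm (s - u) < 1" using that assms(1) by (simp add: dist_norm norm_minus_commute field_simps)
    then have "norm (of_real \<beta> * (s - u)) < 1" using assms(1) by (simp add: norm_mult)
    then have "\<bar>real_of_int (int l - int k)\<bar> < 1" unfolding eq norm_of_int .
    then have "int l - int k = 0" by linarith
    then have "of_real \<beta> * (s - u) = 0" using eq by simp
    then show False using that assms(1) by simp
  qed
  have "f holomorphic_on ball u (1 / \<beta>) - {u}"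
    unfolding f_def using np by (intro holomorphic_intros) auto
  then have iso: "isolated_singularity_at f u"
    by (rule isolated_singularity_at_holomorphic) (use assms in auto)
  have lim: "f \<midarrow>u\<rightarrow> (-1) ^ l / (fact l * of_real \<beta>)"
  proof -
    have "((\<lambda>z. c + of_real \<beta> * z) \<longlongrightarrow> c + of_real \<beta> * u) (at u)" by (intro tendsto_intros)
    then have "filterlim (\<lambda>z. c + of_real \<beta> * z) (at (- of_nat l)) (at u)"
      unfolding filterlim_at using assms by (auto simp: eventually_at_filter intro!: always_eventually)
         (metis add_left_cancel assms(2) less_numeral_extra(3) mult_cancel_left of_real_eq_0_iff)
    from filterlim_compose[OF Gamma_residues this]
    have "((\<lambda>z. Gamma (c + of_real \<beta> * z) * (c + of_real \<beta> * z + of_nat l)) \<longlongrightarrow> (-1) ^ l / fact l) (at u)" .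
    then have "((\<lambda>z. Gamma (c + of_real \<beta> * z) * (c + of_real \<beta> * z + of_nat l) / of_real \<beta>) \<longlongrightarrow>
        (-1) ^ l / fact l / of_real \<beta>) (at u)" by (intro tendsto_intros) (use assms in auto)
    moreover have "Gamma (c + of_real \<beta> * z) * (c + of_real \<beta> * z + of_nat l) / of_real \<beta> = f z" for z
    proof -
      have "of_nat l = - (c + of_real \<beta> * u)" using assms(2) by simp
      then have "c + of_real \<beta> * z + of_nat l = of_real \<beta> * (z - u)" by (simp add: algebra_simps)
      then show ?thesis unfolding f_def using assms(1) by simp
    qed
    ultimately show ?thesis by simp
  qed
  show ?thesis
  proof (rule that[of "remove_sings f"])
    show "remove_sings f analytic_on {u}" by (rule remove_sings_analytic_at[OF iso lim])
    show "remove_sings f u = (-1) ^ l / (fact l * of_real \<beta>)" by (rule remove_sings_eqI[OF lim])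
    show "\<forall>\<^sub>F s in at u. (s - u) * Gamma (c + of_real \<beta> * s) = remove_sings f s"
      using eventually_remove_sings_eq_at[OF iso] by eventually_elim (simp add: f_def)
    show "\<forall>\<^sub>F s in at u. c + of_real \<beta> * s \<notin> \<int>\<^sub>\<le>\<^sub>0"
    proof -
      have "\<forall>\<^sub>F s in at u. s \<in> ball u (1 / \<beta>) - {u}"
        by (rule eventually_at_in_open) (use assms(1) in auto)
      then show ?thesis by eventually_elim (rule np)
    qed
  qed
qed

lemma higher_deriv_exp_minus_mult:
  "(deriv ^^ i) (\<lambda>s. exp (- s * w)) = (\<lambda>s. (- w) ^ i * exp (- s * w :: complex))"
proof (induction i)
  case (Suc i)
  have "deriv (\<lambda>s. (- w) ^ i * exp (- s * w)) = (\<lambda>s. (- w) ^ Suc i * exp (- s * w))"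
    by (rule ext, rule DERIV_imp_deriv) (auto intro!: derivative_eq_intros)
  then show ?case using Suc by simp
qed simp

lemma sum_triangle_swap:
  fixes f :: "nat \<Rightarrow> nat \<Rightarrow> 'a::comm_monoid_add"
  shows "(\<Sum>\<nu>=0..n. \<Sum>i=0..\<nu>. f \<nu> i) = (\<Sum>i=0..n. \<Sum>\<nu>=i..n. f \<nu> i)"
proof -
  have "(\<Sum>\<nu>=0..n. \<Sum>i=0..\<nu>. f \<nu> i) = (\<Sum>\<nu>=0..n. \<Sum>i=0..n. if i \<le> \<nu> then f \<nu> i else 0)"
    by (intro sum.cong refl sum.mono_neutral_cong_left) auto
  also have "\<dots> = (\<Sum>i=0..n. \<Sum>\<nu>=0..n. if i \<le> \<nu> then f \<nu> i else 0)" by (rule sum.swap)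
  also have "\<dots> = (\<Sum>i=0..n. \<Sum>\<nu>=i..n. f \<nu> i)"
    by (intro sum.cong refl sum.mono_neutral_cong_right) auto
  finally show ?thesis .
qed

text \<open>The Leibniz rule is used twice, for the exponential times G and then for that product
  times F. This nesting produces the two binomial coefficients of \<open>H_star\<close>, and the
  i-th derivative of exp (- s w) supplies (-1)^i w^i.\<close>

lemma higher_deriv_product_exp:
  fixes F G :: "complex \<Rightarrow> complex"
  assumes "F analytic_on {u}" "G analytic_on {u}"
  shows "(deriv ^^ n) (\<lambda>s. F s * G s * exp (- s * w)) u =
    (\<Sum>i=0..n. (\<Sum>\<nu>=i..n. (-1) ^ i * of_nat (n choose \<nu>) * of_nat (\<nu> choose i) *
       (deriv ^^ (n - \<nu>)) F u * (deriv ^^ (\<nu> - i)) G u) * exp (- u * w) * w ^ i)"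
proof -
  have e: "(\<lambda>s. exp (- s * w)) analytic_on {u}" by (intro analytic_intros)
  have inner: "(deriv ^^ \<nu>) (\<lambda>s. exp (- s * w) * G s) u =
      (\<Sum>i=0..\<nu>. of_nat (\<nu> choose i) * ((- w) ^ i * exp (- u * w)) * (deriv ^^ (\<nu> - i)) G u)" for \<nu>
    by (subst higher_deriv_mult_at[OF e assms(2)]) (simp only: higher_deriv_exp_minus_mult)
  have "(deriv ^^ n) (\<lambda>s. F s * G s * exp (- s * w)) u = (deriv ^^ n) (\<lambda>s. (exp (- s * w) * G s) * F s) u"
    by (simp only: mult_ac)
  also have "\<dots> = (\<Sum>\<nu>=0..n. of_nat (n choose \<nu>) * (deriv ^^ \<nu>) (\<lambda>s. exp (- s * w) * G s) u * (deriv ^^ (n - \<nu>)) F u)"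
    by (rule higher_deriv_mult_at) (use e assms in \<open>auto intro: analytic_on_mult\<close>)
  also have "\<dots> = (\<Sum>\<nu>=0..n. \<Sum>i=0..\<nu>. (-1) ^ i * of_nat (n choose \<nu>) * of_nat (\<nu> choose i) *
       (deriv ^^ (n - \<nu>)) F u * (deriv ^^ (\<nu> - i)) G u * exp (- u * w) * w ^ i)"
    unfolding inner by (simp only: sum_distrib_left sum_distrib_right power_minus[of w] mult_ac)
  also have "\<dots> = (\<Sum>i=0..n. \<Sum>\<nu>=i..n. (-1) ^ i * of_nat (n choose \<nu>) * of_nat (\<nu> choose i) *
       (deriv ^^ (n - \<nu>)) F u * (deriv ^^ (\<nu> - i)) G u * exp (- u * w) * w ^ i)"
    by (rule sum_triangle_swap)
  finally show ?thesis by (simp only: sum_distrib_right)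
qed

section \<open>The kernel near a pole of the first product\<close>

context H_parameters
begin

lemma b_pole_eq_iff:
  assumes "j \<in> {1..m}"
  shows "b j + of_real (\<beta> j) * s = - of_nat l \<longleftrightarrow> s = b_pole b \<beta> j l"
proof -
  have "\<beta> j > 0" using beta_pos[of j] assms mq by auto
  then show ?thesis unfolding b_pole_def by (auto simp: field_simps add_eq_0_iff2)
qed

lemma pole_J_iff:
  assumes "r \<in> {1..m}"
  shows "r \<in> pole_J m b \<beta> j l \<longleftrightarrow> b r + of_real (\<beta> r) * b_pole b \<beta> j l \<in> \<int>\<^sub>\<le>\<^sub>0"
proof -
  have "r \<in> pole_J m b \<beta> j l \<longleftrightarrow> (\<exists>k. b r + of_real (\<beta> r) * b_pole b \<beta> j l = - of_nat k)"
    unfolding pole_J_def using b_pole_eq_iff[OF assms] assms by simp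
  also have "\<dots> \<longleftrightarrow> b r + of_real (\<beta> r) * b_pole b \<beta> j l \<in> \<int>\<^sub>\<le>\<^sub>0"
    by (auto elim!: nonpos_Ints_cases')
  finally show ?thesis .
qed

lemma finite_pole_J [simp]: "finite (pole_J m b \<beta> j l)"
  and pole_J_subset: "pole_J m b \<beta> j l \<subseteq> {1..m}"
  unfolding pole_J_def by auto

lemma pole_J_self: "j \<in> {1..m} \<Longrightarrow> j \<in> pole_J m b \<beta> j l"
  unfolding pole_J_def by auto

lemma pole_N_pos: "j \<in> {1..m} \<Longrightarrow> pole_N m b \<beta> j l \<ge> 1"
  unfolding pole_N_def using pole_J_self[of j l] finite_pole_J[of j l]
  by (metis One_nat_def Suc_leI card_gt_0_iff empty_iff)

text \<open>The separation hypothesis with denominators restored: a coincidence of poles would read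
  \<beta>_j (a_i - 1 - k) = \<alpha>_i (b_j + l).\<close>

lemma not_a_pole:
  assumes "j \<in> {1..m}" "i \<in> {1..n}"
  shows "1 - a i - of_real (\<alpha> i) * b_pole b \<beta> j l \<notin> \<int>\<^sub>\<le>\<^sub>0"
proof
  assume "1 - a i - of_real (\<alpha> i) * b_pole b \<beta> j l \<in> \<int>\<^sub>\<le>\<^sub>0"
  then obtain k where k: "1 - a i - of_real (\<alpha> i) * b_pole b \<beta> j l = - of_nat k"
    by (auto elim: nonpos_Ints_cases')
  have b0: "\<beta> j > 0" using beta_pos[of j] assms mq by auto
  have "of_real (\<beta> j) * b_pole b \<beta> j l = - (b j + of_nat l)"
    unfolding b_pole_def using b0 by simp
  then have "of_real (\<alpha> i) * (b j + of_nat l) = - of_real (\<beta> j) * (of_real (\<alpha> i) * b_pole b \<beta> j l)"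
    by (simp add: mult.left_commute)
  also have "of_real (\<alpha> i) * b_pole b \<beta> j l = 1 - a i + of_nat k"
    using k by (simp add: algebra_simps)
  finally have "of_real (\<beta> j) * (a i - 1 - of_nat k) = of_real (\<alpha> i) * (b j + of_nat l)"
    by (simp add: algebra_simps)
  then show False using poles_separated[OF assms(2,1)] by blast
qed

text \<open>An explicit form of \<open>H2_star\<close> near the pole: the singular Gamma factors are
  omitted instead of divided out, so no singularity has to be removed.\<close>

definition regular_part :: "nat \<Rightarrow> nat \<Rightarrow> complex \<Rightarrow> complex" where
  "regular_part j l s = (\<Prod>r\<in>{1..m} - pole_J m b \<beta> j l. Gamma (b r + of_real (\<beta> r) * s)) *
     (\<Prod>i=1..n. Gamma (1 - a i - of_real (\<alpha> i) * s)) *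
     (\<Prod>i=n+1..p. rGamma (a i + of_real (\<alpha> i) * s)) *
     (\<Prod>j=m+1..q. rGamma (1 - b j - of_real (\<beta> j) * s))"

lemma analytic_regular_part:
  assumes "j \<in> {1..m}"
  shows "regular_part j l analytic_on {b_pole b \<beta> j l}"
  unfolding regular_part_def [abs_def]
  by (intro analytic_intros ballI) (use not_a_pole[OF assms] pole_J_iff in auto)

lemma kernel_eq_regular_part:
  "H_kernel m n p q a \<alpha> b \<beta> s =
     (\<Prod>r\<in>pole_J m b \<beta> j l. Gamma (b r + of_real (\<beta> r) * s)) * regular_part j l s"
proof -
  have "(\<Prod>r=1..m. Gamma (b r + of_real (\<beta> r) * s)) =
      (\<Prod>r\<in>{1..m} - pole_J m b \<beta> j l. Gamma (b r + of_real (\<beta> r) * s)) *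
      (\<Prod>r\<in>pole_J m b \<beta> j l. Gamma (b r + of_real (\<beta> r) * s))"
    by (rule prod.subset_diff) (use pole_J_subset in auto)
  then show ?thesis unfolding H_kernel_def regular_part_def by (simp add: mult_ac)
qed

text \<open>Each factor vanishes only at its poles, through the convention for Gamma, and these are
  isolated.\<close>

lemma eventually_Gamma_product_nonzero:
  "\<forall>\<^sub>F s in at (b_pole b \<beta> j l). (\<Prod>r\<in>pole_J m b \<beta> j l. Gamma (b r + of_real (\<beta> r) * s)) \<noteq> 0"
proof -
  have "\<forall>\<^sub>F s in at (b_pole b \<beta> j l). b r + of_real (\<beta> r) * s \<notin> \<int>\<^sub>\<le>\<^sub>0" if r: "r \<in> pole_J m b \<beta> j l" for r
  proof -
    have r': "r \<in> {1..m}" using subsetD[OF pole_J_subset r] .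
    then have pos: "\<beta> r > 0" using beta_pos[of r] mq by auto
    from r pole_J_iff[OF r'] obtain k where "b r + of_real (\<beta> r) * b_pole b \<beta> j l = - of_nat k"
      by (auto elim: nonpos_Ints_cases')
    from Gamma_affine_simple_pole[OF pos this] show ?thesis by blast
  qed
  then have "\<forall>\<^sub>F s in at (b_pole b \<beta> j l). \<forall>r\<in>pole_J m b \<beta> j l. b r + of_real (\<beta> r) * s \<notin> \<int>\<^sub>\<le>\<^sub>0"
    by (simp add: eventually_ball_finite_distrib)
  then show ?thesis by eventually_elim (simp add: Gamma_eq_zero_iff)
qed

lemma H2_star_regular:
  assumes "j \<in> {1..m}"
  shows "H2_star m n p q a \<alpha> b \<beta> j l analytic_on {b_pole b \<beta> j l}"
    and "\<forall>\<^sub>F s in nhds (b_pole b \<beta> j l). H2_star m n p q a \<alpha> b \<beta> j l s = regular_part j l s"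
proof -
  have "\<forall>\<^sub>F s in at (b_pole b \<beta> j l). H_kernel m n p q a \<alpha> b \<beta> s /
       (\<Prod>r\<in>pole_J m b \<beta> j l. Gamma (b r + of_real (\<beta> r) * s)) = regular_part j l s"
    using eventually_Gamma_product_nonzero[of j l]
    by eventually_elim (subst kernel_eq_regular_part[of _ j l], simp)
  from eventually_remove_sings_eq[OF this analytic_regular_part[OF assms]]
  show *: "\<forall>\<^sub>F s in nhds (b_pole b \<beta> j l). H2_star m n p q a \<alpha> b \<beta> j l s = regular_part j l s"
    unfolding H2_star_def .
  show "H2_star m n p q a \<alpha> b \<beta> j l analytic_on {b_pole b \<beta> j l}"
    using analytic_at_cong[OF * refl] analytic_regular_part[OF assms] by simp
qed

text \<open>The exponent N is the number of elements of J, so each singular Gamma factor receives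
  one factor s - b and becomes analytic. The value for J = {j} is the constant in front of
  \<open>h_star\<close>.\<close>

lemma H1_star_regular:
  shows "H1_star m b \<beta> j l analytic_on {b_pole b \<beta> j l}"
    and "\<forall>\<^sub>F s in at (b_pole b \<beta> j l). H1_star m b \<beta> j l s =
      (s - b_pole b \<beta> j l) ^ pole_N m b \<beta> j l * (\<Prod>r\<in>pole_J m b \<beta> j l. Gamma (b r + of_real (\<beta> r) * s))"
    and "pole_J m b \<beta> j l = {j} \<Longrightarrow> H1_star m b \<beta> j l (b_pole b \<beta> j l) = (-1) ^ l / (fact l * of_real (\<beta> j))"
proof -
  let ?u = "b_pole b \<beta> j l"
  \<comment> \<open>The index k of the pole depends on r and is determined by it; quantifying over
    it lets the value at the pole survive the simultaneous choice of all P r.\<close>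
  define good where "good r P \<longleftrightarrow> P analytic_on {?u} \<and>
      (\<forall>\<^sub>F s in at ?u. (s - ?u) * Gamma (b r + of_real (\<beta> r) * s) = P s) \<and>
      (\<forall>k. b r + of_real (\<beta> r) * ?u = - of_nat k \<longrightarrow> P ?u = (-1) ^ k / (fact k * of_real (\<beta> r)))" for r P
  have "\<exists>P. good r P" if r: "r \<in> pole_J m b \<beta> j l" for r
  proof -
    have r': "r \<in> {1..m}" using subsetD[OF pole_J_subset r] .
    then have pos: "\<beta> r > 0" using beta_pos[of r] mq by auto
    from r pole_J_iff[OF r'] obtain k where k: "b r + of_real (\<beta> r) * ?u = - of_nat k"
      by (auto elim: nonpos_Ints_cases')
    obtain Q where Q: "Q analytic_on {?u}" "Q ?u = (-1) ^ k / (fact k * of_real (\<beta> r))"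
      "\<forall>\<^sub>F s in at ?u. (s - ?u) * Gamma (b r + of_real (\<beta> r) * s) = Q s"
      using Gamma_affine_simple_pole[OF pos k] by blast
    have "k' = k" if "b r + of_real (\<beta> r) * ?u = - of_nat k'" for k' using that unfolding k by simp
    with Q have "good r Q" unfolding good_def by blast
    then show ?thesis by blast
  qed
  then obtain P where good: "\<And>r. r \<in> pole_J m b \<beta> j l \<Longrightarrow> good r (P r)"
    using bchoice[of "pole_J m b \<beta> j l" good] by blast
  then have P: "\<And>r. r \<in> pole_J m b \<beta> j l \<Longrightarrow> P r analytic_on {?u}"
      "\<And>r. r \<in> pole_J m b \<beta> j l \<Longrightarrow> \<forall>\<^sub>F s in at ?u. (s - ?u) * Gamma (b r + of_real (\<beta> r) * s) = P r s"
    unfolding good_def by blast+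
  have an: "(\<lambda>s. \<Prod>r\<in>pole_J m b \<beta> j l. P r s) analytic_on {?u}"
    by (intro analytic_intros P)
  have "\<forall>\<^sub>F s in at ?u. \<forall>r\<in>pole_J m b \<beta> j l. (s - ?u) * Gamma (b r + of_real (\<beta> r) * s) = P r s"
    using P(2) by (simp add: eventually_ball_finite_distrib)
  then have ev: "\<forall>\<^sub>F s in at ?u. (s - ?u) ^ pole_N m b \<beta> j l * (\<Prod>r\<in>pole_J m b \<beta> j l. Gamma (b r + of_real (\<beta> r) * s))
      = (\<Prod>r\<in>pole_J m b \<beta> j l. P r s)"
  proof eventually_elim
    case (elim s)
    have "(\<Prod>r\<in>pole_J m b \<beta> j l. P r s) = (\<Prod>r\<in>pole_J m b \<beta> j l. (s - ?u) * Gamma (b r + of_real (\<beta> r) * s))"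
      using elim by (intro prod.cong) auto
    then show ?case by (simp add: prod.distrib pole_N_def)
  qed
  from eventually_remove_sings_eq[OF this an]
  have *: "\<forall>\<^sub>F s in nhds ?u. H1_star m b \<beta> j l s = (\<Prod>r\<in>pole_J m b \<beta> j l. P r s)"
    unfolding H1_star_def .
  show "H1_star m b \<beta> j l analytic_on {?u}" using analytic_at_cong[OF * refl] an by simp
  have "\<forall>\<^sub>F s in at ?u. H1_star m b \<beta> j l s = (\<Prod>r\<in>pole_J m b \<beta> j l. P r s)"
    using * by (simp add: eventually_nhds_conv_at)
  with ev show "\<forall>\<^sub>F s in at ?u. H1_star m b \<beta> j l s =
      (s - ?u) ^ pole_N m b \<beta> j l * (\<Prod>r\<in>pole_J m b \<beta> j l. Gamma (b r + of_real (\<beta> r) * s))"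
    by eventually_elim simp
  assume J: "pole_J m b \<beta> j l = {j}"
  have "j \<in> {1..m}" using J pole_J_subset[of j l] by auto
  then have "b j + of_real (\<beta> j) * ?u = - of_nat l" using b_pole_eq_iff[of j ?u l] by simp
  with good[of j] J have "P j ?u = (-1) ^ l / (fact l * of_real (\<beta> j))" unfolding good_def by blast
  moreover have "H1_star m b \<beta> j l ?u = P j ?u" using eventually_nhds_x_imp_x[OF *] J by simp
  ultimately show "H1_star m b \<beta> j l ?u = (-1) ^ l / (fact l * of_real (\<beta> j))" by simp
qed

text \<open>Valid for every N \<ge> 1, so it covers the simple poles too: the residue of an analytic
  function over (s - b)^N is its (N - 1)-st derivative over (N - 1)!. Zeros of the remaining factors
  may lower the true order of the pole without affecting this formula.\<close>

lemma residue_eq_multiple_term: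
  assumes "j \<in> {1..m}"
  shows "residue (\<lambda>s. H_kernel m n p q a \<alpha> b \<beta> s * exp (- s * w)) (b_pole b \<beta> j l) =
    multiple_term m n p q a \<alpha> b \<beta> w (j, l)"
proof -
  let ?u = "b_pole b \<beta> j l" and ?N = "pole_N m b \<beta> j l"
  define H1 where "H1 = H1_star m b \<beta> j l"
  define H2 where "H2 = H2_star m n p q a \<alpha> b \<beta> j l"
  note an1 = H1_star_regular(1)[of j l, folded H1_def]
  note an2 = H2_star_regular(1)[OF assms, of l, folded H2_def]
  obtain M where M: "?N = Suc M" using pole_N_pos[OF assms, of l] by (cases ?N) auto
  have "(\<lambda>s. H1 s * H2 s * exp (- s * w)) analytic_on {?u}"
    using an1 an2 by (intro analytic_intros)
  then obtain A where A: "open A" "?u \<in> A" "(\<lambda>s. H1 s * H2 s * exp (- s * w)) holomorphic_on A"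
    unfolding analytic_at by blast
  have "\<forall>\<^sub>F s in at ?u. H2 s = regular_part j l s"
    using H2_star_regular(2)[OF assms, of l] by (simp add: eventually_nhds_conv_at H2_def)
  moreover have "\<forall>\<^sub>F s in at ?u. s \<noteq> ?u" by (simp add: eventually_at_filter)
  ultimately have "\<forall>\<^sub>F s in at ?u. H_kernel m n p q a \<alpha> b \<beta> s * exp (- s * w) =
      (H1 s * H2 s * exp (- s * w)) / (s - ?u) ^ Suc M"
    using H1_star_regular(2)[of j l]
  proof eventually_elim
    case (elim s)
    then show ?case
      unfolding H1_def [symmetric] M by (subst kernel_eq_regular_part[of _ j l]) simp
  qed
  then have "residue (\<lambda>s. H_kernel m n p q a \<alpha> b \<beta> s * exp (- s * w)) ?u =
      residue (\<lambda>s. (H1 s * H2 s * exp (- s * w)) / (s - ?u) ^ Suc M) ?u"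
    by (rule residue_cong) simp
  also have "\<dots> = (deriv ^^ M) (\<lambda>s. H1 s * H2 s * exp (- s * w)) ?u / fact M"
    by (rule residue_holomorphic_over_power[OF A])
  also have "\<dots> = multiple_term m n p q a \<alpha> b \<beta> w (j, l)"
  proof -
    have e: "exp ((b j + of_nat l) / of_real (\<beta> j) * w) = exp (- ?u * w)"
      unfolding b_pole_def by (simp only: minus_divide_left minus_minus)
    show ?thesis unfolding multiple_term_def H_star_def Let_def M diff_Suc_1 prod.case e
      unfolding higher_deriv_product_exp[OF an1 an2]
      unfolding H1_def H2_def sum_divide_distrib
      by (intro sum.cong refl) (simp add: mult.assoc)
  qed
  finally show ?thesis .
qed

text \<open>For N = 1 the sums reduce to i = \<nu> = 0, and \<open>H_star\<close> becomes the
  product of the values of \<open>H1_star\<close> and \<open>H2_star\<close> at the pole: a Gamma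
  residue times the regular factors.\<close>

lemma simple_term_eq_multiple_term:
  assumes "j \<in> {1..m}" "pole_N m b \<beta> j l = 1"
  shows "simple_term m n p q a \<alpha> b \<beta> w (j, l) = multiple_term m n p q a \<alpha> b \<beta> w (j, l)"
proof -
  let ?u = "b_pole b \<beta> j l"
  have J: "pole_J m b \<beta> j l = {j}"
    using assms(2) pole_J_self[OF assms(1), of l] unfolding pole_N_def
    by (metis card_1_singletonE singletonD)
  have b0: "\<beta> j > 0" using beta_pos[of j] assms mq by auto
  have "H_star m n p q a \<alpha> b \<beta> j l 0 = H1_star m b \<beta> j l ?u * H2_star m n p q a \<alpha> b \<beta> j l ?u"
    unfolding H_star_def Let_def assms(2) by simp
  also have "H2_star m n p q a \<alpha> b \<beta> j l ?u = regular_part j l ?u"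
    using eventually_nhds_x_imp_x[OF H2_star_regular(2)[OF assms(1)]] .
  also have "H1_star m b \<beta> j l ?u = (-1) ^ l / (fact l * of_real (\<beta> j))"
    by (rule H1_star_regular(3)[OF J])
  also have "regular_part j l ?u =
     (\<Prod>i\<in>{1..m} - {j}. Gamma (b i - (b j + of_nat l) * of_real (\<beta> i / \<beta> j))) *
      (\<Prod>i=1..n. Gamma (1 - a i + (b j + of_nat l) * of_real (\<alpha> i / \<beta> j))) *
      (\<Prod>i=n+1..p. rGamma (a i - (b j + of_nat l) * of_real (\<alpha> i / \<beta> j))) *
      (\<Prod>i=m+1..q. rGamma (1 - b i + (b j + of_nat l) * of_real (\<beta> i / \<beta> j)))"
  proof -
    have "x + of_real c * ?u = x - (b j + of_nat l) * of_real (c / \<beta> j)"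
      "x - of_real c * ?u = x + (b j + of_nat l) * of_real (c / \<beta> j)" for x c
      unfolding b_pole_def by (simp_all add: mult.commute minus_divide_left [symmetric] del: minus_add_distrib)
    then show ?thesis unfolding regular_part_def J by (simp only: mult.assoc)
  qed
  finally have "h_star m n p q a \<alpha> b \<beta> j l = H_star m n p q a \<alpha> b \<beta> j l 0"
    unfolding h_star_def by simp
  then show ?thesis unfolding simple_term_def multiple_term_def using assms(2) by simp
qed

end

section \<open>Winding numbers of the loop\<close>

lemma contour_integral_linepath_same_Im:
  assumes "c < d"
  shows "contour_integral (linepath (Complex c y) (Complex d y)) f = integral {c..d} (\<lambda>x. f (Complex x y))"
proof -
  have "contour_integral (linepath (Complex c y) (Complex d y)) f =
      (Complex d y - Complex c y) * integral {0..1} (\<lambda>t. f (linepath (Complex c y) (Complex d y) t))"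
    by (simp add: contour_integral_integral)
  also have "Complex d y - Complex c y = of_real (d - c)" by (simp add: complex_eq_iff)
  also have "(\<lambda>t. f (linepath (Complex c y) (Complex d y) t)) = (\<lambda>t. f (Complex ((d - c) * t + c) y))"
    by (rule ext, rule arg_cong[of _ _ f]) (simp add: linepath_def complex_eq_iff algebra_simps)
  also have "{0..1} = (\<lambda>x. x / (d - c)) ` {0..d - c}"
    using assms by simp
  also have "integral \<dots> (\<lambda>t. f (Complex ((d - c) * t + c) y)) =
      integral {c - c..d - c} (\<lambda>x. f (Complex (x + c) y)) / of_real (d - c)"
    using assms by (subst integral_stretch_real) (auto simp: scaleR_conv_of_real)
  also have "integral {c - c..d - c} (\<lambda>x. f (Complex (x + c) y)) = integral {c..d} (\<lambda>x. f (Complex x y))"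
    by (subst integral_shift_real_ivl) (rule refl)
  finally show ?thesis using assms by simp
qed

locale hankel_loop =
  fixes \<phi>1 \<phi>2 X :: real and g :: "real \<Rightarrow> complex"
  assumes phi: "\<phi>1 < \<phi>2" and valid_g: "valid_path g" and arc_g: "arc g"
    and start_g: "pathstart g = Complex X \<phi>1" and finish_g: "pathfinish g = Complex X \<phi>2"
    and rays: "\<And>x. x < X \<Longrightarrow> Complex x \<phi>1 \<notin> path_image g" "\<And>x. x < X \<Longrightarrow> Complex x \<phi>2 \<notin> path_image g"
begin

text \<open>The cut is traversed downwards, from \<phi>2 to \<phi>1, which makes the closed curve
  positively oriented.\<close>

definition loop_path :: "real \<Rightarrow> real \<Rightarrow> complex" where
  "loop_path Y = linepath (Complex Y \<phi>1) (Complex X \<phi>1) +++ g +++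
     linepath (Complex X \<phi>2) (Complex Y \<phi>2) +++ linepath (Complex Y \<phi>2) (Complex Y \<phi>1)"

text \<open>Keeps the cut off the arc, which is free to wander to the left of X as long as it avoids
  the half-lines.\<close>

definition far_left :: "real \<Rightarrow> bool" where
  "far_left Y \<longleftrightarrow> (\<forall>s\<in>path_image g. Y < Re s)"

lemma far_left_less: "far_left Y \<Longrightarrow> Y < X"
  using pathstart_in_path_image[of g] start_g unfolding far_left_def by fastforce

lemma far_left_mono: "far_left Y \<Longrightarrow> Y' \<le> Y \<Longrightarrow> far_left Y'"
  unfolding far_left_def by fastforce

lemma far_left_exists: "\<exists>Y. far_left Y"
proof -
  have "bounded (path_image g)" using arc_g by (simp add: arc_imp_path bounded_path_image)
  then obtain B where "\<And>s. s \<in> path_image g \<Longrightarrow> norm s \<le> B" by (auto simp: bounded_iff)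
  then have "\<And>s. s \<in> path_image g \<Longrightarrow> - B - 1 < Re s"
    using abs_Re_le_cmod by (smt (verit))
  then show ?thesis unfolding far_left_def by blast
qed

lemma path_g [simp]: "path g" using arc_g by (rule arc_imp_path)

lemma loop_path_ends [simp]:
  "pathstart (loop_path Y) = Complex Y \<phi>1" "pathfinish (loop_path Y) = Complex Y \<phi>1"
  unfolding loop_path_def by simp_all

lemma valid_loop_path [simp]: "valid_path (loop_path Y)"
  unfolding loop_path_def using valid_g start_g finish_g by (intro valid_path_join) auto

lemma path_loop_path [simp]: "path (loop_path Y)"
  by (rule valid_path_imp_path) simp

lemma path_image_loop_path: "path_image (loop_path Y) = loop_closed_at \<phi>1 \<phi>2 X g Y"
  unfolding loop_path_def loop_closed_at_def using start_g finish_g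
  by (simp add: path_image_join Un_ac)

lemma in_horizontal_segment:
  "s \<in> closed_segment (Complex c y) (Complex d y) \<longleftrightarrow> Im s = y \<and> Re s \<in> closed_segment c d"
  by (simp add: closed_segment_same_Im)

lemma in_vertical_segment:
  "s \<in> closed_segment (Complex x c) (Complex x d) \<longleftrightarrow> Re s = x \<and> Im s \<in> closed_segment c d"
  by (simp add: closed_segment_same_Re)

lemma loop_segments:
  assumes "Y < X"
  shows "s \<in> closed_segment (Complex Y \<phi>1) (Complex X \<phi>1) \<longleftrightarrow> Im s = \<phi>1 \<and> Y \<le> Re s \<and> Re s \<le> X"
    and "s \<in> closed_segment (Complex X \<phi>2) (Complex Y \<phi>2) \<longleftrightarrow> Im s = \<phi>2 \<and> Y \<le> Re s \<and> Re s \<le> X"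
    and "s \<in> closed_segment (Complex Y \<phi>2) (Complex Y \<phi>1) \<longleftrightarrow> Re s = Y \<and> \<phi>1 \<le> Im s \<and> Im s \<le> \<phi>2"
  using assms phi by (auto simp: in_horizontal_segment in_vertical_segment closed_segment_eq_real_ivl)

lemma in_path_image_loop_path:
  assumes "Y < X"
  shows "s \<in> path_image (loop_path Y) \<longleftrightarrow> s \<in> path_image g \<or>
    (Im s = \<phi>1 \<or> Im s = \<phi>2) \<and> Y \<le> Re s \<and> Re s \<le> X \<or> Re s = Y \<and> \<phi>1 \<le> Im s \<and> Im s \<le> \<phi>2"
  unfolding path_image_loop_path loop_closed_at_def by (auto simp: loop_segments[OF assms])

text \<open>Unwanted intersections could only involve the arc: with a half-line they are confined to
  the endpoint by \<open>rays\<close>, with the cut they are excluded by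
  \<open>far_left\<close>.\<close>

lemma simple_loop_path:
  assumes "far_left Y"
  shows "simple_path (loop_path Y)"
proof -
  have YX: "Y < X" using assms by (rule far_left_less)
  have neq: "Complex Y \<phi>1 \<noteq> Complex X \<phi>1" "Complex X \<phi>2 \<noteq> Complex Y \<phi>2" "Complex Y \<phi>2 \<noteq> Complex Y \<phi>1"
    using YX phi by auto
  have g1: "Re s = X" if "s \<in> path_image g" "Im s = \<phi>1" "Re s \<le> X" for s
    using rays(1)[of "Re s"] that by (metis complex.collapse le_less)
  have g2: "Re s = X" if "s \<in> path_image g" "Im s = \<phi>2" "Re s \<le> X" for s
    using rays(2)[of "Re s"] that by (metis complex.collapse le_less)
  have g3: "Re s > Y" if "s \<in> path_image g" for s
    using assms that unfolding far_left_def by auto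
  let ?B = "linepath (Complex X \<phi>2) (Complex Y \<phi>2) +++ linepath (Complex Y \<phi>2) (Complex Y \<phi>1)"
  have B: "arc ?B"
    by (rule arc_join) (use neq phi YX in \<open>auto simp: loop_segments[OF YX] complex_eq_iff intro!: arc_linepath\<close>)
  have imB: "path_image ?B = closed_segment (Complex X \<phi>2) (Complex Y \<phi>2) \<union> closed_segment (Complex Y \<phi>2) (Complex Y \<phi>1)"
    by (simp add: path_image_join)
  have gB: "arc (g +++ ?B)"
  proof (rule arc_join[OF arc_g B])
    show "path_image g \<inter> path_image ?B \<subseteq> {pathstart ?B}"
    proof
      fix s assume "s \<in> path_image g \<inter> path_image ?B"
      then have s: "s \<in> path_image g" "Im s = \<phi>2 \<and> Re s \<le> X \<or> Re s = Y"
        unfolding imB by (auto simp: loop_segments[OF YX])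
      with g3[OF s(1)] have "Im s = \<phi>2" "Re s \<le> X" by auto
      with g2[OF s(1)] show "s \<in> {pathstart ?B}" by (simp add: complex_eq_iff)
    qed
  qed (simp add: finish_g)
  have imgB: "path_image (g +++ ?B) = path_image g \<union> path_image ?B"
    by (simp add: path_image_join finish_g)
  show ?thesis unfolding loop_path_def
  proof (rule simple_path_join_loop)
    show "arc (linepath (Complex Y \<phi>1) (Complex X \<phi>1))" using neq by (intro arc_linepath) auto
    show "arc (g +++ ?B)" by (rule gB)
    show "path_image (linepath (Complex Y \<phi>1) (Complex X \<phi>1)) \<inter> path_image (g +++ ?B)
        \<subseteq> {pathstart (linepath (Complex Y \<phi>1) (Complex X \<phi>1)), pathstart (g +++ ?B)}"
    proof
      fix s assume "s \<in> path_image (linepath (Complex Y \<phi>1) (Complex X \<phi>1)) \<inter> path_image (g +++ ?B)"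
      then have s: "Im s = \<phi>1" "Re s \<le> X" "s \<in> path_image g \<or> Re s = Y"
        unfolding imgB imB using phi by (auto simp: loop_segments[OF YX])
      then have "Re s = X \<or> Re s = Y" using g1 by blast
      then show "s \<in> {pathstart (linepath (Complex Y \<phi>1) (Complex X \<phi>1)), pathstart (g +++ ?B)}"
        using s(1) start_g by (auto simp: complex_eq_iff)
    qed
  qed (simp_all add: start_g)
qed

lemma winding_loop_path:
  assumes "z \<notin> path_image (loop_path Y)"
  shows "winding_number (loop_path Y) z =
    winding_number (linepath (Complex Y \<phi>1) (Complex X \<phi>1)) z + winding_number g z +
    winding_number (linepath (Complex X \<phi>2) (Complex Y \<phi>2)) z +
    winding_number (linepath (Complex Y \<phi>2) (Complex Y \<phi>1)) z"
  using assms unfolding path_image_loop_path loop_closed_at_def unfolding loop_path_def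
  by (simp add: winding_number_join path_image_join start_g finish_g)

text \<open>The half-lines split at Y, and the vertical edge over Y is run through twice in opposite
  directions, so a rectangle remains as the difference. The condition Re z \<noteq> Y keeps z off
  that edge.\<close>

lemma winding_loop_path_shift:
  assumes "Y' < Y" "Y < X" "z \<notin> path_image (loop_path Y)" "z \<notin> path_image (loop_path Y')" "Re z \<noteq> Y"
  shows "winding_number (loop_path Y') z =
    winding_number (loop_path Y) z + winding_number (rectpath (Complex Y' \<phi>1) (Complex Y \<phi>2)) z"
proof -
  have lower: "winding_number (linepath (Complex Y' \<phi>1) (Complex X \<phi>1)) z =
      winding_number (linepath (Complex Y' \<phi>1) (Complex Y \<phi>1)) z +
      winding_number (linepath (Complex Y \<phi>1) (Complex X \<phi>1)) z"
    by (rule winding_number_split_linepath)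
      (use assms(1,2,4) in_path_image_loop_path[of Y' z] loop_segments[of Y' z] in
        \<open>auto simp: in_horizontal_segment closed_segment_eq_real_ivl\<close>)
  have upper: "winding_number (linepath (Complex X \<phi>2) (Complex Y' \<phi>2)) z =
      winding_number (linepath (Complex X \<phi>2) (Complex Y \<phi>2)) z +
      winding_number (linepath (Complex Y \<phi>2) (Complex Y' \<phi>2)) z"
    by (rule winding_number_split_linepath)
      (use assms(1,2,4) in_path_image_loop_path[of Y' z] loop_segments[of Y' z] in
        \<open>auto simp: in_horizontal_segment closed_segment_eq_real_ivl\<close>)
  have zn: "z \<notin> closed_segment (Complex Y' \<phi>1) (Complex Y \<phi>1)" "z \<notin> closed_segment (Complex Y \<phi>2) (Complex Y' \<phi>2)"
    "z \<notin> closed_segment (Complex Y \<phi>1) (Complex Y \<phi>2)" "z \<notin> closed_segment (Complex Y' \<phi>2) (Complex Y' \<phi>1)"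
    using assms phi in_path_image_loop_path[of Y' z]
    by (auto simp: in_horizontal_segment in_vertical_segment closed_segment_eq_real_ivl)
  have rev: "winding_number (linepath (Complex Y \<phi>1) (Complex Y \<phi>2)) z =
      - winding_number (linepath (Complex Y \<phi>2) (Complex Y \<phi>1)) z"
    using winding_number_reversepath[of "linepath (Complex Y \<phi>2) (Complex Y \<phi>1)" z] zn(3)
    by (simp add: closed_segment_commute)
  have "winding_number (rectpath (Complex Y' \<phi>1) (Complex Y \<phi>2)) z =
      winding_number (linepath (Complex Y' \<phi>1) (Complex Y \<phi>1)) z +
      winding_number (linepath (Complex Y \<phi>1) (Complex Y \<phi>2)) z +
      winding_number (linepath (Complex Y \<phi>2) (Complex Y' \<phi>2)) z +
      winding_number (linepath (Complex Y' \<phi>2) (Complex Y' \<phi>1)) z"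
    unfolding rectpath_def Let_def using zn by (simp add: winding_number_join path_image_join)
  then show ?thesis
    unfolding winding_loop_path[OF assms(3)] winding_loop_path[OF assms(4)] lower upper rev by simp
qed

lemma path_image_loop_path_right:
  assumes "far_left Y"
  shows "path_image (loop_path Y) \<subseteq> {s. Y \<le> Re s}"
proof
  fix s assume "s \<in> path_image (loop_path Y)"
  then show "s \<in> {s. Y \<le> Re s}"
    using assms in_path_image_loop_path[OF far_left_less[OF assms], of s]
    unfolding far_left_def by (auto intro: less_imp_le)
qed

lemma winding_loop_path_left:
  assumes "far_left Y" "Re z < Y"
  shows "winding_number (loop_path Y) z = 0"
proof (rule winding_number_zero_outside)
  show "convex {s. Y \<le> Re s}" by (simp add: convex_halfspace_Re_ge)
  show "path_image (loop_path Y) \<subseteq> {s. Y \<le> Re s}" by (rule path_image_loop_path_right[OF assms(1)])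
qed (use assms in auto)

text \<open>The orientation is read off at a point just to the right of the vertical segment:
  moving that segment past the point changes the winding number by that of a rectangle.\<close>
lemma winding_loop_path_inside:
  assumes "far_left (Y + 1)" "z \<in> inside (path_image (loop_path Y))"
  shows "winding_number (loop_path Y) z = 1"
proof -
  have fY: "far_left Y" using far_left_mono[OF assms(1)] by simp
  define c where "c = Complex (Y + 1 / 2) ((\<phi>1 + \<phi>2) / 2)"
  have c1: "c \<notin> path_image (loop_path (Y + 1))"
    using path_image_loop_path_right[OF assms(1)] by (auto simp: c_def)
  have c2: "c \<notin> path_image (loop_path Y)"
  proof -
    have "c \<notin> path_image g" using assms(1) unfolding far_left_def c_def by force
    then show ?thesis
      using phi in_path_image_loop_path[OF far_left_less[OF fY], of c] by (auto simp: c_def)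
  qed
  have "winding_number (loop_path Y) c =
      winding_number (loop_path (Y + 1)) c + winding_number (rectpath (Complex Y \<phi>1) (Complex (Y + 1) \<phi>2)) c"
    by (rule winding_loop_path_shift) (use far_left_less[OF assms(1)] c1 c2 in \<open>auto simp: c_def\<close>)
  also have "winding_number (loop_path (Y + 1)) c = 0"
    by (rule winding_loop_path_left[OF assms(1)]) (simp add: c_def)
  also have "winding_number (rectpath (Complex Y \<phi>1) (Complex (Y + 1) \<phi>2)) c = 1"
    by (rule winding_number_rectpath) (use phi in \<open>simp add: c_def in_box_complex_iff\<close>)
  finally have wc: "winding_number (loop_path Y) c = 1" by simp
  have "c \<notin> outside (path_image (loop_path Y))"
    using winding_number_zero_in_outside[of "loop_path Y" c] wc by auto
  then have c3: "c \<in> inside (path_image (loop_path Y))"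
    using c2 inside_Un_outside[of "path_image (loop_path Y)"] by blast
  \<comment> \<open>Inside a simple closed curve the winding number is constantly 1 or constantly
    -1, so its value at c decides.\<close>
  show ?thesis
    by (rule simple_closed_path_winding_number_inside[OF simple_loop_path[OF fY]])
      (use wc c3 assms(2) in force)+
qed

text \<open>To the right of Y a point lies outside the rectangle between the two cuts, so moving the
  cut does not affect it.\<close>

lemma winding_loop_path_transfer:
  assumes "far_left Y" "Y' < Y" "Y < Re z" "z \<notin> path_image (loop_path Y')"
  shows "z \<notin> path_image (loop_path Y)" "winding_number (loop_path Y) z = winding_number (loop_path Y') z"
proof -
  have YX: "Y < X" using far_left_less[OF assms(1)] .
  show 1: "z \<notin> path_image (loop_path Y)"
    using assms YX in_path_image_loop_path[of Y z] in_path_image_loop_path[of Y' z] by auto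
  have "winding_number (rectpath (Complex Y' \<phi>1) (Complex Y \<phi>2)) z = 0"
    by (rule winding_number_rectpath_outside) (use assms phi in \<open>auto simp: in_cbox_complex_iff\<close>)
  then show "winding_number (loop_path Y) z = winding_number (loop_path Y') z"
    using winding_loop_path_shift[OF assms(2) YX 1 assms(4)] assms(3) by simp
qed

text \<open>The hypothesis speaks only of cuts far enough to the left: the winding number is
  determined at one of them and carried back to Y.\<close>

lemma winding_eventually_inside:
  assumes "far_left Y" "Y < Re z" "\<forall>\<^sub>F Y in at_bot. z \<in> inside (loop_closed_at \<phi>1 \<phi>2 X g Y)"
  shows "z \<notin> path_image (loop_path Y)" "winding_number (loop_path Y) z = 1"
proof -
  \<comment> \<open>One unit of slack, because the orientation at Y' is determined under
    \<open>far_left (Y' + 1)\<close>.\<close>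
  have "\<forall>\<^sub>F Y' in at_bot. Y' < Y - 1" by (rule eventually_gt_at_bot)
  with assms(3) have "\<forall>\<^sub>F Y' in at_bot. z \<in> inside (path_image (loop_path Y')) \<and> Y' < Y - 1"
    unfolding path_image_loop_path by (rule eventually_conj)
  from eventually_happens'[OF _ this] obtain Y' where Y': "z \<in> inside (path_image (loop_path Y'))" "Y' < Y - 1"
    by auto
  have nz: "z \<notin> path_image (loop_path Y')"
    using Y'(1) inside_no_overlap[of "path_image (loop_path Y')"] by blast
  have "far_left (Y' + 1)" using far_left_mono[OF assms(1)] Y'(2) by simp
  note w1 = winding_loop_path_inside[OF this Y'(1)]
  have "Y' < Y" using Y'(2) by simp
  note tr = winding_loop_path_transfer[OF assms(1) this assms(2) nz]
  show "z \<notin> path_image (loop_path Y)" by (rule tr(1))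
  show "winding_number (loop_path Y) z = 1" using tr(2) w1 by simp
qed

lemma winding_eventually_outside:
  assumes "far_left Y" "Y < Re z" "\<forall>\<^sub>F Y in at_bot. z \<in> outside (loop_closed_at \<phi>1 \<phi>2 X g Y)"
  shows "z \<notin> path_image (loop_path Y)" "winding_number (loop_path Y) z = 0"
proof -
  have "\<forall>\<^sub>F Y' in at_bot. Y' < Y" by (rule eventually_gt_at_bot)
  with assms(3) have "\<forall>\<^sub>F Y' in at_bot. z \<in> outside (path_image (loop_path Y')) \<and> Y' < Y"
    unfolding path_image_loop_path by (rule eventually_conj)
  from eventually_happens'[OF _ this] obtain Y' where Y': "z \<in> outside (path_image (loop_path Y'))" "Y' < Y"
    by auto
  have nz: "z \<notin> path_image (loop_path Y')"
    using Y'(1) outside_no_overlap[of "path_image (loop_path Y')"] by blast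
  have "winding_number (loop_path Y') z = 0"
    by (rule winding_number_zero_in_outside[OF path_loop_path _ Y'(1)]) simp
  note tr = winding_loop_path_transfer[OF assms(1) Y'(2) assms(2) nz]
  show "z \<notin> path_image (loop_path Y)" by (rule tr(1))
  show "winding_number (loop_path Y) z = 0" using tr(2) \<open>winding_number (loop_path Y') z = 0\<close> by simp
qed

lemma contour_integral_loop_path:
  assumes "Y < X" "open U" "f holomorphic_on U" "path_image (loop_path Y) \<subseteq> U"
  shows "contour_integral (loop_path Y) f =
    integral {Y..X} (\<lambda>x. f (Complex x \<phi>1)) + contour_integral g f
      - integral {Y..X} (\<lambda>x. f (Complex x \<phi>2)) - \<i> * integral {\<phi>1..\<phi>2} (\<lambda>y. f (Complex Y y))"
proof -
  have sub: "path_image g \<subseteq> U" "closed_segment (Complex Y \<phi>1) (Complex X \<phi>1) \<subseteq> U"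
    "closed_segment (Complex X \<phi>2) (Complex Y \<phi>2) \<subseteq> U" "closed_segment (Complex Y \<phi>2) (Complex Y \<phi>1) \<subseteq> U"
    using assms(4) unfolding path_image_loop_path loop_closed_at_def by auto
  have ig: "f contour_integrable_on g"
    by (rule contour_integrable_holomorphic_simple[OF assms(3,2) valid_g sub(1)])
  have il: "f contour_integrable_on linepath (Complex Y \<phi>1) (Complex X \<phi>1)"
    "f contour_integrable_on linepath (Complex X \<phi>2) (Complex Y \<phi>2)"
    "f contour_integrable_on linepath (Complex Y \<phi>2) (Complex Y \<phi>1)"
    using sub by (auto intro!: contour_integrable_holomorphic_simple[OF assms(3,2)])
  have "contour_integral (loop_path Y) f =
      contour_integral (linepath (Complex Y \<phi>1) (Complex X \<phi>1)) f + contour_integral g f +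
      contour_integral (linepath (Complex X \<phi>2) (Complex Y \<phi>2)) f +
      contour_integral (linepath (Complex Y \<phi>2) (Complex Y \<phi>1)) f"
    unfolding loop_path_def using ig il valid_g start_g finish_g
    by (simp add: contour_integral_join contour_integrable_join valid_path_join)
  also have "contour_integral (linepath (Complex X \<phi>2) (Complex Y \<phi>2)) f =
      - contour_integral (linepath (Complex Y \<phi>2) (Complex X \<phi>2)) f"
    by (rule contour_integral_reverse_linepath)
      (use sub(3) assms(3) in \<open>auto intro!: holomorphic_on_imp_continuous_on holomorphic_on_subset[OF assms(3)]
        simp: closed_segment_commute\<close>)
  also have "contour_integral (linepath (Complex Y \<phi>2) (Complex Y \<phi>1)) f =
      - contour_integral (linepath (Complex Y \<phi>1) (Complex Y \<phi>2)) f"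
    by (rule contour_integral_reverse_linepath)
      (use sub(4) assms(3) in \<open>auto intro!: holomorphic_on_imp_continuous_on holomorphic_on_subset[OF assms(3)]
        simp: closed_segment_commute\<close>)
  also have "contour_integral (linepath (Complex Y \<phi>1) (Complex Y \<phi>2)) f =
      \<i> * integral {\<phi>1..\<phi>2} (\<lambda>y. f (Complex Y y))"
    by (rule contour_integral_linepath_same_Re) (use phi in auto)
  finally show ?thesis by (simp add: contour_integral_linepath_same_Im assms(1))
qed

end

section \<open>Location of the poles\<close>

lemma exp_set_integrable_atMost:
  fixes \<eta> :: real
  assumes "\<eta> > 0"
  shows "set_integrable lborel {..X} (\<lambda>x. exp (\<eta> * x))"
proof -
  have "(\<lambda>x. exp (- \<eta> * x)) absolutely_integrable_on {- X..}"
    by (rule nonnegative_absolutely_integrable_1) (use assms integrable_on_exp_minus_to_infinity in auto)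
  then have "integrable lborel (\<lambda>x. indicator {- X..} x *\<^sub>R exp (- \<eta> * x))"
    unfolding set_integrable_def by (subst (asm) integrable_completion) auto
  from lborel_integrable_real_affine[OF this, of "-1" 0]
  have "integrable lborel (\<lambda>x. indicator {- X..} (- x) *\<^sub>R exp (\<eta> * x))" by simp
  moreover have "indicator {- X..} (- x) = (indicator {..X} x :: real)" for x by (auto simp: indicator_def)
  ultimately show ?thesis unfolding set_integrable_def by simp
qed

text \<open>On the compact rest [T, X] continuity bounds the quotient of |h| by the exponential, so
  one exponential dominates h on the whole half-line. Hence h is Lebesgue integrable, its Lebesgue
  and gauge integrals agree, and the limit can be taken for the former.\<close>

lemma tendsto_integral_atMost:
  fixes h :: "real \<Rightarrow> complex"
  assumes cont: "continuous_on {..X} h" and eta: "\<eta> > 0"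
    and bound: "\<And>x. x \<le> T \<Longrightarrow> norm (h x) \<le> C * exp (\<eta> * x)"
  shows "((\<lambda>Y. integral {Y..X} h) \<longlongrightarrow> integral {..X} h) at_bot"
proof -
  have "continuous_on {T..X} (\<lambda>x. norm (h x) / exp (\<eta> * x))"
    by (intro continuous_intros continuous_on_subset[OF cont]) auto
  then have "bounded ((\<lambda>x. norm (h x) / exp (\<eta> * x)) ` {T..X})"
    by (intro compact_imp_bounded compact_continuous_image) auto
  then obtain C' where "\<forall>x\<in>{T..X}. norm (norm (h x) / exp (\<eta> * x)) \<le> C'"
    unfolding bounded_iff by blast
  then have C': "norm (h x) / exp (\<eta> * x) \<le> C'" if "T \<le> x" "x \<le> X" for x
    using that by fastforce
  have hb: "norm (h x) \<le> max C C' * exp (\<eta> * x)" if "x \<le> X" for x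
  proof (cases "x \<le> T")
    case True
    have "C * exp (\<eta> * x) \<le> max C C' * exp (\<eta> * x)" by (intro mult_right_mono) auto
    with bound[OF True] show ?thesis by linarith
  next
    case False
    with C'[of x] that have "norm (h x) \<le> C' * exp (\<eta> * x)" by (simp add: field_simps)
    also have "\<dots> \<le> max C C' * exp (\<eta> * x)" by (intro mult_right_mono) auto
    finally show ?thesis .
  qed
  have int: "set_integrable lborel {..X} h"
  proof (rule set_integrable_bound)
    show "set_integrable lborel {..X} (\<lambda>x. max C C' * exp (\<eta> * x))"
      using exp_set_integrable_atMost[OF eta] by (intro set_integrable_mult_right) auto
    show "set_borel_measurable lborel {..X} h"
      unfolding set_borel_measurable_def
      using borel_measurable_continuous_on_indicator[OF _ cont] by simp
    show "AE x in lborel. x \<in> {..X} \<longrightarrow> norm (h x) \<le> norm (max C C' * exp (\<eta> * x))"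
      using hb by (auto intro!: AE_I2 order.trans[OF hb])
  qed
  have eq: "set_lebesgue_integral lborel {Y..X} h = integral {Y..X} h" for Y
    by (rule set_borel_integral_eq_integral(2)) (rule set_integrable_subset[OF int], auto)
  have "((\<lambda>Y. set_lebesgue_integral lborel {Y..X} h) \<longlongrightarrow> set_lebesgue_integral lborel {..X} h) at_bot"
    by (rule tendsto_set_lebesgue_integral_at_bot) (use int in auto)
  then show ?thesis unfolding eq set_borel_integral_eq_integral(2)[OF int] .
qed

text \<open>Four subintervals of an interval shorter than half the lattice spacing: the first or the last
  one keeps its own length as distance from the lattice; then recurse into it.\<close>
lemma lattice_gaps:
  fixes c \<beta> :: "'i \<Rightarrow> real"
  assumes "finite J" "\<And>j. j \<in> J \<Longrightarrow> \<beta> j > 0" "L > 0"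
  shows "\<exists>\<epsilon>>0. \<forall>x. \<exists>R. x \<le> R \<and> R \<le> x + L \<and> (\<forall>j\<in>J. \<forall>l::int. \<epsilon> \<le> \<bar>R - (c j + of_int l) / \<beta> j\<bar>)"
  using assms
proof (induction J arbitrary: L rule: finite_induct)
  case empty
  then show ?case by (intro exI[of _ 1]) auto
next
  case (insert i J)
  have bi: "\<beta> i > 0" using insert.prems by auto
  \<comment> \<open>At most a quarter of the available length, and so small that 6 h stays below the
    spacing 1 / \<beta> i of the i-th lattice.\<close>
  define h where "h = min L (1 / (2 * \<beta> i)) / 4"
  have h: "h > 0" "4 * h \<le> L" "8 * h \<le> 1 / \<beta> i" using insert.prems bi by (auto simp: h_def)
  obtain \<epsilon> where e: "\<epsilon> > 0" "\<And>x. \<exists>R. x \<le> R \<and> R \<le> x + h \<and> (\<forall>j\<in>J. \<forall>l::int. \<epsilon> \<le> \<bar>R - (c j + of_int l) / \<beta> j\<bar>)"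
    using insert.IH[OF _ h(1)] insert.prems by auto
  show ?case
  proof (rule exI[of _ "min \<epsilon> h"], intro conjI allI)
    fix x
    have "\<exists>y. x \<le> y \<and> y + h \<le> x + 4 * h \<and> (\<forall>l::int. \<forall>R. y \<le> R \<longrightarrow> R \<le> y + h \<longrightarrow> h \<le> \<bar>R - (c i + of_int l) / \<beta> i\<bar>)"
    proof (rule ccontr)
      assume no: "\<not> ?thesis"
      have none: "\<exists>l::int. \<exists>R. y \<le> R \<and> R \<le> y + h \<and> \<bar>R - (c i + of_int l) / \<beta> i\<bar> < h"
        if "x \<le> y" "y + h \<le> x + 4 * h" for y
        using no that by (meson not_le)
      obtain l1 :: int and R1 where 1: "x \<le> R1" "R1 \<le> x + h" "\<bar>R1 - (c i + of_int l1) / \<beta> i\<bar> < h"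
        using none[of x] h(1) by auto
      obtain l2 :: int and R2 where 2: "x + 3 * h \<le> R2" "R2 \<le> x + 3 * h + h" "\<bar>R2 - (c i + of_int l2) / \<beta> i\<bar> < h"
        using none[of "x + 3 * h"] h(1) by auto
      define d where "d = (c i + of_int l2) / \<beta> i - (c i + of_int l1) / \<beta> i"
      \<comment> \<open>The two lattice points are within h of points of [x, x + h] and
        [x + 3 h, x + 4 h]: their difference exceeds 2 h - 2 h and is less than 4 h + 2 h.\<close>
      have d: "0 < d" "d < 6 * h" using 1 2 unfolding d_def abs_less_iff by linarith+
      have "d = of_int (l2 - l1) / \<beta> i" by (simp add: d_def add_divide_distrib diff_divide_distrib)
      then have "\<beta> i * d = of_int (l2 - l1)" using bi by simp
      moreover have "0 < \<beta> i * d" using bi d by simp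
      moreover have "\<beta> i * d < 1"
      proof -
        have "d < 1 / \<beta> i" using d h by linarith
        then show ?thesis using bi by (simp add: field_simps)
      qed
      ultimately have "0 < real_of_int (l2 - l1)" "real_of_int (l2 - l1) < 1" by auto
      then have "0 < l2 - l1" "l2 - l1 < 1" by (simp_all only: of_int_0_less_iff of_int_less_1_iff)
      then show False by linarith
    qed
    then obtain y where y: "x \<le> y" "y + h \<le> x + 4 * h"
      "\<And>l::int. \<And>R. y \<le> R \<Longrightarrow> R \<le> y + h \<Longrightarrow> h \<le> \<bar>R - (c i + of_int l) / \<beta> i\<bar>" by blast
    obtain R where R: "y \<le> R" "R \<le> y + h" "\<forall>j\<in>J. \<forall>l::int. \<epsilon> \<le> \<bar>R - (c j + of_int l) / \<beta> j\<bar>"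
      using e(2)[of y] by blast
    show "\<exists>R. x \<le> R \<and> R \<le> x + L \<and> (\<forall>j\<in>insert i J. \<forall>l::int. min \<epsilon> h \<le> \<bar>R - (c j + of_int l) / \<beta> j\<bar>)"
    proof (rule exI[of _ R], intro conjI ballI allI)
      show "x \<le> R" "R \<le> x + L" using y R h by linarith+
      fix j and l :: int assume "j \<in> insert i J"
      then show "min \<epsilon> h \<le> \<bar>R - (c j + of_int l) / \<beta> j\<bar>"
        using y(3)[OF R(1,2), of l] R(3) by (cases "j = i") (auto simp: min_le_iff_disj)
    qed
  qed (use e h in auto)
qed

text \<open>Including D in the minimum caps d, which the sine estimate needs at 1/2, and keeps the
  minimum defined for an empty family.\<close>

lemma finite_uniform_lower_bound:
  fixes f :: "'i \<Rightarrow> real"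
  assumes "finite J" "\<And>j. j \<in> J \<Longrightarrow> f j > 0" "D > 0"
  obtains d where "d > 0" "d \<le> D" "\<And>j. j \<in> J \<Longrightarrow> d \<le> f j"
proof (rule that[of "Min (insert D (f ` J))"])
  show "Min (insert D (f ` J)) > 0" using assms by (subst Min_gr_iff) auto
qed (use assms in auto)

context H_parameters
begin

lemma beta_pos': "j \<in> {1..m} \<Longrightarrow> \<beta> j > 0"
  using beta_pos[of j] mq by auto

lemma alpha_pos': "i \<in> {1..n} \<Longrightarrow> \<alpha> i > 0"
  using alpha_pos[of i] np by auto

lemma Re_b_pole: "Re (b_pole b \<beta> j l) = - ((Re (b j) + real l) / \<beta> j)"
  and Im_b_pole: "Im (b_pole b \<beta> j l) = - (Im (b j) / \<beta> j)"
proof -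
  have "b_pole b \<beta> j l = - ((b j + of_nat l) / of_real (\<beta> j))"
    unfolding b_pole_def by (rule minus_divide_left [symmetric])
  then show "Re (b_pole b \<beta> j l) = - ((Re (b j) + real l) / \<beta> j)" "Im (b_pole b \<beta> j l) = - (Im (b j) / \<beta> j)"
    by (simp_all only: uminus_complex.simps Re_divide_of_real Im_divide_of_real plus_complex.simps
        complex_Re_of_nat complex_Im_of_nat add_0_right)
qed

lemma Re_a_pole: "Re (a_pole a \<alpha> i k) = (1 - Re (a i) + real k) / \<alpha> i"
  by (simp add: a_pole_def Re_divide_of_real)

lemma b_pole_dist:
  assumes "j \<in> {1..m}"
  shows "norm (b j + of_real (\<beta> j) * s + of_nat l) = \<beta> j * norm (s - b_pole b \<beta> j l)"
proof -
  have "b j + of_real (\<beta> j) * s + of_nat l = of_real (\<beta> j) * (s - b_pole b \<beta> j l)"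
    using beta_pos'[OF assms] by (simp add: b_pole_def field_simps)
  then show ?thesis using beta_pos'[OF assms] by (simp add: norm_mult)
qed

lemma pole_gaps_exist: "\<exists>R. pole_gaps m b \<beta> R"
proof -
  obtain \<epsilon> where e: "\<epsilon> > 0"
    "\<And>x. \<exists>R. x \<le> R \<and> R \<le> x + 1 \<and> (\<forall>j\<in>{1..m}. \<forall>l::int. \<epsilon> \<le> \<bar>R - (Re (b j) + of_int l) / \<beta> j\<bar>)"
    using lattice_gaps[of "{1..m}" \<beta> 1 "\<lambda>j. Re (b j)", OF finite_atLeastAtMost beta_pos' zero_less_one] by blast
  then have "\<forall>k::nat. \<exists>R. real k \<le> R \<and> (\<forall>j\<in>{1..m}. \<forall>l::int. \<epsilon> \<le> \<bar>R - (Re (b j) + of_int l) / \<beta> j\<bar>)"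
    by blast
  from choice[OF this] obtain R where
    R': "\<forall>k. real k \<le> R k \<and> (\<forall>j\<in>{1..m}. \<forall>l::int. \<epsilon> \<le> \<bar>R k - (Re (b j) + of_int l) / \<beta> j\<bar>)" ..
  have R: "real k \<le> R k" "j \<in> {1..m} \<Longrightarrow> \<epsilon> \<le> \<bar>R k - (Re (b j) + of_int l) / \<beta> j\<bar>" for k j l
    using R' by blast+
  have "filterlim R at_top sequentially"
    by (rule filterlim_at_top_mono[OF filterlim_real_sequentially]) (use R in auto)
  moreover have "\<epsilon> \<le> \<bar>Re (b_pole b \<beta> j l) + R k\<bar>" if "j \<in> {1..m}" for k j l
    using R(2)[OF that, of k "int l"] unfolding Re_b_pole of_int_of_nat_eq by linarith
  ultimately show ?thesis unfolding pole_gaps_def using e(1) by blast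
qed

definition b_poles :: "complex set" where
  "b_poles = {b_pole b \<beta> j l | j l. j \<in> {1..m}}"

definition a_poles :: "complex set" where
  "a_poles = {a_pole a \<alpha> i k | i k. i \<in> {1..n}}"

lemma finite_b_indices: "finite {(j, l). j \<in> {1..m} \<and> - r < Re (b_pole b \<beta> j l)}"
proof -
  have "l \<le> nat \<lceil>\<beta> j * r - Re (b j)\<rceil>" if "j \<in> {1..m}" "- r < Re (b_pole b \<beta> j l)" for j l
  proof -
    have "(Re (b j) + real l) / \<beta> j < r" using that(2) unfolding Re_b_pole by linarith
    then have "real l < \<beta> j * r - Re (b j)" using beta_pos'[OF that(1)] by (simp add: field_simps)
    then show ?thesis by linarith
  qed
  then have "{(j, l). j \<in> {1..m} \<and> - r < Re (b_pole b \<beta> j l)} \<subseteq> (SIGMA j:{1..m}. {..nat \<lceil>\<beta> j * r - Re (b j)\<rceil>})"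
    by auto
  then show ?thesis by (rule finite_subset) auto
qed

lemma finite_b_poles_right: "finite {u \<in> b_poles. - r < Re u}"
proof -
  have "{u \<in> b_poles. - r < Re u} = (\<lambda>(j, l). b_pole b \<beta> j l) ` {(j, l). j \<in> {1..m} \<and> - r < Re (b_pole b \<beta> j l)}"
    unfolding b_poles_def by auto
  then show ?thesis using finite_b_indices[of r] by simp
qed

lemma finite_a_poles_left: "finite {u \<in> a_poles. Re u < r}"
proof -
  have "k \<le> nat \<lceil>\<alpha> i * r - 1 + Re (a i)\<rceil>" if "i \<in> {1..n}" "Re (a_pole a \<alpha> i k) < r" for i k
  proof -
    have "real k < \<alpha> i * r - 1 + Re (a i)"
      using that(2) alpha_pos'[OF that(1)] unfolding Re_a_pole by (simp add: field_simps)
    then show ?thesis by linarith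
  qed
  then have "{u \<in> a_poles. Re u < r} \<subseteq> (\<lambda>(i, k). a_pole a \<alpha> i k) ` (SIGMA i:{1..n}. {..nat \<lceil>\<alpha> i * r - 1 + Re (a i)\<rceil>})"
    unfolding a_poles_def by force
  then show ?thesis by (rule finite_subset) auto
qed

lemma a_poles_bounded_left: "\<exists>Y. \<forall>u\<in>a_poles. Y < Re u"
proof -
  define Y where "Y = (\<Sum>i=1..n. - \<bar>1 - Re (a i)\<bar> / \<alpha> i) - 1"
  have "Y < Re (a_pole a \<alpha> i k)" if i: "i \<in> {1..n}" for i k
  proof -
    have "(\<Sum>i=1..n. - \<bar>1 - Re (a i)\<bar> / \<alpha> i) = - (\<Sum>i=1..n. \<bar>1 - Re (a i)\<bar> / \<alpha> i)"
      by (simp add: sum_negf)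
    moreover have "\<bar>1 - Re (a i)\<bar> / \<alpha> i \<le> (\<Sum>i=1..n. \<bar>1 - Re (a i)\<bar> / \<alpha> i)"
    proof (rule member_le_sum[OF i])
      fix i' assume "i' \<in> {1..n} - {i}"
      then show "0 \<le> \<bar>1 - Re (a i')\<bar> / \<alpha> i'" using alpha_pos'[of i'] by simp
    qed simp
    moreover have "- \<bar>1 - Re (a i)\<bar> / \<alpha> i \<le> Re (a_pole a \<alpha> i k)"
      unfolding Re_a_pole using alpha_pos'[OF i] by (intro divide_right_mono) auto
    ultimately show ?thesis unfolding Y_def by (simp add: minus_divide_left [symmetric])
  qed
  then show ?thesis unfolding a_poles_def by blast
qed

lemma kernel_holomorphic:
  assumes "A \<inter> (b_poles \<union> a_poles) = {}"
  shows "(\<lambda>s. H_kernel m n p q a \<alpha> b \<beta> s * exp (- s * w)) holomorphic_on A"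
proof -
  have 1: "b j + of_real (\<beta> j) * s \<notin> \<int>\<^sub>\<le>\<^sub>0" if "s \<in> A" "j \<in> {1..m}" for s j
  proof
    assume "b j + of_real (\<beta> j) * s \<in> \<int>\<^sub>\<le>\<^sub>0"
    then obtain l where "b j + of_real (\<beta> j) * s = - of_nat l" by (auto elim: nonpos_Ints_cases')
    then have "s = b_pole b \<beta> j l" using b_pole_eq_iff[OF that(2)] by simp
    then show False using that assms unfolding b_poles_def by blast
  qed
  have 2: "1 - a i - of_real (\<alpha> i) * s \<notin> \<int>\<^sub>\<le>\<^sub>0" if "s \<in> A" "i \<in> {1..n}" for s i
  proof
    assume "1 - a i - of_real (\<alpha> i) * s \<in> \<int>\<^sub>\<le>\<^sub>0"
    then obtain k where k: "1 - a i - of_real (\<alpha> i) * s = - of_nat k" by (auto elim: nonpos_Ints_cases')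
    have "of_real (\<alpha> i) * s = 1 - a i + of_nat k" using k by (simp add: algebra_simps)
    then have "s = a_pole a \<alpha> i k" using alpha_pos'[OF that(2)] by (simp add: a_pole_def field_simps)
    then show False using that assms unfolding a_poles_def by blast
  qed
  show ?thesis unfolding H_kernel_def by (intro holomorphic_intros) (use 1 2 in auto)
qed

lemma pole_eq_same_class:
  assumes "b_pole b \<beta> j l = b_pole b \<beta> j' l'"
  shows "pole_J m b \<beta> j l = pole_J m b \<beta> j' l'" "pole_N m b \<beta> j l = pole_N m b \<beta> j' l'"
  using assms unfolding pole_N_def pole_J_def by auto

text \<open>At a simple pole J is a singleton, which forces j and then l, so only multiple poles
  need a choice. Both kinds of pairs together enumerate \<open>b_poles\<close> without repetition,
  which turns sums over pairs into sums over poles.\<close>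

lemma pole_choice_props:
  assumes "is_pole_choice m b \<beta> S"
  shows "simple_pairs m b \<beta> \<inter> S = {}"
    and "inj_on (\<lambda>(j, l). b_pole b \<beta> j l) (simple_pairs m b \<beta> \<union> S)"
    and "(\<lambda>(j, l). b_pole b \<beta> j l) ` (simple_pairs m b \<beta> \<union> S) = b_poles"
    and "simple_pairs m b \<beta> \<union> S \<subseteq> {1..m} \<times> UNIV"
proof -
  have Smult: "S \<subseteq> multiple_pairs m b \<beta>" using assms unfolding is_pole_choice_def by blast
  have Sex: "\<exists>!x. x \<in> S \<and> b_pole b \<beta> (fst x) (snd x) = b_pole b \<beta> j l" if "(j, l) \<in> multiple_pairs m b \<beta>" for j l
    using assms that unfolding is_pole_choice_def by fast
  have S2: "pole_N m b \<beta> j l \<ge> 2" if "(j, l) \<in> S" for j l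
    using Smult that unfolding multiple_pairs_def by auto
  show "simple_pairs m b \<beta> \<inter> S = {}" using S2 unfolding simple_pairs_def by fastforce
  show sub: "simple_pairs m b \<beta> \<union> S \<subseteq> {1..m} \<times> UNIV"
    using Smult unfolding simple_pairs_def multiple_pairs_def by auto
  show "inj_on (\<lambda>(j, l). b_pole b \<beta> j l) (simple_pairs m b \<beta> \<union> S)"
  proof (rule inj_onI, clarify)
    fix j l j' l'
    assume x: "(j, l) \<in> simple_pairs m b \<beta> \<union> S" and y: "(j', l') \<in> simple_pairs m b \<beta> \<union> S"
      and eq: "b_pole b \<beta> j l = b_pole b \<beta> j' l'"
    note same = pole_eq_same_class[OF eq]
    have jj: "j \<in> {1..m}" "j' \<in> {1..m}" using x y sub by auto
    show "j = j' \<and> l = l'"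
    proof (cases "pole_N m b \<beta> j l = 1")
      case True
      then obtain r where "pole_J m b \<beta> j l = {r}" unfolding pole_N_def by (rule card_1_singletonE)
      then have "j = j'" using pole_J_self[OF jj(1), of l] pole_J_self[OF jj(2), of l'] same by auto
      moreover have "l = l'" using eq beta_pos'[OF jj(1)] unfolding \<open>j = j'\<close> b_pole_def by auto
      ultimately show ?thesis by simp
    next
      case False
      then have xS: "(j, l) \<in> S" "(j', l') \<in> S" using x y same unfolding simple_pairs_def by auto
      with Smult have "(j, l) \<in> multiple_pairs m b \<beta>" by auto
      from Sex[OF this] xS eq have "(j, l) = (j', l')" by (metis fst_conv snd_conv)
      then show ?thesis by simp
    qed
  qed
  show "(\<lambda>(j, l). b_pole b \<beta> j l) ` (simple_pairs m b \<beta> \<union> S) = b_poles"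
  proof
    show "(\<lambda>(j, l). b_pole b \<beta> j l) ` (simple_pairs m b \<beta> \<union> S) \<subseteq> b_poles"
    proof clarify
      fix j l assume "(j, l) \<in> simple_pairs m b \<beta> \<union> S"
      then have "j \<in> {1..m}" using sub by blast
      then show "b_pole b \<beta> j l \<in> b_poles" unfolding b_poles_def by blast
    qed
    show "b_poles \<subseteq> (\<lambda>(j, l). b_pole b \<beta> j l) ` (simple_pairs m b \<beta> \<union> S)"
    proof
      fix u assume "u \<in> b_poles"
      then obtain j l where jl: "u = b_pole b \<beta> j l" "j \<in> {1..m}" unfolding b_poles_def by auto
      show "u \<in> (\<lambda>(j, l). b_pole b \<beta> j l) ` (simple_pairs m b \<beta> \<union> S)"
      proof (cases "pole_N m b \<beta> j l = 1")
        case True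
        then have "(j, l) \<in> simple_pairs m b \<beta>" using jl unfolding simple_pairs_def by auto
        then show ?thesis using jl by force
      next
        case False
        then have "(j, l) \<in> multiple_pairs m b \<beta>"
          using pole_N_pos[OF jl(2), of l] jl(2) unfolding multiple_pairs_def by auto
        from Sex[OF this] obtain x where "x \<in> S" "b_pole b \<beta> (fst x) (snd x) = u" using jl by auto
        then show ?thesis by (force simp: case_prod_beta)
      qed
    qed
  qed
qed

end

section \<open>The limit of the truncated loop integrals\<close>

locale H_loop = H_convergent + hankel_loop +
  assumes b_inside: "\<And>j l. j \<in> {1..m} \<Longrightarrow>
      \<forall>\<^sub>F Y in at_bot. b_pole b \<beta> j l \<in> inside (loop_closed_at \<phi>1 \<phi>2 X g Y)"
    and a_outside: "\<And>i k. i \<in> {1..n} \<Longrightarrow>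
      \<forall>\<^sub>F Y in at_bot. a_pole a \<alpha> i k \<in> outside (loop_closed_at \<phi>1 \<phi>2 X g Y)"
begin

lemma winding_b_poles:
  assumes "far_left Y" "u \<in> b_poles" "Y < Re u"
  shows "u \<notin> path_image (loop_path Y)" "winding_number (loop_path Y) u = 1"
  using assms winding_eventually_inside[OF assms(1,3)] b_inside unfolding b_poles_def by auto

lemma winding_a_poles:
  assumes "far_left Y" "u \<in> a_poles" "Y < Re u"
  shows "u \<notin> path_image (loop_path Y)" "winding_number (loop_path Y) u = 0"
  using assms winding_eventually_outside[OF assms(1,3)] a_outside unfolding a_poles_def by auto

text \<open>A point of a half-line lies on every closed curve whose cut is further to the left,
  whereas each pole is off these curves.\<close>

lemma rays_avoid_poles:
  assumes "x \<le> X" "\<phi> \<in> {\<phi>1, \<phi>2}"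
  shows "Complex x \<phi> \<notin> b_poles \<union> a_poles"
proof
  assume pole: "Complex x \<phi> \<in> b_poles \<union> a_poles"
  obtain Y0 where "far_left Y0" using far_left_exists by blast
  define Y where "Y = min Y0 (x - 1)"
  have Y: "far_left Y" "Y < Re (Complex x \<phi>)"
    using far_left_mono[OF \<open>far_left Y0\<close>] by (auto simp: Y_def)
  have "Complex x \<phi> \<in> path_image (loop_path Y)"
    using in_path_image_loop_path[OF far_left_less[OF Y(1)], of "Complex x \<phi>"] assms Y(2) by auto
  with pole winding_b_poles(1)[OF Y(1) _ Y(2)] winding_a_poles(1)[OF Y(1) _ Y(2)] show False by blast
qed

text \<open>The j-th family of poles runs to the left on one horizontal line; if a half-line lay on
  it, a pole with large l would hit that half-line. The gain is a distance from the half-lines that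
  does not depend on l.\<close>

lemma b_poles_off_rays:
  assumes "j \<in> {1..m}" "\<phi> \<in> {\<phi>1, \<phi>2}"
  shows "Im (b_pole b \<beta> j 0) \<noteq> \<phi>"
proof
  assume eq: "Im (b_pole b \<beta> j 0) = \<phi>"
  define l where "l = nat \<lceil>- \<beta> j * X - Re (b j)\<rceil>"
  have "real l \<ge> - \<beta> j * X - Re (b j)" unfolding l_def by linarith
  then have "- X \<le> (Re (b j) + real l) / \<beta> j"
    using beta_pos'[OF assms(1)] by (simp add: pos_le_divide_eq algebra_simps)
  then have "Re (b_pole b \<beta> j l) \<le> X" unfolding Re_b_pole by linarith
  from rays_avoid_poles[OF this assms(2)] have "Complex (Re (b_pole b \<beta> j l)) \<phi> \<notin> b_poles" by simp
  moreover have "Complex (Re (b_pole b \<beta> j l)) \<phi> = b_pole b \<beta> j l"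
    using eq by (simp add: complex_eq_iff Im_b_pole)
  ultimately show False using assms(1) unfolding b_poles_def by auto
qed

lemma ray_integral_limit:
  assumes "\<phi> \<in> {\<phi>1, \<phi>2}"
  shows "((\<lambda>Y. integral {Y..X} (\<lambda>x. integrand (Complex x \<phi>))) \<longlongrightarrow>
    integral {..X} (\<lambda>x. integrand (Complex x \<phi>))) at_bot"
proof -
  obtain \<eta> T where eta: "\<eta> > 0" and decay:
    "\<And>s d. Re s \<le> - T \<Longrightarrow> \<bar>Im s\<bar> \<le> \<bar>\<phi>\<bar> \<Longrightarrow> 0 < d \<Longrightarrow> d \<le> 1/2 \<Longrightarrow>
       \<forall>j\<in>{1..m}. \<forall>l. d \<le> norm (b j + of_real (\<beta> j) * s + of_nat l) \<Longrightarrow>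
       norm (integrand s) \<le> (1 / d) ^ m * exp (\<eta> * Re s)"
    using integrand_decay[OF abs_ge_zero[of \<phi>]] by blast
  have pos: "\<beta> j * \<bar>\<phi> - Im (b_pole b \<beta> j 0)\<bar> > 0" if "j \<in> {1..m}" for j
    using beta_pos'[OF that] b_poles_off_rays[OF that assms] by simp
  obtain d where d: "d > 0" "d \<le> 1/2" "\<And>j. j \<in> {1..m} \<Longrightarrow> d \<le> \<beta> j * \<bar>\<phi> - Im (b_pole b \<beta> j 0)\<bar>"
    by (rule finite_uniform_lower_bound[of "{1..m}" "\<lambda>j. \<beta> j * \<bar>\<phi> - Im (b_pole b \<beta> j 0)\<bar>" "1/2"])
      (use pos in auto)
  show ?thesis
  proof (rule tendsto_integral_atMost[OF _ eta])
    show "continuous_on {..X} (\<lambda>x. integrand (Complex x \<phi>))"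
    proof (rule continuous_on_compose2[of _ integrand])
      show "continuous_on ((\<lambda>x. Complex x \<phi>) ` {..X}) integrand"
        by (rule holomorphic_on_imp_continuous_on, rule kernel_holomorphic)
          (use rays_avoid_poles[OF _ assms] in auto)
      show "continuous_on {..X} (\<lambda>x. Complex x \<phi>)"
        unfolding Complex_eq by (intro continuous_intros)
    qed auto
    fix x assume "x \<le> - T"
    have "norm (integrand (Complex x \<phi>)) \<le> (1 / d) ^ m * exp (\<eta> * Re (Complex x \<phi>))"
    proof (rule decay, goal_cases)
      case 5
      show ?case
      proof (intro ballI allI)
        fix j l assume j: "j \<in> {1..m}"
        have "\<bar>\<phi> - Im (b_pole b \<beta> j l)\<bar> \<le> norm (Complex x \<phi> - b_pole b \<beta> j l)"
          using abs_Im_le_cmod[of "Complex x \<phi> - b_pole b \<beta> j l"] by simp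
        then have "\<beta> j * \<bar>\<phi> - Im (b_pole b \<beta> j l)\<bar> \<le> \<beta> j * norm (Complex x \<phi> - b_pole b \<beta> j l)"
          using beta_pos'[OF j] by (intro mult_left_mono) auto
        then show "d \<le> norm (b j + of_real (\<beta> j) * Complex x \<phi> + of_nat l)"
          unfolding b_pole_dist[OF j] using d(3)[OF j] by (simp add: Im_b_pole)
      qed
    qed (use \<open>x \<le> - T\<close> d in auto)
    then show "norm (integrand (Complex x \<phi>)) \<le> (1 / d) ^ m * exp (\<eta> * x)" by simp
  qed
qed

text \<open>The gap keeps the cuts away from the poles uniformly in k, and the segments have fixed
  length, so the integrals are O(exp (- \<eta> R k)).\<close>

lemma vertical_integral_limit:
  assumes "pole_gaps m b \<beta> R"
  shows "(\<lambda>k. integral {\<phi>1..\<phi>2} (\<lambda>y. integrand (Complex (- R k) y))) \<longlonglongrightarrow> 0"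
proof -
  define K where "K = max \<bar>\<phi>1\<bar> \<bar>\<phi>2\<bar>"
  have K0: "K \<ge> 0" by (simp add: K_def)
  obtain \<eta> T where eta: "\<eta> > 0" and decay:
    "\<And>s d. Re s \<le> - T \<Longrightarrow> \<bar>Im s\<bar> \<le> K \<Longrightarrow> 0 < d \<Longrightarrow> d \<le> 1/2 \<Longrightarrow>
       \<forall>j\<in>{1..m}. \<forall>l. d \<le> norm (b j + of_real (\<beta> j) * s + of_nat l) \<Longrightarrow>
       norm (integrand s) \<le> (1 / d) ^ m * exp (\<eta> * Re s)"
    using integrand_decay[OF K0] by blast
  obtain \<epsilon> where e: "\<epsilon> > 0" "\<And>k j l. j \<in> {1..m} \<Longrightarrow> \<epsilon> \<le> \<bar>Re (b_pole b \<beta> j l) + R k\<bar>"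
    and R: "filterlim R at_top sequentially"
    using assms unfolding pole_gaps_def by blast
  obtain d where d: "d > 0" "d \<le> 1/2" "\<And>j. j \<in> {1..m} \<Longrightarrow> d \<le> \<beta> j * \<epsilon>"
    by (rule finite_uniform_lower_bound[of "{1..m}" "\<lambda>j. \<beta> j * \<epsilon>" "1/2"]) (use beta_pos' e(1) in auto)
  obtain Ya where Ya: "\<forall>u\<in>a_poles. Ya < Re u" using a_poles_bounded_left by blast
  have "\<forall>\<^sub>F k in sequentially. R k \<ge> T" "\<forall>\<^sub>F k in sequentially. R k \<ge> - Ya"
    using R by (auto simp: filterlim_at_top)
  then have "\<forall>\<^sub>F k in sequentially. norm (integral {\<phi>1..\<phi>2} (\<lambda>y. integrand (Complex (- R k) y)))
      \<le> (1 / d) ^ m * exp (\<eta> * (- R k)) * (\<phi>2 - \<phi>1)"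
  proof eventually_elim
    case (elim k)
    show ?case
    proof (rule integral_bound)
      show "\<phi>1 \<le> \<phi>2" using phi by simp
      have nb: "Complex (- R k) y \<notin> b_poles" for y
      proof
        assume "Complex (- R k) y \<in> b_poles"
        then obtain j l where "j \<in> {1..m}" "Complex (- R k) y = b_pole b \<beta> j l" unfolding b_poles_def by blast
        with e(2)[of j l k] e(1) show False by (metis abs_zero add.commute add.right_inverse complex.sel(1) not_le)
      qed
      have na: "Complex (- R k) y \<notin> a_poles" for y using Ya elim by force
      show "continuous_on {\<phi>1..\<phi>2} (\<lambda>y. integrand (Complex (- R k) y))"
      proof (rule continuous_on_compose2[of _ integrand])
        show "continuous_on ((\<lambda>y. Complex (- R k) y) ` {\<phi>1..\<phi>2}) integrand"
          by (rule holomorphic_on_imp_continuous_on, rule kernel_holomorphic) (use na nb in auto)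
        show "continuous_on {\<phi>1..\<phi>2} (\<lambda>y. Complex (- R k) y)"
          unfolding Complex_eq by (intro continuous_intros)
      qed auto
      fix y assume y: "y \<in> {\<phi>1..\<phi>2}"
      have "norm (integrand (Complex (- R k) y)) \<le> (1 / d) ^ m * exp (\<eta> * Re (Complex (- R k) y))"
      proof (rule decay, goal_cases)
        case 5
        show ?case
        proof (intro ballI allI)
          fix j l assume j: "j \<in> {1..m}"
          have "\<epsilon> \<le> \<bar>Re (Complex (- R k) y - b_pole b \<beta> j l)\<bar>" using e(2)[OF j, of l k] by simp
          also have "\<dots> \<le> norm (Complex (- R k) y - b_pole b \<beta> j l)" by (rule abs_Re_le_cmod)
          finally have "\<beta> j * \<epsilon> \<le> \<beta> j * norm (Complex (- R k) y - b_pole b \<beta> j l)"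
            using beta_pos'[OF j] by (intro mult_left_mono) auto
          then show "d \<le> norm (b j + of_real (\<beta> j) * Complex (- R k) y + of_nat l)"
            unfolding b_pole_dist[OF j] using d(3)[OF j] by linarith
        qed
      qed (use elim d y in \<open>auto simp: K_def\<close>)
      then show "norm (integrand (Complex (- R k) y)) \<le> (1 / d) ^ m * exp (\<eta> * (- R k))" by simp
    qed
  qed
  moreover have "(\<lambda>k. (1 / d) ^ m * exp (\<eta> * (- R k)) * (\<phi>2 - \<phi>1)) \<longlonglongrightarrow> 0"
  proof -
    have "((\<lambda>x. exp (\<eta> * (- x))) \<longlongrightarrow> 0) at_top" using eta by real_asymp
    from filterlim_compose[OF this R] have "(\<lambda>k. exp (\<eta> * (- R k))) \<longlonglongrightarrow> 0" .
    from tendsto_mult_left_zero[OF tendsto_mult_right_zero[OF this]] show ?thesis .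
  qed
  ultimately show ?thesis by (rule Lim_null_comparison)
qed

text \<open>The residue theorem needs an open set around the curve with finitely many poles. The gap
  allows a vertical strip to begin at Y - \<epsilon> without catching further poles, and its right
  edge cuts off all but finitely many poles of the second product. Convexity of the strip gives
  winding number 0 outside.\<close>

lemma loop_residues:
  assumes Y: "far_left Y" and a_right: "\<forall>u\<in>a_poles. Y < Re u"
    and gap: "\<epsilon> > 0" "\<forall>u\<in>b_poles. \<epsilon> \<le> \<bar>Re u - Y\<bar>"
  shows "contour_integral (loop_path Y) integrand =
      2 * of_real pi * \<i> * (\<Sum>u\<in>{u\<in>b_poles. Y < Re u}. residue integrand u)"
    and "path_image (loop_path Y) \<inter> (b_poles \<union> a_poles) = {}"
proof -
  let ?P = "{u\<in>b_poles. Y < Re u}"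
  have b_right: "Y < Re u" if "u \<in> b_poles" "Y - \<epsilon> < Re u" for u
    using gap(2) that gap(1) by (auto simp: abs_if split: if_splits)
  have finP: "finite ?P" using finite_b_poles_right[of "- Y"] by simp
  obtain B0 where B0: "\<And>s. s \<in> path_image (loop_path Y) \<union> ?P \<Longrightarrow> norm s \<le> B0"
    using bounded_Un[of "path_image (loop_path Y)" ?P] bounded_path_image[OF path_loop_path] finite_imp_bounded[OF finP]
    by (auto simp: bounded_iff)
  define B where "B = B0 + 1"
  have B: "Re s < B" if "s \<in> path_image (loop_path Y) \<union> ?P" for s
    using B0[OF that] complex_Re_le_cmod[of s] by (simp add: B_def)
  define D where "D = {s. Y - \<epsilon> < Re s} \<inter> {s. Re s < B}"
  define pts where "pts = (b_poles \<union> a_poles) \<inter> D"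
  have "pts \<subseteq> ?P \<union> {u \<in> a_poles. Re u < B}" using b_right by (auto simp: pts_def D_def)
  then have finpts: "finite pts" by (rule finite_subset) (use finP finite_a_poles_left[of B] in auto)
  have oD: "open D" unfolding D_def by (intro open_Int open_halfspace_Re_gt open_halfspace_Re_lt)
  have cD: "convex D" unfolding D_def by (intro convex_Int convex_halfspace_Re_gt convex_halfspace_Re_lt)
  have off: "u \<notin> path_image (loop_path Y)" if "u \<in> b_poles \<union> a_poles" for u
  proof (cases "Y < Re u")
    case True
    then show ?thesis using that winding_b_poles(1)[OF Y] winding_a_poles(1)[OF Y] by blast
  next
    case False
    then have "u \<in> b_poles" using that a_right by auto
    then have "\<not> Y - \<epsilon> < Re u" using b_right False by blast
    then show ?thesis using path_image_loop_path_right[OF Y] gap(1) by auto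
  qed
  then show disj: "path_image (loop_path Y) \<inter> (b_poles \<union> a_poles) = {}" by blast
  have img: "path_image (loop_path Y) \<subseteq> D - pts"
    using path_image_loop_path_right[OF Y] B gap(1) disj unfolding D_def pts_def by force
  have "contour_integral (loop_path Y) integrand =
      2 * pi * \<i> * (\<Sum>u\<in>pts. winding_number (loop_path Y) u * residue integrand u)"
  proof (rule Residue_theorem[OF oD convex_connected[OF cD] finpts _ valid_loop_path _ img])
    show "integrand holomorphic_on D - pts"
      by (rule kernel_holomorphic) (auto simp: pts_def)
    show "\<forall>z. z \<notin> D \<longrightarrow> winding_number (loop_path Y) z = 0"
    proof (intro allI impI)
      fix z assume "z \<notin> D"
      show "winding_number (loop_path Y) z = 0"
        by (rule winding_number_zero_outside[OF path_loop_path cD _ \<open>z \<notin> D\<close>]) (use img in auto)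
    qed
  qed simp
  also have "(\<Sum>u\<in>pts. winding_number (loop_path Y) u * residue integrand u) =
      (\<Sum>u\<in>?P. winding_number (loop_path Y) u * residue integrand u)"
  proof (rule sum.mono_neutral_right[OF finpts])
    show "?P \<subseteq> pts" using B gap(1) unfolding pts_def D_def by force
    show "\<forall>u\<in>pts - ?P. winding_number (loop_path Y) u * residue integrand u = 0"
    proof
      fix u assume u: "u \<in> pts - ?P"
      then have "u \<in> a_poles" using b_right unfolding pts_def D_def by auto
      then show "winding_number (loop_path Y) u * residue integrand u = 0"
        using winding_a_poles(2)[OF Y] a_right by simp
    qed
  qed
  also have "\<dots> = (\<Sum>u\<in>?P. residue integrand u)"
    by (rule sum.cong) (use winding_b_poles(2)[OF Y] in auto)
  finally show "contour_integral (loop_path Y) integrand =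
      2 * of_real pi * \<i> * (\<Sum>u\<in>?P. residue integrand u)" by simp
qed

lemma residue_sums_tendsto:
  assumes "pole_gaps m b \<beta> R"
  shows "(\<lambda>k. \<Sum>u\<in>{u\<in>b_poles. - R k < Re u}. residue integrand u)
    \<longlonglongrightarrow> H_fun m n p q a \<alpha> b \<beta> \<phi>1 \<phi>2 X g w"
proof -
  obtain \<epsilon> where e: "\<epsilon> > 0" "\<And>k j l. j \<in> {1..m} \<Longrightarrow> \<epsilon> \<le> \<bar>Re (b_pole b \<beta> j l) + R k\<bar>"
    and R: "filterlim R at_top sequentially"
    using assms unfolding pole_gaps_def by blast
  obtain Ya where Ya: "\<forall>u\<in>a_poles. Ya < Re u" using a_poles_bounded_left by blast
  obtain Y0 where Y0: "far_left Y0" using far_left_exists by blast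
  have Rb: "filterlim (\<lambda>k. - R k) at_bot sequentially"
    using R by (simp add: filterlim_uminus_at_top)
  define V where "V k = integral {\<phi>1..\<phi>2} (\<lambda>y. integrand (Complex (- R k) y))" for k
  define I where "I \<phi> k = integral {- R k..X} (\<lambda>x. integrand (Complex x \<phi>))" for \<phi> k
  have "\<forall>\<^sub>F k in sequentially. R k \<ge> - Ya" "\<forall>\<^sub>F k in sequentially. R k \<ge> - Y0"
    using R by (auto simp: filterlim_at_top)
  then have "\<forall>\<^sub>F k in sequentially. 1 / (2 * of_real pi * \<i>) * (I \<phi>1 k + contour_integral g integrand - I \<phi>2 k - \<i> * V k)
      = (\<Sum>u\<in>{u\<in>b_poles. - R k < Re u}. residue integrand u)"
  proof eventually_elim
    case (elim k)
    have far: "far_left (- R k)" using far_left_mono[OF Y0] elim by simp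
    have ar: "\<forall>u\<in>a_poles. - R k < Re u" using Ya elim by force
    have gap: "\<forall>u\<in>b_poles. \<epsilon> \<le> \<bar>Re u - (- R k)\<bar>" using e(2) unfolding b_poles_def by auto
    note res = loop_residues[OF far ar e(1) gap]
    \<comment> \<open>Splitting the contour integral into its four pieces requires holomorphy on an
      open set: a vertical strip around the curve minus its finitely many poles.\<close>
    obtain U where U: "open U" "path_image (loop_path (- R k)) \<subseteq> U" "U \<inter> (b_poles \<union> a_poles) = {}"
    proof -
      obtain B0 where B0: "\<And>s. s \<in> path_image (loop_path (- R k)) \<Longrightarrow> norm s \<le> B0"
        using bounded_path_image[OF path_loop_path, of "- R k"] unfolding bounded_iff by blast
      define W where "W = {s. - (R k + 1) < Re s} \<inter> {s. Re s < B0 + 1}"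
      have fin: "finite ((b_poles \<union> a_poles) \<inter> W)"
        by (rule finite_subset[of _ "{u \<in> b_poles. - (R k + 1) < Re u} \<union> {u \<in> a_poles. Re u < B0 + 1}"])
          (use finite_b_poles_right[of "R k + 1"] finite_a_poles_left[of "B0 + 1"] in \<open>auto simp: W_def\<close>)
      have "open W" unfolding W_def by (intro open_Int open_halfspace_Re_gt open_halfspace_Re_lt)
      then have "open (W - (b_poles \<union> a_poles) \<inter> W)" using fin by (intro open_Diff finite_imp_closed)
      moreover have "path_image (loop_path (- R k)) \<subseteq> W - (b_poles \<union> a_poles) \<inter> W"
      proof
        fix s assume s: "s \<in> path_image (loop_path (- R k))"
        then have "- R k \<le> Re s" using path_image_loop_path_right[OF far] by auto
        moreover have "Re s < B0 + 1" using B0[OF s] complex_Re_le_cmod[of s] by linarith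
        ultimately show "s \<in> W - (b_poles \<union> a_poles) \<inter> W" using s res(2) by (auto simp: W_def)
      qed
      ultimately show ?thesis by (rule that) blast
    qed
    have eq: "contour_integral (loop_path (- R k)) integrand =
        I \<phi>1 k + contour_integral g integrand - I \<phi>2 k - \<i> * V k"
      unfolding I_def V_def
      by (rule contour_integral_loop_path[OF far_left_less[OF far] U(1) kernel_holomorphic[OF U(3)] U(2)])
    show ?case unfolding eq [symmetric] res(1) by simp
  qed
  moreover have "(\<lambda>k. 1 / (2 * of_real pi * \<i>) * (I \<phi>1 k + contour_integral g integrand - I \<phi>2 k - \<i> * V k))
      \<longlonglongrightarrow> 1 / (2 * of_real pi * \<i>) * (integral {..X} (\<lambda>x. integrand (Complex x \<phi>1)) + contour_integral g integrand
        - integral {..X} (\<lambda>x. integrand (Complex x \<phi>2)) - \<i> * 0)"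
    unfolding I_def V_def
    by (intro tendsto_intros vertical_integral_limit[OF assms]
        filterlim_compose[OF ray_integral_limit Rb]) auto
  ultimately have "(\<lambda>k. \<Sum>u\<in>{u\<in>b_poles. - R k < Re u}. residue integrand u)
      \<longlonglongrightarrow> 1 / (2 * of_real pi * \<i>) * (integral {..X} (\<lambda>x. integrand (Complex x \<phi>1)) + contour_integral g integrand
        - integral {..X} (\<lambda>x. integrand (Complex x \<phi>2)) - \<i> * 0)"
    by (rule Lim_transform_eventually [rotated])
  then show ?thesis unfolding H_fun_def loop_integral_def by simp
qed

end

section \<open>Convergence of the residue series\<close>

context H_convergent
begin

lemma residue_sum_eq_terms:
  assumes "is_pole_choice m b \<beta> S"
  shows "(\<Sum>u\<in>{u\<in>b_poles. - r < Re u}. residue integrand u) =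
    (\<Sum>x\<in>simple_pairs m b \<beta> \<inter> right_of b \<beta> r. simple_term m n p q a \<alpha> b \<beta> w x) +
    (\<Sum>x\<in>S \<inter> right_of b \<beta> r. multiple_term m n p q a \<alpha> b \<beta> w x)"
proof -
  note props = pole_choice_props[OF assms]
  let ?A = "simple_pairs m b \<beta> \<union> S" and ?\<pi> = "\<lambda>(j, l). b_pole b \<beta> j l"
  have fin: "finite (?A \<inter> right_of b \<beta> r)"
    by (rule finite_subset[OF _ finite_b_indices[of r]]) (use props(4) in \<open>auto simp: right_of_def\<close>)
  have img: "{u\<in>b_poles. - r < Re u} = ?\<pi> ` (?A \<inter> right_of b \<beta> r)"
    unfolding props(3) [symmetric] by (auto simp: right_of_def)
  have "(\<Sum>u\<in>{u\<in>b_poles. - r < Re u}. residue integrand u) =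
      (\<Sum>x\<in>?A \<inter> right_of b \<beta> r. residue integrand (?\<pi> x))"
    unfolding img by (subst sum.reindex) (auto intro: inj_on_subset[OF props(2)])
  also have "?A \<inter> right_of b \<beta> r = (simple_pairs m b \<beta> \<inter> right_of b \<beta> r) \<union> (S \<inter> right_of b \<beta> r)"
    by blast
  also have "(\<Sum>x\<in>\<dots>. residue integrand (?\<pi> x)) =
      (\<Sum>x\<in>simple_pairs m b \<beta> \<inter> right_of b \<beta> r. residue integrand (?\<pi> x)) +
      (\<Sum>x\<in>S \<inter> right_of b \<beta> r. residue integrand (?\<pi> x))"
    by (rule sum.union_disjoint) (use fin props(1) in \<open>auto intro: finite_subset[OF _ fin]\<close>)
  also have "(\<Sum>x\<in>simple_pairs m b \<beta> \<inter> right_of b \<beta> r. residue integrand (?\<pi> x)) =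
      (\<Sum>x\<in>simple_pairs m b \<beta> \<inter> right_of b \<beta> r. simple_term m n p q a \<alpha> b \<beta> w x)"
  proof (rule sum.cong)
    fix x assume "x \<in> simple_pairs m b \<beta> \<inter> right_of b \<beta> r"
    then have "fst x \<in> {1..m}" "pole_N m b \<beta> (fst x) (snd x) = 1" unfolding simple_pairs_def by auto
    then show "residue integrand (?\<pi> x) = simple_term m n p q a \<alpha> b \<beta> w x"
      using residue_eq_multiple_term[of "fst x" w "snd x"] simple_term_eq_multiple_term[of "fst x" "snd x" w]
      by (simp add: case_prod_beta)
  qed simp
  also have "(\<Sum>x\<in>S \<inter> right_of b \<beta> r. residue integrand (?\<pi> x)) =
      (\<Sum>x\<in>S \<inter> right_of b \<beta> r. multiple_term m n p q a \<alpha> b \<beta> w x)"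
  proof (rule sum.cong)
    fix x assume "x \<in> S \<inter> right_of b \<beta> r"
    then have "fst x \<in> {1..m}" using props(4) by auto
    then show "residue integrand (?\<pi> x) = multiple_term m n p q a \<alpha> b \<beta> w x"
      using residue_eq_multiple_term[of "fst x" w "snd x"] by (simp add: case_prod_beta)
  qed simp
  finally show ?thesis .
qed

text \<open>Integrate over a circle that is as large as the separation of the poles permits.  Each of the \<open>m\<close>
  Gamma factors loses at most the reciprocal of its radius, and as the separation is allowed to shrink only
  subexponentially, this loss is absorbed by half of the decay rate.\<close>
lemma residue_decay:
  assumes "poles_apart m b \<beta>"
  shows "\<exists>C \<eta> T. \<eta> > 0 \<and> (\<forall>j\<in>{1..m}. \<forall>l. Re (b_pole b \<beta> j l) \<le> - T \<longrightarrow>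
    norm (residue integrand (b_pole b \<beta> j l)) \<le> C * exp (\<eta> * Re (b_pole b \<beta> j l)))"
proof -
  define K where "K = (\<Sum>j=1..m. \<bar>Im (b_pole b \<beta> j 0)\<bar>)"
  have K0: "K \<ge> 0" unfolding K_def by (intro sum_nonneg) auto
  have ImK: "\<bar>Im (b_pole b \<beta> j l)\<bar> \<le> K" if "j \<in> {1..m}" for j l
  proof -
    have "\<bar>Im (b_pole b \<beta> j 0)\<bar> \<le> K" unfolding K_def by (rule member_le_sum[OF that]) auto
    then show ?thesis by (simp add: Im_b_pole)
  qed
  have "K + 1 \<ge> 0" using K0 by simp
  then obtain \<eta> T where eta: "\<eta> > 0" and decay:
    "\<And>s d. Re s \<le> - T \<Longrightarrow> \<bar>Im s\<bar> \<le> K + 1 \<Longrightarrow> 0 < d \<Longrightarrow> d \<le> 1/2 \<Longrightarrow>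
       \<forall>j\<in>{1..m}. \<forall>l. d \<le> norm (b j + of_real (\<beta> j) * s + of_nat l) \<Longrightarrow>
       norm (integrand s) \<le> (1 / d) ^ m * exp (\<eta> * Re s)"
    using integrand_decay by blast
  \<comment> \<open>The m reciprocals of the radius together lose a factor exp (m \<eta>0 |u|),
    which must stay below exp (\<eta> |u| / 2); the summand 1 covers m = 0.\<close>
  define \<eta>0 where "\<eta>0 = \<eta> / (2 * (real m + 1))"
  have eta0: "\<eta>0 > 0" "real m * \<eta>0 \<le> \<eta> / 2" using eta by (auto simp: \<eta>0_def field_simps)
  obtain c where c: "c > 0" "\<And>j r l k. j \<in> {1..m} \<Longrightarrow> r \<in> {1..m} \<Longrightarrow> b_pole b \<beta> j l \<noteq> b_pole b \<beta> r k \<Longrightarrow>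
        c * exp (- \<eta>0 * norm (b_pole b \<beta> j l)) \<le> dist (b_pole b \<beta> j l) (b_pole b \<beta> r k)"
    using assms eta0(1) unfolding poles_apart_def by meson
  define c1 where "c1 = min c 1"
  have c1: "c1 > 0" "c1 \<le> 1" "c1 \<le> c" using c(1) by (auto simp: c1_def)
  \<comment> \<open>A lower bound for the factors by which distances in s are scaled in the Gamma
    arguments; the cap 1/2 ensures \<open>\<kappa> * \<rho> \<le> 1/2\<close>.\<close>
  obtain \<kappa> where kappa: "\<kappa> > 0" "\<kappa> \<le> 1/2" "\<And>j. j \<in> {1..m} \<Longrightarrow> \<kappa> \<le> \<beta> j"
    by (rule finite_uniform_lower_bound[of "{1..m}" \<beta> "1/2"]) (use beta_pos' in auto)
  obtain Ya where Ya: "\<forall>u\<in>a_poles. Ya < Re u" using a_poles_bounded_left by blast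
  define C where "C = (2 / (\<kappa> * c1)) ^ m * exp (\<eta> / 2 * K) * exp \<eta>"
  \<comment> \<open>Three thresholds: T + 1 keeps the circle where the decay estimate holds, 1 - Ya
    keeps the disc to the left of the poles of the second product, and 0 makes |Re u| equal to - Re
    u.\<close>
  have "norm (residue integrand u) \<le> C * exp (\<eta> / 2 * Re u)"
    if j: "j \<in> {1..m}" and u: "u = b_pole b \<beta> j l" and left: "Re u \<le> - (max (T + 1) (max 0 (1 - Ya)))" for j l u
  proof -
    define E where "E = exp (- \<eta>0 * norm u)"
    have E: "0 < E" "E \<le> 1" using eta0 by (auto simp: E_def)
    \<comment> \<open>Half the guaranteed separation: the circle then has distance \<rho> from u and
      at least \<rho> from every other pole.\<close>
    define \<rho> where "\<rho> = c1 * E / 2"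
    have rho0: "\<rho> > 0" using c1 E by (simp add: \<rho>_def)
    have "c1 * E \<le> 1 * 1" using c1 E by (intro mult_mono) auto
    then have rho1: "\<rho> \<le> 1 / 2" by (simp add: \<rho>_def)
    have far: "2 * \<rho> \<le> dist u v" if "v \<in> b_poles" "v \<noteq> u" for v
    proof -
      obtain r k where v: "v = b_pole b \<beta> r k" "r \<in> {1..m}" using \<open>v \<in> b_poles\<close> unfolding b_poles_def by blast
      have "c1 * E \<le> c * E" using c1 E by simp
      also have "\<dots> \<le> dist u v" unfolding E_def u v(1) by (rule c(2)) (use j v u that in auto)
      finally show ?thesis by (simp add: \<rho>_def)
    qed
    have "(ball u (2 * \<rho>) - {u}) \<inter> (b_poles \<union> a_poles) = {}"
    proof -
      have "v \<notin> a_poles" if "v \<in> ball u (2 * \<rho>)" for v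
      proof -
        have "norm (v - u) < 1" using that rho1 by (simp add: dist_norm norm_minus_commute)
        then have "Re v < Re u + 1" using complex_Re_le_cmod[of "v - u"] by simp
        then have "Re v < Ya" using left by simp
        then show ?thesis using Ya by force
      qed
      then show ?thesis using far by fastforce
    qed
    then have "integrand holomorphic_on ball u (2 * \<rho>) - {u}" by (rule kernel_holomorphic)
    then have ci: "(integrand has_contour_integral 2 * pi * \<i> * residue integrand u) (circlepath u \<rho>)"
      by (intro base_residue[of "ball u (2 * \<rho>)"]) (use rho0 in auto)
    define B where "B = (1 / (\<kappa> * \<rho>)) ^ m * exp (\<eta> * (Re u + 1))"
    have B0: "B \<ge> 0" using kappa rho0 by (simp add: B_def)
    have "norm (2 * pi * \<i> * residue integrand u) \<le> B * (2 * pi * \<rho>)"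
    proof (rule has_contour_integral_bound_circlepath[OF ci B0 rho0])
      fix s assume s: "norm (s - u) = \<rho>"
      have Re: "Re s \<le> Re u + 1" using complex_Re_le_cmod[of "s - u"] s rho1 by simp
      have "norm (integrand s) \<le> (1 / (\<kappa> * \<rho>)) ^ m * exp (\<eta> * Re s)"
      proof (rule decay)
        show "Re s \<le> - T" using Re left by simp
        show "\<bar>Im s\<bar> \<le> K + 1"
          using abs_Im_le_cmod[of "s - u"] s rho1 ImK[OF j, of l] u by simp
        show "0 < \<kappa> * \<rho>" using kappa rho0 by simp
        have "\<kappa> * \<rho> \<le> 1/2 * 1" using kappa rho0 rho1 by (intro mult_mono) auto
        then show "\<kappa> * \<rho> \<le> 1/2" by simp
        show "\<forall>j\<in>{1..m}. \<forall>l. \<kappa> * \<rho> \<le> norm (b j + of_real (\<beta> j) * s + of_nat l)"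
        proof (intro ballI allI)
          fix i k assume i: "i \<in> {1..m}"
          have "\<rho> \<le> norm (s - b_pole b \<beta> i k)"
          proof (cases "b_pole b \<beta> i k = u")
            case False
            have "b_pole b \<beta> i k \<in> b_poles" using i unfolding b_poles_def by blast
            from far[OF this False] have "2 * \<rho> \<le> norm (u - b_pole b \<beta> i k)" by (simp add: dist_norm)
            also have "\<dots> \<le> norm (u - s) + norm (s - b_pole b \<beta> i k)"
              using norm_triangle_ineq[of "u - s" "s - b_pole b \<beta> i k"] by simp
            finally show ?thesis using s by (simp add: norm_minus_commute)
          qed (use s in simp)
          then have "\<kappa> * \<rho> \<le> \<beta> i * norm (s - b_pole b \<beta> i k)"
            using kappa(1) kappa(3)[OF i] rho0 by (intro mult_mono) auto
          then show "\<kappa> * \<rho> \<le> norm (b i + of_real (\<beta> i) * s + of_nat k)"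
            unfolding b_pole_dist[OF i] .
        qed
      qed
      also have "\<dots> \<le> B" unfolding B_def using kappa rho0 eta Re by (intro mult_left_mono) auto
      finally show "norm (integrand s) \<le> B" .
    qed
    then have "2 * pi * norm (residue integrand u) \<le> 2 * pi * (B * \<rho>)"
      by (simp add: norm_mult mult_ac)
    then have "norm (residue integrand u) \<le> B * \<rho>" by simp
    also have "\<dots> \<le> B" using B0 rho1 mult_left_mono[of \<rho> 1 B] by simp
    also have "\<dots> \<le> C * exp (\<eta> / 2 * Re u)"
    proof -
      have "1 / (\<kappa> * \<rho>) = 2 / (\<kappa> * c1) * exp (\<eta>0 * norm u)"
        using kappa c1 by (simp add: \<rho>_def E_def exp_minus field_simps)
      moreover have "exp (\<eta>0 * norm u) ^ m = exp (real m * \<eta>0 * norm u)"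
        by (simp add: mult.assoc flip: exp_of_nat_mult)
      ultimately have "B = (2 / (\<kappa> * c1)) ^ m * exp (real m * \<eta>0 * norm u) * exp (\<eta> * (Re u + 1))"
        unfolding B_def by (simp only: power_mult_distrib)
      also have "\<dots> = (2 / (\<kappa> * c1)) ^ m * exp (real m * \<eta>0 * norm u + \<eta> * (Re u + 1))"
        by (simp add: exp_add)
      also have "\<dots> \<le> (2 / (\<kappa> * c1)) ^ m * exp (\<eta> / 2 * K + \<eta> + \<eta> / 2 * Re u)"
      proof -
        \<comment> \<open>The poles lie in a horizontal strip, so a loss measured by |u| can be
          charged to decay measured by Re u.\<close>
        have "norm u \<le> K - Re u" using cmod_le[of u] ImK[OF j, of l] u left by simp
        then have "real m * \<eta>0 * norm u \<le> \<eta> / 2 * (K - Re u)"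
          using eta0 eta by (intro mult_mono) auto
        then have "real m * \<eta>0 * norm u + \<eta> * (Re u + 1) \<le> \<eta> / 2 * K + \<eta> + \<eta> / 2 * Re u"
          by (simp add: algebra_simps)
        then show ?thesis using kappa c1 by (intro mult_left_mono) auto
      qed
      also have "\<dots> = C * exp (\<eta> / 2 * Re u)" by (simp add: C_def exp_add)
      finally show ?thesis .
    qed
    finally show ?thesis .
  qed
  then show ?thesis using eta by (intro exI[of _ C] exI[of _ "\<eta> / 2"] exI[of _ "max (T + 1) (max 0 (1 - Ya))"]) auto
qed

text \<open>For fixed j the poles form an arithmetic progression with step - 1 / \<beta>_j, so
  exponential decay means comparison with a geometric series. All pairs are summed, repetitions
  included, so that every choice of pairs inherits summability.\<close>

lemma residues_abs_summable:
  assumes "poles_apart m b \<beta>"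
  shows "(\<lambda>x. norm (case x of (j, l) \<Rightarrow> residue integrand (b_pole b \<beta> j l))) summable_on ({1..m} \<times> UNIV)"
proof -
  obtain C \<eta> T where eta: "\<eta> > 0" and bound: "\<And>j l. j \<in> {1..m} \<Longrightarrow> Re (b_pole b \<beta> j l) \<le> - T \<Longrightarrow>
      norm (residue integrand (b_pole b \<beta> j l)) \<le> C * exp (\<eta> * Re (b_pole b \<beta> j l))"
    using residue_decay[OF assms] by blast
  have "(\<lambda>x. norm (case x of (j, l) \<Rightarrow> residue integrand (b_pole b \<beta> j l))) summable_on (\<Union>j\<in>{1..m}. {j} \<times> UNIV)"
  proof (rule summable_on_finite_union_disjoint)
    fix j assume j: "j \<in> {1..m}"
    define r where "r = exp (- \<eta> / \<beta> j)"
    define D where "D = C * exp (- \<eta> * Re (b j) / \<beta> j)"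
    have bj: "\<beta> j > 0" using beta_pos'[OF j] .
    have r: "0 < r" "r < 1" using eta bj by (auto simp: r_def)
    have "summable (\<lambda>l. norm (residue integrand (b_pole b \<beta> j l)))"
    proof (rule summable_comparison_test_ev)
      show "summable (\<lambda>l. D * r ^ l)" using r by (intro summable_mult summable_geometric) auto
      have "\<forall>\<^sub>F l in sequentially. real l \<ge> T * \<beta> j - Re (b j)"
        using filterlim_real_sequentially by (auto simp: filterlim_at_top)
      then show "\<forall>\<^sub>F l in sequentially. norm (norm (residue integrand (b_pole b \<beta> j l))) \<le> D * r ^ l"
      proof eventually_elim
        case (elim l)
        have "T \<le> (Re (b j) + real l) / \<beta> j" using elim bj by (simp add: pos_le_divide_eq)
        then have "Re (b_pole b \<beta> j l) \<le> - T" unfolding Re_b_pole by simp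
        from bound[OF j this] have "norm (residue integrand (b_pole b \<beta> j l)) \<le> C * exp (\<eta> * Re (b_pole b \<beta> j l))" .
        also have "\<eta> * Re (b_pole b \<beta> j l) = - \<eta> * Re (b j) / \<beta> j + real l * (- \<eta> / \<beta> j)"
          using bj unfolding Re_b_pole by (simp add: field_simps)
        also have "C * exp \<dots> = D * r ^ l" by (simp only: D_def r_def exp_add exp_of_nat_mult mult.assoc)
        finally show ?case by simp
      qed
    qed
    then have "(\<lambda>l. norm (residue integrand (b_pole b \<beta> j l))) summable_on UNIV"
      by (subst summable_on_UNIV_nonneg_real_iff) auto
    then have "((\<lambda>x. norm (case x of (j, l) \<Rightarrow> residue integrand (b_pole b \<beta> j l))) \<circ> Pair j) summable_on UNIV"
      by (simp add: o_def)
    then have "(\<lambda>x. norm (case x of (j, l) \<Rightarrow> residue integrand (b_pole b \<beta> j l))) summable_on (Pair j ` UNIV)"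
      by (subst summable_on_reindex) (auto simp: inj_on_def)
    also have "Pair j ` UNIV = {j} \<times> UNIV" by auto
    finally show "(\<lambda>x. norm (case x of (j, l) \<Rightarrow> residue integrand (b_pole b \<beta> j l))) summable_on ({j} \<times> UNIV)" .
  qed auto
  moreover have "(\<Union>j\<in>{1..m}. {j} \<times> UNIV) = {1..m} \<times> (UNIV :: nat set)" by auto
  ultimately show ?thesis by simp
qed

end

context H_loop
begin

text \<open>For a summable family the truncations by \<open>right_of\<close> are one exhaustion by
  finite sets among many, so the limit along a gap sequence equals the unordered sum. This sum
  splits because both parts are summable on their own.\<close>

lemma H_fun_eq_infsum:
  assumes apart: "poles_apart m b \<beta>" and S: "is_pole_choice m b \<beta> S"
  shows "simple_term m n p q a \<alpha> b \<beta> w summable_on simple_pairs m b \<beta>"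
    and "multiple_term m n p q a \<alpha> b \<beta> w summable_on S"
    and "H_fun m n p q a \<alpha> b \<beta> \<phi>1 \<phi>2 X g w =
        (\<Sum>\<^sub>\<infinity>x\<in>simple_pairs m b \<beta>. simple_term m n p q a \<alpha> b \<beta> w x) +
        (\<Sum>\<^sub>\<infinity>x\<in>S. multiple_term m n p q a \<alpha> b \<beta> w x)"
proof -
  note props = pole_choice_props[OF S]
  let ?\<tau> = "\<lambda>(j, l). residue integrand (b_pole b \<beta> j l)"
  have sm: "?\<tau> summable_on B" if "B \<subseteq> {1..m} \<times> UNIV" for B
    using summable_on_subset_banach[OF Infinite_Sum.abs_summable_summable[OF residues_abs_summable[OF apart]] that] .
  have eq1: "?\<tau> x = simple_term m n p q a \<alpha> b \<beta> w x" if "x \<in> simple_pairs m b \<beta>" for x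
  proof -
    have "fst x \<in> {1..m}" "pole_N m b \<beta> (fst x) (snd x) = 1" using that unfolding simple_pairs_def by auto
    then show ?thesis
      using residue_eq_multiple_term[of "fst x" w "snd x"] simple_term_eq_multiple_term[of "fst x" "snd x" w]
      by (simp add: case_prod_beta)
  qed
  have eq2: "?\<tau> x = multiple_term m n p q a \<alpha> b \<beta> w x" if "x \<in> S" for x
  proof -
    have "fst x \<in> {1..m}" using props(4) that by auto
    then show ?thesis using residue_eq_multiple_term[of "fst x" w "snd x"] by (simp add: case_prod_beta)
  qed
  have s1: "?\<tau> summable_on simple_pairs m b \<beta>" and s2: "?\<tau> summable_on S"
    by (intro sm, use props(4) in blast)+
  show "simple_term m n p q a \<alpha> b \<beta> w summable_on simple_pairs m b \<beta>"
    by (rule summable_on_cong[THEN iffD1, OF eq1 s1])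
  show "multiple_term m n p q a \<alpha> b \<beta> w summable_on S"
    by (rule summable_on_cong[THEN iffD1, OF eq2 s2])
  let ?A = "simple_pairs m b \<beta> \<union> S"
  obtain R where R: "pole_gaps m b \<beta> R" using pole_gaps_exist by blast
  have "(?\<tau> has_sum infsum ?\<tau> ?A) ?A" using sm[OF props(4)] by (rule has_sum_infsum)
  then have lim: "(sum ?\<tau> \<longlongrightarrow> infsum ?\<tau> ?A) (finite_subsets_at_top ?A)" unfolding has_sum_def .
  have "filterlim (\<lambda>k. ?A \<inter> right_of b \<beta> (R k)) (finite_subsets_at_top ?A) sequentially"
    unfolding filterlim_finite_subsets_at_top
  proof (intro allI impI)
    fix F assume F: "finite F \<and> F \<subseteq> ?A"
    have "\<forall>\<^sub>F k in sequentially. \<forall>x\<in>F. - Re (b_pole b \<beta> (fst x) (snd x)) < R k"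
    proof (rule eventually_ball_finite)
      show "\<forall>x\<in>F. \<forall>\<^sub>F k in sequentially. - Re (b_pole b \<beta> (fst x) (snd x)) < R k"
        using R unfolding pole_gaps_def filterlim_at_top_dense by blast
    qed (use F in blast)
    then show "\<forall>\<^sub>F k in sequentially. finite (?A \<inter> right_of b \<beta> (R k)) \<and>
        F \<subseteq> ?A \<inter> right_of b \<beta> (R k) \<and> ?A \<inter> right_of b \<beta> (R k) \<subseteq> ?A"
    proof eventually_elim
      case (elim k)
      have "finite (?A \<inter> right_of b \<beta> (R k))"
        by (rule finite_subset[OF _ finite_b_indices[of "R k"]]) (use props(4) in \<open>auto simp: right_of_def\<close>)
      moreover have "F \<subseteq> right_of b \<beta> (R k)" using elim by (force simp: right_of_def)
      ultimately show ?case using F by blast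
    qed
  qed
  from filterlim_compose[OF lim this]
  have lim1: "(\<lambda>k. sum ?\<tau> (?A \<inter> right_of b \<beta> (R k))) \<longlonglongrightarrow> infsum ?\<tau> ?A" .
  have "sum ?\<tau> (?A \<inter> right_of b \<beta> r) = (\<Sum>u\<in>{u\<in>b_poles. - r < Re u}. residue integrand u)" for r
  proof -
    have img: "{u\<in>b_poles. - r < Re u} = (\<lambda>(j, l). b_pole b \<beta> j l) ` (?A \<inter> right_of b \<beta> r)"
      unfolding props(3) [symmetric] by (auto simp: right_of_def)
    show ?thesis unfolding img
      by (subst sum.reindex) (auto intro!: inj_on_subset[OF props(2)] sum.cong)
  qed
  note sum_eq = this
  have "H_fun m n p q a \<alpha> b \<beta> \<phi>1 \<phi>2 X g w = infsum ?\<tau> ?A"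
    by (rule LIMSEQ_unique[OF residue_sums_tendsto[OF R] lim1[unfolded sum_eq]])
  also have "\<dots> = infsum ?\<tau> (simple_pairs m b \<beta>) + infsum ?\<tau> S"
    by (rule infsum_Un_disjoint[OF s1 s2 props(1)])
  also have "infsum ?\<tau> (simple_pairs m b \<beta>) = (\<Sum>\<^sub>\<infinity>x\<in>simple_pairs m b \<beta>. simple_term m n p q a \<alpha> b \<beta> w x)"
    by (rule infsum_cong) (rule eq1)
  also have "infsum ?\<tau> S = (\<Sum>\<^sub>\<infinity>x\<in>S. multiple_term m n p q a \<alpha> b \<beta> w x)"
    by (rule infsum_cong) (rule eq2)
  finally show "H_fun m n p q a \<alpha> b \<beta> \<phi>1 \<phi>2 X g w =
        (\<Sum>\<^sub>\<infinity>x\<in>simple_pairs m b \<beta>. simple_term m n p q a \<alpha> b \<beta> w x) +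
        (\<Sum>\<^sub>\<infinity>x\<in>S. multiple_term m n p q a \<alpha> b \<beta> w x)" .
qed

end

text \<open>The existence of a gap sequence keeps the limit statement from being vacuous. That limit
  concerns the two truncated sums taken together; convergence of each separately is claimed only
  under \<open>poles_apart\<close>.\<close>

theorem theorem5:
  fixes m n p q :: nat
    and a b :: "nat \<Rightarrow> complex" and \<alpha> \<beta> :: "nat \<Rightarrow> real"
    and z w :: complex
    and \<phi>1 \<phi>2 X :: real and g :: "real \<Rightarrow> complex"
    and S :: "(nat \<times> nat) set"
  assumes "m \<le> q" and "n \<le> p"
    and "\<And>i. i \<in> {1..p} \<Longrightarrow> \<alpha> i > 0"
    and "\<And>j. j \<in> {1..q} \<Longrightarrow> \<beta> j > 0"
    and "\<And>i j k l :: nat. i \<in> {1..n} \<Longrightarrow> j \<in> {1..m} \<Longrightarrow>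
           of_real (\<beta> j) * (a i - 1 - of_nat k) \<noteq> of_real (\<alpha> i) * (b j + of_nat l)"
    and "H_Delta p q \<alpha> \<beta> > 0 \<and> z \<noteq> 0 \<or>
         H_Delta p q \<alpha> \<beta> = 0 \<and> 0 < norm z \<and> norm z < H_delta p q \<alpha> \<beta>"
    and "exp w = z"
    and "is_H_loop m n a \<alpha> b \<beta> \<phi>1 \<phi>2 X g"
    and "is_pole_choice m b \<beta> S"
  shows "(\<exists>R. pole_gaps m b \<beta> R) \<and>
    (\<forall>R. pole_gaps m b \<beta> R \<longrightarrow>
      (\<lambda>k. (\<Sum>x\<in>simple_pairs m b \<beta> \<inter> right_of b \<beta> (R k). simple_term m n p q a \<alpha> b \<beta> w x) +
           (\<Sum>x\<in>S \<inter> right_of b \<beta> (R k). multiple_term m n p q a \<alpha> b \<beta> w x))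
        \<longlonglongrightarrow> H_fun m n p q a \<alpha> b \<beta> \<phi>1 \<phi>2 X g w) \<and>
    (poles_apart m b \<beta> \<longrightarrow>
      simple_term m n p q a \<alpha> b \<beta> w summable_on simple_pairs m b \<beta> \<and>
      multiple_term m n p q a \<alpha> b \<beta> w summable_on S \<and>
      H_fun m n p q a \<alpha> b \<beta> \<phi>1 \<phi>2 X g w =
        (\<Sum>\<^sub>\<infinity>x\<in>simple_pairs m b \<beta>. simple_term m n p q a \<alpha> b \<beta> w x) +
        (\<Sum>\<^sub>\<infinity>x\<in>S. multiple_term m n p q a \<alpha> b \<beta> w x))"
proof -
  have "norm z = exp (Re w)" using \<open>exp w = z\<close> norm_exp_eq_Re by blast
  then interpret H_convergent m n p q a b \<alpha> \<beta> w
    using assms(1-6) by unfold_locales auto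
  interpret H_loop m n p q a b \<alpha> \<beta> w \<phi>1 \<phi>2 X g
    using assms(8) unfolding is_H_loop_def by unfold_locales auto
  show ?thesis
    using pole_gaps_exist residue_sums_tendsto H_fun_eq_infsum[OF _ assms(9)]
    unfolding residue_sum_eq_terms[OF assms(9)] by blast
qed

end
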